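(* Let $\Gamma$ be a finitely generated charfinite group satisfying the conditions: (1) $Rad(\Gamma)=\{e\}$; (2) $\Gamma$ contains a distorted element of infinite order. Then $\Gamma$ has non-factorizable regular character.
   Context: Let $\Gamma$ be a countable discrete group. A character on $\Gamma$ is a function $\phi:\Gamma\to\mathbb{C}$ that is positive definite, conjugation-invariant and normalized ($\phi(e)=1$); it is extremal if it is an extreme point of the convex set of characters. $\Gamma$ has non-factorizable regular character if for any characters $\phi,\psi$ on $\Gamma$ with $\phi(s)\psi(s)=0$ for all $s\neq e$, one has $\phi\equiv\delta_e$ or $\psi\equiv\delta_e$ ($\delta_e$ the Dirac function at $e$). $Rad(\Gamma)$ is the amenable radical, i.e. the largest amenable normal subgroup of $\Gamma$. $\mathcal{P}(\Gamma)\subset\ell^\infty(\Gamma)$ is the convex set of normalized positive definite functions with the weak$^*$-topology, on which $\Gamma$ acts by conjugation. A character with GNS representation $(\pi,H)$ is called amenable if $\pi\otimes\bar\pi$ weakly contains the trivial representation; von Neumann amenable if moreover $\pi(\Gamma)''$ is an amenable von Neumann algebra; finite if $H$ is finite dimensional. $\Gamma$ is charfinite if: (a) every non-empty $\Gamma$-invariant compact convex subset of $\mathcal{P}(\Gamma)$ contains a fixed point for the conjugation action (i.e. a character); (b) every extremal character is either supported on $Rad(\Gamma)$ or von Neumann amenable; (c) $Rad(\Gamma)$ is finite; (d) $\Gamma$ has a finite number of isomorphism classes of unitary representations in each given finite dimension; (e) every amenable extremal character is finite. If $S$ is a finite generating set of $\Gamma$ with word length $\ell_S$, an element $\gamma\in\Gamma$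 is distorted if $\liminf_{n\to\infty}\ell_S(\gamma^n)/n=0$. *)

theory Defs
  imports "HOL-Analysis.Analysis" "HOL-Algebra.Generated_Groups"
begin

text \<open>
  Conventions. A discrete group is a HOL-Algebra group \<open>G\<close>. A complex function on \<open>G\<close> is
  represented by a total function that vanishes outside \<open>carrier G\<close>, so that equality of
  functions on the group is equality in HOL. All inner products are linear in the first argument.
\<close>

definition group_functions :: "('a, 'b) monoid_scheme \<Rightarrow> ('a \<Rightarrow> complex) set" where
  "group_functions G = {\<phi>. \<forall>x. x \<notin> carrier G \<longrightarrow> \<phi> x = 0}"

definition positive_definite :: "('a, 'b) monoid_scheme \<Rightarrow> ('a \<Rightarrow> complex) \<Rightarrow> bool" where
  "positive_definite G \<phi> \<longleftrightarrow>
     (\<forall>F c. finite F \<and> F \<subseteq> carrier G \<longrightarrow>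
        (\<Sum>x\<in>F. \<Sum>y\<in>F. c x * cnj (c y) * \<phi> (inv\<^bsub>G\<^esub> y \<otimes>\<^bsub>G\<^esub> x)) \<in> \<real>\<^sub>\<ge>\<^sub>0)"

definition normalized_pd :: "('a, 'b) monoid_scheme \<Rightarrow> ('a \<Rightarrow> complex) set" where
  "normalized_pd G = {\<phi> \<in> group_functions G. positive_definite G \<phi> \<and> \<phi> \<one>\<^bsub>G\<^esub> = 1}"

definition characters :: "('a, 'b) monoid_scheme \<Rightarrow> ('a \<Rightarrow> complex) set" where
  "characters G = {\<phi> \<in> normalized_pd G.
     \<forall>g\<in>carrier G. \<forall>x\<in>carrier G. \<phi> (g \<otimes>\<^bsub>G\<^esub> x \<otimes>\<^bsub>G\<^esub> inv\<^bsub>G\<^esub> g) = \<phi> x}"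

definition convex_comb :: "real \<Rightarrow> ('a \<Rightarrow> complex) \<Rightarrow> ('a \<Rightarrow> complex) \<Rightarrow> 'a \<Rightarrow> complex" where
  "convex_comb t \<phi> \<psi> = (\<lambda>x. of_real t * \<phi> x + of_real (1 - t) * \<psi> x)"

definition extremal_character :: "('a, 'b) monoid_scheme \<Rightarrow> ('a \<Rightarrow> complex) \<Rightarrow> bool" where
  "extremal_character G \<phi> \<longleftrightarrow> \<phi> \<in> characters G \<and>
     (\<forall>\<alpha>\<in>characters G. \<forall>\<psi>\<in>characters G. \<forall>t. 0 < t \<and> t < 1 \<and> \<phi> = convex_comb t \<alpha> \<psi>
        \<longrightarrow> \<alpha> = \<phi> \<and> \<psi> = \<phi>)"

definition dirac :: "('a, 'b) monoid_scheme \<Rightarrow> 'a \<Rightarrow> complex" where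
  "dirac G = (\<lambda>x. if x = \<one>\<^bsub>G\<^esub> then 1 else 0)"

definition nonfactorizable_regular_character :: "('a, 'b) monoid_scheme \<Rightarrow> bool" where
  "nonfactorizable_regular_character G \<longleftrightarrow>
     (\<forall>\<phi>\<in>characters G. \<forall>\<psi>\<in>characters G.
        (\<forall>s\<in>carrier G. s \<noteq> \<one>\<^bsub>G\<^esub> \<longrightarrow> \<phi> s * \<psi> s = 0) \<longrightarrow> \<phi> = dirac G \<or> \<psi> = dirac G)"

definition linfty :: "('a, 'b) monoid_scheme \<Rightarrow> ('a \<Rightarrow> complex) set" where
  "linfty G = {\<phi> \<in> group_functions G. \<exists>C. \<forall>x\<in>carrier G. cmod (\<phi> x) \<le> C}"

text \<open>The topology \<open>\<sigma>(\<ell>\<^sup>\<infinity>, \<ell>\<^sup>1)\<close>; the choice \<open>U = UNIV\<close> makes \<open>linfty G\<close> its underlying space.\<close>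

definition weak_star :: "('a, 'b) monoid_scheme \<Rightarrow> ('a \<Rightarrow> complex) topology" where
  "weak_star G = topology_generated_by
     {{\<phi> \<in> linfty G. (\<Sum>\<^sub>\<infinity>x\<in>carrier G. f x * \<phi> x) \<in> U} | f U.
        (\<lambda>x. cmod (f x)) summable_on carrier G \<and> open U}"

definition conj_act :: "('a, 'b) monoid_scheme \<Rightarrow> 'a \<Rightarrow> ('a \<Rightarrow> complex) \<Rightarrow> 'a \<Rightarrow> complex" where
  "conj_act G g \<phi> = (\<lambda>x. if x \<in> carrier G then \<phi> (inv\<^bsub>G\<^esub> g \<otimes>\<^bsub>G\<^esub> x \<otimes>\<^bsub>G\<^esub> g) else 0)"

definition fixed_point_property :: "('a, 'b) monoid_scheme \<Rightarrow> bool" where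
  "fixed_point_property G \<longleftrightarrow>
     (\<forall>K. K \<subseteq> normalized_pd G \<and> K \<noteq> {} \<and> compactin (weak_star G) K
        \<and> (\<forall>\<phi>\<in>K. \<forall>\<psi>\<in>K. \<forall>t. 0 \<le> t \<and> t \<le> 1 \<longrightarrow> convex_comb t \<phi> \<psi> \<in> K)
        \<and> (\<forall>g\<in>carrier G. \<forall>\<phi>\<in>K. conj_act G g \<phi> \<in> K)
        \<longrightarrow> (\<exists>\<phi>\<in>K. \<forall>g\<in>carrier G. conj_act G g \<phi> = \<phi>))"

definition amenable_group :: "('a, 'b) monoid_scheme \<Rightarrow> bool" where
  "amenable_group G \<longleftrightarrow> group G \<and>
     (\<exists>\<mu> :: 'a set \<Rightarrow> real.
        (\<forall>A. A \<subseteq> carrier G \<longrightarrow> 0 \<le> \<mu> A) \<and> \<mu> (carrier G) = 1 \<and>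
        (\<forall>A B. A \<subseteq> carrier G \<and> B \<subseteq> carrier G \<and> A \<inter> B = {} \<longrightarrow> \<mu> (A \<union> B) = \<mu> A + \<mu> B) \<and>
        (\<forall>g\<in>carrier G. \<forall>A. A \<subseteq> carrier G \<longrightarrow> \<mu> (g <#\<^bsub>G\<^esub> A) = \<mu> A))"

definition amenable_radical :: "('a, 'b) monoid_scheme \<Rightarrow> 'a set" where
  "amenable_radical G = (GREATEST N. normal N G \<and> amenable_group (G\<lparr>carrier := N\<rparr>))"

text \<open>
  Hilbert spaces are closed subspaces of \<open>\<ell>\<^sup>2(I)\<close>, with \<open>I\<close> the universe of an index type;
  up to isomorphism, index type \<^typ>\<open>nat\<close> gives all separable ones.
\<close>

definition ell2 :: "('i \<Rightarrow> complex) set" where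
  "ell2 = {f. (\<lambda>i. (cmod (f i))\<^sup>2) summable_on UNIV}"

definition ell2_inner :: "('i \<Rightarrow> complex) \<Rightarrow> ('i \<Rightarrow> complex) \<Rightarrow> complex" where
  "ell2_inner f g = (\<Sum>\<^sub>\<infinity>i. f i * cnj (g i))"

definition ell2_norm :: "('i \<Rightarrow> complex) \<Rightarrow> real" where
  "ell2_norm f = sqrt (\<Sum>\<^sub>\<infinity>i. (cmod (f i))\<^sup>2)"

definition closed_subspace :: "('i \<Rightarrow> complex) set \<Rightarrow> bool" where
  "closed_subspace V \<longleftrightarrow> V \<subseteq> ell2 \<and> (\<lambda>i. 0) \<in> V \<and>
     (\<forall>f\<in>V. \<forall>g\<in>V. (\<lambda>i. f i + g i) \<in> V) \<and>
     (\<forall>c. \<forall>f\<in>V. (\<lambda>i. c * f i) \<in> V) \<and>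
     (\<forall>f\<in>ell2. (\<forall>\<epsilon>>0. \<exists>g\<in>V. ell2_norm (\<lambda>i. f i - g i) < \<epsilon>) \<longrightarrow> f \<in> V)"

definition closed_span :: "('i \<Rightarrow> complex) set \<Rightarrow> ('i \<Rightarrow> complex) set" where
  "closed_span A = \<Inter>{V. closed_subspace V \<and> A \<subseteq> V}"

definition finite_dimensional :: "('i \<Rightarrow> complex) set \<Rightarrow> bool" where
  "finite_dimensional V \<longleftrightarrow>
     (\<exists>B. finite B \<and> B \<subseteq> V \<and> (\<forall>v\<in>V. \<exists>c. v = (\<lambda>i. \<Sum>b\<in>B. c b * b i)))"

definition euclidean_Cn :: "nat \<Rightarrow> (nat \<Rightarrow> complex) set" where
  "euclidean_Cn n = {f. \<forall>i\<ge>n. f i = 0}"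

definition linear_map_on ::
  "('i \<Rightarrow> complex) set \<Rightarrow> (('i \<Rightarrow> complex) \<Rightarrow> ('j \<Rightarrow> complex)) \<Rightarrow> bool" where
  "linear_map_on V T \<longleftrightarrow>
     (\<forall>f\<in>V. \<forall>g\<in>V. T (\<lambda>i. f i + g i) = (\<lambda>j. T f j + T g j)) \<and>
     (\<forall>c. \<forall>f\<in>V. T (\<lambda>i. c * f i) = (\<lambda>j. c * T f j))"

definition unitary_map ::
  "('i \<Rightarrow> complex) set \<Rightarrow> ('j \<Rightarrow> complex) set \<Rightarrow> (('i \<Rightarrow> complex) \<Rightarrow> ('j \<Rightarrow> complex)) \<Rightarrow> bool" where
  "unitary_map V W T \<longleftrightarrow> linear_map_on V T \<and> T ` V = W \<and>
     (\<forall>f\<in>V. \<forall>g\<in>V. ell2_inner (T f) (T g) = ell2_inner f g)"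

definition unitary_rep :: "('a, 'b) monoid_scheme \<Rightarrow> ('i \<Rightarrow> complex) set
    \<Rightarrow> ('a \<Rightarrow> ('i \<Rightarrow> complex) \<Rightarrow> ('i \<Rightarrow> complex)) \<Rightarrow> bool" where
  "unitary_rep G V \<pi> \<longleftrightarrow> closed_subspace V \<and>
     (\<forall>g\<in>carrier G. unitary_map V V (\<pi> g)) \<and>
     (\<forall>g\<in>carrier G. \<forall>h\<in>carrier G. \<forall>v\<in>V. \<pi> (g \<otimes>\<^bsub>G\<^esub> h) v = \<pi> g (\<pi> h v))"

definition reps_of_dim :: "('a, 'b) monoid_scheme \<Rightarrow> nat
    \<Rightarrow> ('a \<Rightarrow> (nat \<Rightarrow> complex) \<Rightarrow> (nat \<Rightarrow> complex)) set" where
  "reps_of_dim G n = {\<pi>. unitary_rep G (euclidean_Cn n) \<pi>}"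

definition rep_iso :: "('a, 'b) monoid_scheme \<Rightarrow> nat
    \<Rightarrow> (('a \<Rightarrow> (nat \<Rightarrow> complex) \<Rightarrow> (nat \<Rightarrow> complex))
        \<times> ('a \<Rightarrow> (nat \<Rightarrow> complex) \<Rightarrow> (nat \<Rightarrow> complex))) set" where
  "rep_iso G n = {(\<pi>, \<sigma>). \<pi> \<in> reps_of_dim G n \<and> \<sigma> \<in> reps_of_dim G n \<and>
     (\<exists>U. unitary_map (euclidean_Cn n) (euclidean_Cn n) U \<and>
        (\<forall>g\<in>carrier G. \<forall>v\<in>euclidean_Cn n. U (\<pi> g v) = \<sigma> g (U v)))}"

definition conj_space :: "('i \<Rightarrow> complex) set \<Rightarrow> ('i \<Rightarrow> complex) set" where
  "conj_space V = (\<lambda>f i. cnj (f i)) ` V"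

definition conj_rep :: "('a \<Rightarrow> ('i \<Rightarrow> complex) \<Rightarrow> ('i \<Rightarrow> complex))
    \<Rightarrow> 'a \<Rightarrow> ('i \<Rightarrow> complex) \<Rightarrow> ('i \<Rightarrow> complex)" where
  "conj_rep \<pi> g f = (\<lambda>i. cnj (\<pi> g (\<lambda>j. cnj (f j)) i))"

definition tensor :: "('i \<Rightarrow> complex) \<Rightarrow> ('j \<Rightarrow> complex) \<Rightarrow> 'i \<times> 'j \<Rightarrow> complex" where
  "tensor f g = (\<lambda>(i, j). f i * g j)"

definition tensor_space ::
  "('i \<Rightarrow> complex) set \<Rightarrow> ('j \<Rightarrow> complex) set \<Rightarrow> ('i \<times> 'j \<Rightarrow> complex) set" where
  "tensor_space V W = closed_span {tensor f g | f g. f \<in> V \<and> g \<in> W}"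

text \<open>These conditions determine \<open>\<rho>\<close> on \<open>tensor_space V W\<close>.\<close>

definition is_tensor_rep :: "('a, 'b) monoid_scheme
    \<Rightarrow> ('i \<Rightarrow> complex) set \<Rightarrow> ('a \<Rightarrow> ('i \<Rightarrow> complex) \<Rightarrow> ('i \<Rightarrow> complex))
    \<Rightarrow> ('j \<Rightarrow> complex) set \<Rightarrow> ('a \<Rightarrow> ('j \<Rightarrow> complex) \<Rightarrow> ('j \<Rightarrow> complex))
    \<Rightarrow> ('a \<Rightarrow> ('i \<times> 'j \<Rightarrow> complex) \<Rightarrow> ('i \<times> 'j \<Rightarrow> complex)) \<Rightarrow> bool" where
  "is_tensor_rep G V \<pi> W \<sigma> \<rho> \<longleftrightarrow> unitary_rep G (tensor_space V W) \<rho> \<and>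
     (\<forall>g\<in>carrier G. \<forall>f\<in>V. \<forall>h\<in>W. \<rho> g (tensor f h) = tensor (\<pi> g f) (\<sigma> g h))"

text \<open>
  Weak containment of \<open>(V, \<pi>)\<close> in \<open>(W, \<rho>)\<close>: functions of positive type associated to \<open>\<pi>\<close> are
  limits, uniformly on finite sets, of finite sums of functions of positive type associated to
  \<open>\<rho>\<close>.
\<close>

definition weakly_contained :: "('a, 'b) monoid_scheme
    \<Rightarrow> ('i \<Rightarrow> complex) set \<Rightarrow> ('a \<Rightarrow> ('i \<Rightarrow> complex) \<Rightarrow> ('i \<Rightarrow> complex))
    \<Rightarrow> ('j \<Rightarrow> complex) set \<Rightarrow> ('a \<Rightarrow> ('j \<Rightarrow> complex) \<Rightarrow> ('j \<Rightarrow> complex)) \<Rightarrow> bool" where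
  "weakly_contained G V \<pi> W \<rho> \<longleftrightarrow>
     (\<forall>\<xi>\<in>V. \<forall>F. finite F \<and> F \<subseteq> carrier G \<longrightarrow> (\<forall>\<epsilon>>0. \<exists>\<eta>s. set \<eta>s \<subseteq> W \<and>
        (\<forall>g\<in>F. cmod (ell2_inner (\<pi> g \<xi>) \<xi> - (\<Sum>\<eta>\<leftarrow>\<eta>s. ell2_inner (\<rho> g \<eta>) \<eta>)) < \<epsilon>)))"

definition amenable_rep :: "('a, 'b) monoid_scheme
    \<Rightarrow> ('i \<Rightarrow> complex) set \<Rightarrow> ('a \<Rightarrow> ('i \<Rightarrow> complex) \<Rightarrow> ('i \<Rightarrow> complex)) \<Rightarrow> bool" where
  "amenable_rep G V \<pi> \<longleftrightarrow>
     (\<exists>\<rho>. is_tensor_rep G V \<pi> (conj_space V) (conj_rep \<pi>) \<rho> \<and>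
        weakly_contained G (euclidean_Cn 1) (\<lambda>g v. v) (tensor_space V (conj_space V)) \<rho>)"

text \<open>
  Bounded operators on \<open>V\<close> are taken \<open>extensional\<close> on \<open>V\<close>, so that operators agreeing on \<open>V\<close>
  are equal.
\<close>

definition bounded_ops ::
  "('i \<Rightarrow> complex) set \<Rightarrow> (('i \<Rightarrow> complex) \<Rightarrow> ('i \<Rightarrow> complex)) set" where
  "bounded_ops V = {T \<in> extensional V. linear_map_on V T \<and> T ` V \<subseteq> V \<and>
     (\<exists>C. \<forall>v\<in>V. ell2_norm (T v) \<le> C * ell2_norm v)}"

definition commutant :: "('i \<Rightarrow> complex) set
    \<Rightarrow> (('i \<Rightarrow> complex) \<Rightarrow> ('i \<Rightarrow> complex)) set \<Rightarrow> (('i \<Rightarrow> complex) \<Rightarrow> ('i \<Rightarrow> complex)) set" where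
  "commutant V A = {T \<in> bounded_ops V. \<forall>S\<in>A. compose V S T = compose V T S}"

definition rep_von_neumann :: "('a, 'b) monoid_scheme
    \<Rightarrow> ('i \<Rightarrow> complex) set \<Rightarrow> ('a \<Rightarrow> ('i \<Rightarrow> complex) \<Rightarrow> ('i \<Rightarrow> complex))
    \<Rightarrow> (('i \<Rightarrow> complex) \<Rightarrow> ('i \<Rightarrow> complex)) set" where
  "rep_von_neumann G V \<pi> = commutant V (commutant V ((\<lambda>g. restrict (\<pi> g) V) ` carrier G))"

definition positive_op ::
  "('i \<Rightarrow> complex) set \<Rightarrow> (('i \<Rightarrow> complex) \<Rightarrow> ('i \<Rightarrow> complex)) \<Rightarrow> bool" where
  "positive_op V T \<longleftrightarrow> (\<forall>v\<in>V. ell2_inner (T v) v \<in> \<real>\<^sub>\<ge>\<^sub>0)"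

text \<open>
  Conditional expectations from the algebra of all bounded operators onto \<open>M\<close>; no normality is
  required.
\<close>

definition conditional_expectation :: "('i \<Rightarrow> complex) set
    \<Rightarrow> (('i \<Rightarrow> complex) \<Rightarrow> ('i \<Rightarrow> complex)) set
    \<Rightarrow> ((('i \<Rightarrow> complex) \<Rightarrow> ('i \<Rightarrow> complex)) \<Rightarrow> (('i \<Rightarrow> complex) \<Rightarrow> ('i \<Rightarrow> complex))) \<Rightarrow> bool" where
  "conditional_expectation V M E \<longleftrightarrow>
     (\<forall>T\<in>bounded_ops V. E T \<in> M) \<and>
     (\<forall>T\<in>M. E T = T) \<and>
     (\<forall>S\<in>bounded_ops V. \<forall>T\<in>bounded_ops V.
        E (\<lambda>v\<in>V. \<lambda>i. S v i + T v i) = (\<lambda>v\<in>V. \<lambda>i. E S v i + E T v i)) \<and>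
     (\<forall>c. \<forall>T\<in>bounded_ops V. E (\<lambda>v\<in>V. \<lambda>i. c * T v i) = (\<lambda>v\<in>V. \<lambda>i. c * E T v i)) \<and>
     (\<forall>T\<in>bounded_ops V. positive_op V T \<longrightarrow> positive_op V (E T)) \<and>
     (\<forall>A\<in>M. \<forall>B\<in>M. \<forall>T\<in>bounded_ops V.
        E (compose V A (compose V T B)) = compose V A (compose V (E T) B))"

text \<open>Amenability in the sense of injectivity; this does not depend on the Hilbert space.\<close>

definition amenable_von_neumann :: "('i \<Rightarrow> complex) set
    \<Rightarrow> (('i \<Rightarrow> complex) \<Rightarrow> ('i \<Rightarrow> complex)) set \<Rightarrow> bool" where
  "amenable_von_neumann V M \<longleftrightarrow> (\<exists>E. conditional_expectation V M E)"

text \<open>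
  The GNS triple of \<open>\<phi>\<close> is unique up to unitary equivalence. For countable \<open>G\<close> its Hilbert space is
  separable, so index type \<^typ>\<open>nat\<close> loses nothing.
\<close>

definition gns_triple :: "('a, 'b) monoid_scheme \<Rightarrow> ('a \<Rightarrow> complex) \<Rightarrow> (nat \<Rightarrow> complex) set
    \<Rightarrow> ('a \<Rightarrow> (nat \<Rightarrow> complex) \<Rightarrow> (nat \<Rightarrow> complex)) \<Rightarrow> (nat \<Rightarrow> complex) \<Rightarrow> bool" where
  "gns_triple G \<phi> V \<pi> \<xi> \<longleftrightarrow> unitary_rep G V \<pi> \<and> \<xi> \<in> V \<and>
     closed_span ((\<lambda>g. \<pi> g \<xi>) ` carrier G) = V \<and>
     (\<forall>g\<in>carrier G. \<phi> g = ell2_inner (\<pi> g \<xi>) \<xi>)"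

definition amenable_character :: "('a, 'b) monoid_scheme \<Rightarrow> ('a \<Rightarrow> complex) \<Rightarrow> bool" where
  "amenable_character G \<phi> \<longleftrightarrow> \<phi> \<in> characters G \<and>
     (\<exists>V \<pi> \<xi>. gns_triple G \<phi> V \<pi> \<xi> \<and> amenable_rep G V \<pi>)"

text \<open>Von Neumann amenability is imposed on top of amenability of the character.\<close>

definition von_neumann_amenable_character ::
  "('a, 'b) monoid_scheme \<Rightarrow> ('a \<Rightarrow> complex) \<Rightarrow> bool" where
  "von_neumann_amenable_character G \<phi> \<longleftrightarrow> \<phi> \<in> characters G \<and>
     (\<exists>V \<pi> \<xi>. gns_triple G \<phi> V \<pi> \<xi> \<and> amenable_rep G V \<pi> \<and>
        amenable_von_neumann V (rep_von_neumann G V \<pi>))"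

definition finite_character :: "('a, 'b) monoid_scheme \<Rightarrow> ('a \<Rightarrow> complex) \<Rightarrow> bool" where
  "finite_character G \<phi> \<longleftrightarrow> \<phi> \<in> characters G \<and>
     (\<exists>V \<pi> \<xi>. gns_triple G \<phi> V \<pi> \<xi> \<and> finite_dimensional V)"

definition charfinite :: "('a, 'b) monoid_scheme \<Rightarrow> bool" where
  "charfinite G \<longleftrightarrow>
     fixed_point_property G \<and>
     (\<forall>\<phi>. extremal_character G \<phi> \<longrightarrow>
        (\<forall>x. x \<notin> amenable_radical G \<longrightarrow> \<phi> x = 0) \<or> von_neumann_amenable_character G \<phi>) \<and>
     finite (amenable_radical G) \<and>
     (\<forall>n. finite (reps_of_dim G n // rep_iso G n)) \<and>
     (\<forall>\<phi>. extremal_character G \<phi> \<and> amenable_character G \<phi> \<longrightarrow> finite_character G \<phi>)"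

definition word_length :: "('a, 'b) monoid_scheme \<Rightarrow> 'a set \<Rightarrow> 'a \<Rightarrow> nat" where
  "word_length G S g = (LEAST n. \<exists>ws. length ws = n \<and> set ws \<subseteq> S \<union> (\<lambda>s. inv\<^bsub>G\<^esub> s) ` S \<and>
     foldr (\<lambda>x y. x \<otimes>\<^bsub>G\<^esub> y) ws \<one>\<^bsub>G\<^esub> = g)"

definition distorted :: "('a, 'b) monoid_scheme \<Rightarrow> 'a set \<Rightarrow> 'a \<Rightarrow> bool" where
  "distorted G S g \<longleftrightarrow>
     liminf (\<lambda>n. ereal (real (word_length G S (g [^]\<^bsub>G\<^esub> n)) / real n)) = 0"

end

theory Submission
  imports Defs "HOL-Complex_Analysis.Great_Picard" "HOL-Library.Ramsey"
begin

text \<open>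
  If the amenable radical is trivial, every extremal character other than \<open>\<delta>\<^sub>e\<close> is finite. An extremal
  finite character is determined by the isomorphism class of its GNS representation, so there are
  only countably many of them. As in Choquet's theorem, a character \<open>\<phi> \<noteq> \<delta>\<^sub>e\<close> then has an atom at one of
  them: \<open>\<phi> = t \<alpha> + (1 - t) \<phi>'\<close> with \<open>t > 0\<close> and \<open>\<alpha>\<close> finite.

  Suppose that \<open>\<phi>\<close> and \<open>\<psi>\<close> dominate the finite characters \<open>\<alpha>\<close> and \<open>\<beta>\<close> in this way. Orbits of
  finite-dimensional unitary representations are relatively compact, so there are infinitely many
  powers \<open>x\<^sub>k\<close> of \<open>\<gamma>\<close> such that \<open>\<alpha>\<close> and \<open>\<beta>\<close> are close to 1 at all \<open>x\<^sub>l\<^sup>-\<^sup>1 x\<^sub>k\<close>. If \<open>\<phi> \<psi> = \<delta>\<^sub>e\<close>, Ramsey's theorem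
  makes one of \<open>\<phi>\<close>, \<open>\<psi>\<close>, say \<open>\<phi>\<close>, vanish at \<open>x\<^sub>l\<^sup>-\<^sup>1 x\<^sub>k\<close> for all \<open>k \<noteq> l\<close> in an infinite set. On \<open>m\<close> of these
  indices the sum of the values \<open>\<phi> (x\<^sub>l\<^sup>-\<^sup>1 x\<^sub>k)\<close> is \<open>m\<close>, but positive definiteness of \<open>\<phi>'\<close> bounds it
  below by \<open>t m\<^sup>2 / 2\<close>.
\<close>

section \<open>Extreme points of compact convex sets\<close>

text \<open>An atom is needed because recurrence is available only for one finite-dimensional
  representation at a time: a measure on extreme points without atoms would give no single finite
  character of which \<phi> contains a positive share. Countability rules this out: a measure
  carried by \<open>dirac G\<close> and countably many other points, with no atom at the latter, is
  the point mass at \<open>dirac G\<close>, so \<phi> would be \<open>dirac G\<close>.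

  Measures are replaced by finite lists, read as equally weighted point masses. A representing
  measure that maximizes the integral of a strictly convex function lives on the extreme points;
  correspondingly, lists that nearly maximize the mean of such a function have few entries near
  midpoints of distant points.

  A vanishing product says only that at each \<open>x\<^sub>l\<^sup>-\<^sup>1 x\<^sub>k\<close> one
  of the two characters is zero, and which one may depend on the pair. The lower bound by positive
  definiteness needs the same character for all pairs, whence Ramsey's theorem.\<close>

definition list_mean :: "'v::real_normed_vector list \<Rightarrow> 'v" where
  "list_mean xs = sum_list xs /\<^sub>R real (length xs)"

definition list_freq :: "'v list \<Rightarrow> 'v set \<Rightarrow> real" where
  "list_freq xs B = real (length (filter (\<lambda>x. x \<in> B) xs)) / real (length xs)"

lemma list_mean_in_convex:
  assumes "convex C" "set xs \<subseteq> C" "xs \<noteq> []"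
  shows "list_mean xs \<in> C"
  using assms(3,2)
proof (induction xs rule: list_nonempty_induct)
  case (single x)
  then show ?case by (simp add: list_mean_def)
next
  case (cons x xs)
  let ?n = "real (length xs)"
  have n: "?n > 0" using cons.hyps by simp
  have "list_mean (x # xs) = (1 / (?n + 1)) *\<^sub>R x + (?n / (?n + 1)) *\<^sub>R list_mean xs"
    using n by (simp add: list_mean_def scaleR_add_right field_simps)
  moreover have "1 / (?n + 1) + ?n / (?n + 1) = 1"
    using n by (simp add: field_simps)
  moreover have "x \<in> C" "list_mean xs \<in> C" using cons by auto
  ultimately show ?case
    using convexD[OF assms(1), of x "list_mean xs" "1 / (?n + 1)" "?n / (?n + 1)"] n by simp
qed

text \<open>An empty half has mean 0 and weight 0, so the identity also covers lists that lie
  entirely inside or outside of \<open>B\<close>.\<close>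

lemma list_mean_filter:
  assumes "xs \<noteq> []"
  shows "list_mean xs = list_freq xs B *\<^sub>R list_mean (filter (\<lambda>x. x \<in> B) xs)
     + (1 - list_freq xs B) *\<^sub>R list_mean (filter (\<lambda>x. x \<notin> B) xs)"
proof -
  let ?p = "filter (\<lambda>x. x \<in> B) xs" and ?q = "filter (\<lambda>x. x \<notin> B) xs"
  have l: "real (length xs) = real (length ?p) + real (length ?q)"
    using sum_length_filter_compl[of "\<lambda>x. x \<in> B" xs] by (metis of_nat_add)
  have s: "sum_list xs = sum_list ?p + sum_list ?q"
    by (induction xs) (auto simp: algebra_simps)
  have n: "real (length xs) > 0" using assms by simp
  have p: "list_freq xs B *\<^sub>R list_mean ?p = sum_list ?p /\<^sub>R real (length xs)"
    by (cases "?p = []") (auto simp: list_freq_def list_mean_def field_simps)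
  have "1 - list_freq xs B = real (length ?q) / real (length xs)"
    using n l by (simp add: list_freq_def field_simps)
  then have q: "(1 - list_freq xs B) *\<^sub>R list_mean ?q = sum_list ?q /\<^sub>R real (length xs)"
    by (cases "?q = []") (auto simp: list_mean_def field_simps)
  show ?thesis unfolding p q by (simp add: list_mean_def s scaleR_add_right)
qed

lemma list_freq_bounds: "0 \<le> list_freq xs B" "list_freq xs B \<le> 1"
  by (auto simp: list_freq_def divide_le_eq_1)

lemma list_freq_Un: "list_freq xs (A \<union> B) \<le> list_freq xs A + list_freq xs B"
proof -
  have "length (filter (\<lambda>x. x \<in> A \<union> B) xs)
     \<le> length (filter (\<lambda>x. x \<in> A) xs) + length (filter (\<lambda>x. x \<in> B) xs)"
    by (induction xs) auto
  then show ?thesis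
    unfolding list_freq_def add_divide_distrib[symmetric]
    by (intro divide_right_mono) auto
qed

lemma list_freq_UN:
  "finite I \<Longrightarrow> list_freq xs (\<Union>i\<in>I. A i) \<le> (\<Sum>i\<in>I. list_freq xs (A i))"
proof (induction I rule: finite_induct)
  case empty
  then show ?case by (simp add: list_freq_def)
next
  case (insert i I)
  then show ?case using list_freq_Un[of xs "A i" "\<Union>i\<in>I. A i"] by simp
qed

lemma list_freq_superset: "xs \<noteq> [] \<Longrightarrow> set xs \<subseteq> B \<Longrightarrow> list_freq xs B = 1"
  by (auto simp: list_freq_def filter_id_conv[THEN iffD2] subset_iff)

text \<open>From an inner point of a segment one can step equally far in both directions, up to the
  nearer end. With midpoints, the distance of the two ends alone measures how far a point is from
  being extreme.\<close>

lemma not_extreme_point_midpoint: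
  assumes "convex K" "x \<in> K" "\<not> x extreme_point_of K"
  shows "\<exists>a\<in>K. \<exists>b\<in>K. a \<noteq> b \<and> x = midpoint a b"
proof -
  obtain a b where ab: "a \<in> K" "b \<in> K" "x \<in> open_segment a b"
    using assms unfolding extreme_point_of_def by blast
  then obtain u where u: "0 < u" "u < 1" "x = (1 - u) *\<^sub>R a + u *\<^sub>R b" "a \<noteq> b"
    unfolding in_segment by blast
  define q where "q = min u (1 - u)"
  have q: "0 < q" "q \<le> u" "u + q \<le> 1" using u by (auto simp: q_def)
  define p where "p v = (1 - v) *\<^sub>R a + v *\<^sub>R b" for v
  have p: "p v = a + v *\<^sub>R (b - a)" for v by (simp add: p_def algebra_simps)
  have x: "x = p u" using u(3) by (simp add: p_def)
  have "p (u - q) \<in> K" "p (u + q) \<in> K"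
    unfolding p_def using q u by (auto intro!: convexD[OF assms(1) ab(1,2)])
  moreover have "p (u - q) \<noteq> p (u + q)" using q u by (simp add: p)
  moreover have "p (u - q) + p (u + q) = x + x"
    unfolding x p by (simp only: scaleR_left_diff_distrib scaleR_left_distrib) simp
  then have "x = midpoint (p (u - q)) (p (u + q))"
    by (simp add: midpoint_def flip: scaleR_2)
  ultimately show ?thesis by blast
qed

section \<open>Near-optimal samples in place of maximal representing measures\<close>

locale strictly_convex_compact =
  fixes K :: "'v::real_normed_vector set" and f :: "'v \<Rightarrow> real" and \<phi> :: 'v
  assumes compact: "compact K" and convex: "convex K" and cont: "continuous_on K f"
    and strict: "\<And>a b. a \<in> K \<Longrightarrow> b \<in> K \<Longrightarrow> a \<noteq> b \<Longrightarrow> f (midpoint a b) < (f a + f b) / 2"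
    and point: "\<phi> \<in> K"
begin

text \<open>A nonempty list stands for the uniform probability measure on its entries, repetitions
  counted; the pair is its barycentre together with the integral of \<open>f\<close>.\<close>

definition samples :: "('v \<times> real) set" where
  "samples = {(list_mean xs, list_mean (map f xs)) | xs. xs \<noteq> [] \<and> set xs \<subseteq> K}"

text \<open>The value at \<open>\<phi>\<close> of the upper semicontinuous concave envelope of \<open>f\<close>.\<close>

definition top_value :: real where
  "top_value = Sup {r. (\<phi>, r) \<in> closure samples}"

text \<open>Up to the error \<kappa>, a measure with barycentre \<phi> and the largest possible
  integral of \<open>f\<close>.\<close>

definition near_optimal :: "real \<Rightarrow> 'v list \<Rightarrow> bool" where
  "near_optimal \<kappa> xs \<longleftrightarrow> xs \<noteq> [] \<and> set xs \<subseteq> K \<and> dist (list_mean xs) \<phi> < \<kappa>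
     \<and> list_mean (map f xs) > top_value - \<kappa>"

lemma near_optimal_mono: "near_optimal \<kappa> xs \<Longrightarrow> \<kappa> \<le> \<kappa>' \<Longrightarrow> near_optimal \<kappa>' xs"
  by (auto simp: near_optimal_def)

lemma compact_samples: "compact (closure samples)"
proof -
  have "compact (f ` K)" using compact cont by (rule compact_continuous_image[rotated])
  then have "bounded (f ` K)" by (rule compact_imp_bounded)
  then obtain C where C: "\<And>x. x \<in> K \<Longrightarrow> \<bar>f x\<bar> \<le> C"
    by (auto simp: bounded_iff)
  have "samples \<subseteq> K \<times> {-C..C}"
  proof
    fix p assume "p \<in> samples"
    then obtain xs where xs: "p = (list_mean xs, list_mean (map f xs))" "xs \<noteq> []" "set xs \<subseteq> K"
      unfolding samples_def by blast
    have "set (map f xs) \<subseteq> {-C..C}" using xs(3) C by (fastforce simp: abs_le_iff)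
    then show "p \<in> K \<times> {-C..C}"
      using xs list_mean_in_convex[OF convex xs(3,2)] list_mean_in_convex[of "{-C..C}" "map f xs"] 
      by auto
  qed
  moreover have "compact (K \<times> {-C..C})" using compact by (intro compact_Times) auto
  ultimately have "closure samples \<subseteq> K \<times> {-C..C}" "compact (K \<times> {-C..C})"
    using closure_minimal[OF _ compact_imp_closed] by blast+
  then show ?thesis
    using compact_Int_closed[of "K \<times> {-C..C}" "closure samples"] by (simp add: inf.absorb2)
qed

lemma top_value_attained: "(\<phi>, top_value) \<in> closure samples"
  and top_value_upper: "(\<phi>, r) \<in> closure samples \<Longrightarrow> r \<le> top_value"
proof -
  let ?R = "{r. (\<phi>, r) \<in> closure samples}"
  have R: "?R = snd ` (closure samples \<inter> ({\<phi>} \<times> UNIV))" by force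
  have "compact (closure samples \<inter> ({\<phi>} \<times> UNIV))"
    by (intro compact_Int_closed compact_samples closed_Times) auto
  then have c: "compact ?R"
    unfolding R by (intro compact_continuous_image continuous_intros)
  have "(list_mean [\<phi>], list_mean (map f [\<phi>])) \<in> samples"
    unfolding samples_def using point by (intro CollectI exI[of _ "[\<phi>]"]) simp
  then have ne: "?R \<noteq> {}"
    using closure_subset[of samples] by (auto simp: list_mean_def)
  have bd: "bdd_above ?R" using c by (simp add: bounded_imp_bdd_above compact_imp_bounded)
  have "Sup ?R \<in> ?R"
    using closed_contains_Sup[OF ne bd compact_imp_closed[OF c]] .
  then show "(\<phi>, top_value) \<in> closure samples" by (simp add: top_value_def)
  show "(\<phi>, r) \<in> closure samples \<Longrightarrow> r \<le> top_value"
    unfolding top_value_def using bd by (intro cSup_upper) auto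
qed

lemma near_optimal_exists:
  assumes "\<kappa> > 0" shows "\<exists>xs. near_optimal \<kappa> xs"
proof -
  obtain p where p: "p \<in> samples" "dist p (\<phi>, top_value) < \<kappa>"
    using top_value_attained assms closure_approachable by blast
  then obtain xs where xs: "p = (list_mean xs, list_mean (map f xs))" "xs \<noteq> []" "set xs \<subseteq> K"
    unfolding samples_def by blast
  have "dist (list_mean xs) \<phi> < \<kappa>" "dist (list_mean (map f xs)) top_value < \<kappa>"
    using p(2) dist_fst_le[of p "(\<phi>, top_value)"] dist_snd_le[of p "(\<phi>, top_value)"] xs(1) by auto
  then show ?thesis using xs unfolding near_optimal_def
    by (intro exI[of _ xs]) (auto simp: dist_real_def)
qed

text \<open>Upper semicontinuity of the envelope at \<phi>: lists whose means tend to \<phi> while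
  the means of \<open>f\<close> stay above \<open>top_value + \<epsilon>\<close> would have a limit
  in the compact set \<open>closure samples\<close>, over \<phi> but higher than
  \<open>top_value\<close>.\<close>

lemma list_mean_near_top:
  assumes "\<epsilon> > 0"
  shows "\<exists>\<delta>>0. \<forall>xs. xs \<noteq> [] \<and> set xs \<subseteq> K \<and> dist (list_mean xs) \<phi> < \<delta>
    \<longrightarrow> list_mean (map f xs) < top_value + \<epsilon>"
proof (rule ccontr)
  assume neg: "\<not> ?thesis"
  have "\<forall>k. \<exists>xs. xs \<noteq> [] \<and> set xs \<subseteq> K \<and> dist (list_mean xs) \<phi> < 1 / real (Suc k)
      \<and> list_mean (map f xs) \<ge> top_value + \<epsilon>"
    (is "\<forall>k. ?Q k")
  proof
    fix k
    have "1 / real (Suc k) > 0" by simp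
    then show "?Q k" using neg unfolding not_less[symmetric] by blast
  qed
  then obtain xs where xs: "\<And>k. xs k \<noteq> []" "\<And>k. set (xs k) \<subseteq> K"
      "\<And>k. dist (list_mean (xs k)) \<phi> < 1 / real (Suc k)"
      "\<And>k. list_mean (map f (xs k)) \<ge> top_value + \<epsilon>"
    by metis
  let ?p = "\<lambda>k. (list_mean (xs k), list_mean (map f (xs k)))"
  have "\<And>k. ?p k \<in> closure samples"
    using xs(1,2) closure_subset[of samples] unfolding samples_def by blast
  then obtain l r where l: "l \<in> closure samples" "strict_mono r" "(?p \<circ> r) \<longlonglongrightarrow> l"
    using compact_samples[unfolded compact_eq_seq_compact_metric seq_compact_def] by meson
  have "(\<lambda>k. list_mean (xs k)) \<longlonglongrightarrow> \<phi>"
  proof (rule metric_tendsto_imp_tendsto)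
    show "(\<lambda>k. 1 / real (Suc k)) \<longlonglongrightarrow> 0"
      using lim_1_over_n LIMSEQ_Suc by blast
    show "\<forall>\<^sub>F k in sequentially. dist (list_mean (xs k)) \<phi> \<le> dist (1 / real (Suc k)) 0"
      using xs(3) by (auto simp: less_imp_le dist_real_def)
  qed
  then have "(\<lambda>k. list_mean (xs (r k))) \<longlonglongrightarrow> \<phi>"
    using LIMSEQ_subseq_LIMSEQ[OF _ l(2)] by (auto simp: o_def)
  moreover have "(\<lambda>k. list_mean (xs (r k))) \<longlonglongrightarrow> fst l"
    using tendsto_fst[OF l(3)] by (simp add: o_def)
  ultimately have 1: "fst l = \<phi>" using LIMSEQ_unique by blast
  have "(\<lambda>k. list_mean (map f (xs (r k)))) \<longlonglongrightarrow> snd l"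
    using tendsto_snd[OF l(3)] by (simp add: o_def)
  then have "snd l \<ge> top_value + \<epsilon>"
    using xs(4) by (intro LIMSEQ_le_const) auto
  moreover have "snd l \<le> top_value"
    using top_value_upper[of "snd l"] l(1) 1 by (metis prod.collapse)
  ultimately show False using assms by simp
qed

text \<open>If samples kept frequency \<open>s\<close> in ever smaller balls around
  \<open>e\<close>, then splitting their means into the parts inside and outside of the ball and
  passing to the limit would exhibit \<open>e\<close> with a share of at least \<open>s\<close> in
  \<phi>.\<close>

lemma freq_near_undominated:
  assumes e: "e \<in> K" and s: "s > 0"
    and no: "\<not> (\<exists>t y. s \<le> t \<and> t \<le> 1 \<and> y \<in> K \<and> \<phi> = t *\<^sub>R e + (1 - t) *\<^sub>R y)"
  shows "\<exists>\<delta>>0. \<exists>\<kappa>>0. \<forall>xs. near_optimal \<kappa> xs \<longrightarrow> list_freq xs (ball e \<delta>) < s"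
proof (rule ccontr)
  assume neg: "\<not> ?thesis"
  have "\<forall>k. \<exists>xs. near_optimal (1 / real (Suc k)) xs \<and> list_freq xs (ball e (1 / real (Suc k))) \<ge> s"
  proof
    fix k
    have "1 / real (Suc k) > 0" by simp
    then show "\<exists>xs. near_optimal (1 / real (Suc k)) xs \<and> list_freq xs (ball e (1 / real (Suc k))) \<ge> s"
      using neg unfolding not_less[symmetric] by blast
  qed
  then obtain xs where xs: "\<And>k. near_optimal (1 / real (Suc k)) (xs k)"
     "\<And>k. list_freq (xs k) (ball e (1 / real (Suc k))) \<ge> s" by metis
  define B where "B k = ball e (1 / real (Suc k))" for k
  define t where "t k = list_freq (xs k) (B k)" for k
  define a where "a k = list_mean (filter (\<lambda>x. x \<in> B k) (xs k))" for k
  \<comment> \<open>If no entry lies outside of the ball, the weight of \<open>b k\<close> is 0; the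
    default \<open>e\<close> keeps \<open>b k\<close> in the compact set \<open>K\<close>.\<close>
  define b where "b k = (if filter (\<lambda>x. x \<notin> B k) (xs k) = [] then e
     else list_mean (filter (\<lambda>x. x \<notin> B k) (xs k)))" for k
  have x: "xs k \<noteq> []" "set (xs k) \<subseteq> K" "dist (list_mean (xs k)) \<phi> < 1 / real (Suc k)" for k
    using xs(1)[of k] by (auto simp: near_optimal_def)
  have t: "s \<le> t k" "t k \<le> 1" for k
    using xs(2)[of k] list_freq_bounds by (auto simp: t_def B_def)
  have split: "list_mean (xs k) = t k *\<^sub>R a k + (1 - t k) *\<^sub>R b k" for k
  proof (cases "filter (\<lambda>x. x \<notin> B k) (xs k) = []")
    case True
    then have "set (xs k) \<subseteq> B k" by (auto simp: filter_empty_conv)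
    then have "t k = 1" using list_freq_superset[OF x(1)] by (simp add: t_def)
    then show ?thesis using list_mean_filter[OF x(1), of k "B k"] by (simp add: t_def a_def)
  next
    case False
    then show ?thesis using list_mean_filter[OF x(1), of k "B k"] by (simp add: t_def a_def b_def)
  qed
  have a_ne: "filter (\<lambda>x. x \<in> B k) (xs k) \<noteq> []" for k
    using t(1)[of k] s by (auto simp: t_def list_freq_def)
  have "a k \<in> B k" for k
    unfolding a_def by (rule list_mean_in_convex[OF _ _ a_ne]) (auto simp: B_def)
  then have a_dist: "dist (a k) e \<le> 1 / real (Suc k)" for k
    by (simp add: B_def dist_commute less_imp_le)
  have b: "b k \<in> K" for k
    unfolding b_def using e x(2)[of k] by (auto intro!: list_mean_in_convex[OF convex])
  have inv0: "(\<lambda>k. 1 / real (Suc k)) \<longlonglongrightarrow> 0"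
    using lim_1_over_n LIMSEQ_Suc by blast
  have a_lim: "a \<longlonglongrightarrow> e"
    by (rule metric_tendsto_imp_tendsto[OF inv0]) (use a_dist in \<open>auto simp: dist_real_def\<close>)
  have m_lim: "(\<lambda>k. list_mean (xs k)) \<longlonglongrightarrow> \<phi>"
    by (rule metric_tendsto_imp_tendsto[OF inv0])
       (use x(3) in \<open>auto simp: dist_real_def less_imp_le\<close>)
  have "compact ({s..1} \<times> K)" using compact by (intro compact_Times) auto
  moreover have "\<And>k. (t k, b k) \<in> {s..1} \<times> K" using t b by auto
  ultimately obtain l r where l: "l \<in> {s..1} \<times> K" "strict_mono r" "((\<lambda>k. (t k, b k)) \<circ> r) \<longlonglongrightarrow> l"
    unfolding compact_eq_seq_compact_metric seq_compact_def by meson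
  have "(\<lambda>k. t (r k) *\<^sub>R a (r k) + (1 - t (r k)) *\<^sub>R b (r k)) \<longlonglongrightarrow> fst l *\<^sub>R e + (1 - fst l) *\<^sub>R snd l"
    using tendsto_fst[OF l(3)] tendsto_snd[OF l(3)] LIMSEQ_subseq_LIMSEQ[OF a_lim l(2)]
    by (intro tendsto_intros) (auto simp: o_def)
  moreover have "(\<lambda>k. t (r k) *\<^sub>R a (r k) + (1 - t (r k)) *\<^sub>R b (r k)) \<longlonglongrightarrow> \<phi>"
    using LIMSEQ_subseq_LIMSEQ[OF m_lim l(2)] by (simp add: split o_def)
  ultimately have "\<phi> = fst l *\<^sub>R e + (1 - fst l) *\<^sub>R snd l" using LIMSEQ_unique by blast
  then show False using no l(1) by (metis atLeastAtMost_iff mem_Times_iff)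
qed

definition far_midpoints :: "real \<Rightarrow> 'v set" where
  "far_midpoints \<epsilon> = {midpoint a b | a b. a \<in> K \<and> b \<in> K \<and> \<epsilon> \<le> dist a b}"

text \<open>The convexity gap tends to 0 as two points approach each other, but on the compact set
  of pairs at distance at least \<epsilon> it is continuous and attains a positive minimum.\<close>

lemma strict_gap:
  assumes "\<epsilon> > 0"
  shows "\<exists>c>0. \<forall>a\<in>K. \<forall>b\<in>K. \<epsilon> \<le> dist a b \<longrightarrow> f (midpoint a b) + c \<le> (f a + f b) / 2"
proof -
  let ?P = "(K \<times> K) \<inter> {p. \<epsilon> \<le> dist (fst p) (snd p)}"
  let ?g = "\<lambda>p. (f (fst p) + f (snd p)) / 2 - f (midpoint (fst p) (snd p))"
  have mid: "midpoint a b \<in> K" if "a \<in> K" "b \<in> K" for a b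
    using convexD[OF convex that, of "1/2" "1/2"] by (simp add: midpoint_def scaleR_add_right)
  have "closed {p :: 'v \<times> 'v. \<epsilon> \<le> dist (fst p) (snd p)}"
    by (intro closed_Collect_le continuous_intros)
  then have cP: "compact ?P" using compact by (intro compact_Int_closed compact_Times) auto
  have cg: "continuous_on ?P ?g"
    unfolding midpoint_def
    by (intro continuous_intros continuous_on_compose2[OF cont])
       (use mid in \<open>auto simp: midpoint_def\<close>)
  show ?thesis
  proof (cases "?P = {}")
    case True
    then show ?thesis by (intro exI[of _ 1]) auto
  next
    case False
    then obtain p where p: "p \<in> ?P" "\<And>q. q \<in> ?P \<Longrightarrow> ?g p \<le> ?g q"
      using continuous_attains_inf[OF cP False cg] by blast
    have "fst p \<noteq> snd p" using p(1) assms by auto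
    then have "?g p > 0" using strict[of "fst p" "snd p"] p(1) by auto
    moreover have "f (midpoint a b) + ?g p \<le> (f a + f b) / 2"
      if "a \<in> K" "b \<in> K" "\<epsilon> \<le> dist a b" for a b
      using p(2)[of "(a, b)"] that by simp argo
    ultimately show ?thesis by blast
  qed
qed

text \<open>Splitting the sample points near \<open>midpoint a b\<close> into \<open>a\<close> and \<open>b\<close> hardly moves the mean but
  raises the mean of \<open>f\<close> by a definite amount per split point, so a near-optimal sample has few
  such points.\<close>

lemma freq_near_far_midpoints:
  assumes \<epsilon>: "\<epsilon> > 0" and \<eta>: "\<eta> > 0"
  shows "\<exists>\<delta>>0. \<exists>\<kappa>>0. \<forall>xs. near_optimal \<kappa> xs
    \<longrightarrow> list_freq xs (\<Union>x\<in>far_midpoints \<epsilon>. ball x \<delta>) < \<eta>"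
proof -
  obtain c where c: "c > 0"
      "\<And>a b. a \<in> K \<Longrightarrow> b \<in> K \<Longrightarrow> \<epsilon> \<le> dist a b \<Longrightarrow> f (midpoint a b) + c \<le> (f a + f b) / 2"
    using strict_gap[OF \<epsilon>] by blast
  have mid: "midpoint a b \<in> K" if "a \<in> K" "b \<in> K" for a b
    using convexD[OF convex that, of "1/2" "1/2"] by (simp add: midpoint_def scaleR_add_right)
  obtain d where d: "d > 0" "\<And>x y. x \<in> K \<Longrightarrow> y \<in> K \<Longrightarrow> dist x y < d \<Longrightarrow> dist (f x) (f y) < c / 2"
  proof -
    have "c / 2 > 0" using c(1) by simp
    then obtain d where "d > 0" "\<forall>x\<in>K. \<forall>y\<in>K. dist y x < d \<longrightarrow> dist (f y) (f x) < c / 2"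
      using compact_uniformly_continuous[OF cont compact]
      unfolding uniformly_continuous_on_def by blast
    then show ?thesis using that by blast
  qed
  obtain \<delta>0 where \<delta>0: "\<delta>0 > 0" "\<And>xs. xs \<noteq> [] \<Longrightarrow> set xs \<subseteq> K \<Longrightarrow> dist (list_mean xs) \<phi> < \<delta>0
      \<Longrightarrow> list_mean (map f xs) < top_value + c * \<eta> / 4"
    using list_mean_near_top[of "c * \<eta> / 4"] c(1) \<eta> by auto
  \<comment> \<open>Replacing a midpoint by an entry within \<open>d\<close> costs less than half of
    the gap \<open>c\<close>. Splitting moves the mean by at most \<delta>, and \<delta> and
    \<kappa> are at most half of \<open>\<delta>0\<close>, so the new mean stays within
    \<open>\<delta>0\<close> of \<phi>.\<close>
  define \<delta> where "\<delta> = min d (\<delta>0 / 2)"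
  \<comment> \<open>Frequency \<eta> would raise the mean of \<open>f\<close> by
    \<open>c * \<eta> / 2\<close>. One half of this absorbs the error \<kappa> of \<open>xs\<close>,
    the other half the slack in the upper bound for the split list.\<close>
  define \<kappa> where "\<kappa> = min (c * \<eta> / 4) (\<delta>0 / 2)"
  have pos: "\<delta> > 0" "\<kappa> > 0" using d(1) \<delta>0(1) c(1) \<eta> by (auto simp: \<delta>_def \<kappa>_def)
  define W where "W = (\<Union>x\<in>far_midpoints \<epsilon>. ball x \<delta>)"
  have "\<exists>a b. a \<in> K \<and> b \<in> K \<and> dist (midpoint a b) x < \<delta> \<and> \<epsilon> \<le> dist a b" if "x \<in> W" for x
    using that by (auto simp: W_def far_midpoints_def)
  then obtain a b where ab: "\<And>x. x \<in> W \<Longrightarrow> a x \<in> K" "\<And>x. x \<in> W \<Longrightarrow> b x \<in> K"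
     "\<And>x. x \<in> W \<Longrightarrow> dist (midpoint (a x) (b x)) x < \<delta>" "\<And>x. x \<in> W \<Longrightarrow> \<epsilon> \<le> dist (a x) (b x)"
    by metis
  have "list_freq xs W < \<eta>" if opt: "near_optimal \<kappa> xs" for xs
  proof -
    \<comment> \<open>Entries outside of \<open>W\<close> are doubled, so the new list is exactly
      twice as long as \<open>xs\<close> and each entry of \<open>xs\<close> keeps its
      weight.\<close>
    define spl where "spl x = (if x \<in> W then [a x, b x] else [x, x])" for x
    define ys where "ys = concat (map spl xs)"
    have xs: "xs \<noteq> []" "set xs \<subseteq> K" "dist (list_mean xs) \<phi> < \<kappa>" 
        "list_mean (map f xs) > top_value - \<kappa>"
      using opt by (auto simp: near_optimal_def)
    have n: "real (length xs) > 0" using xs(1) by simp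
    have len: "length ys = 2 * length xs"
      unfolding ys_def spl_def by (induction xs) auto
    have "ys \<noteq> []" using len xs(1) by auto
    moreover have "set ys \<subseteq> K"
      using ab(1,2) xs(2) unfolding ys_def spl_def by auto
    ultimately have ysK: "set ys \<subseteq> K" "ys \<noteq> []" by blast+
    have "norm (sum_list ys - 2 *\<^sub>R sum_list xs) \<le> 2 * \<delta> * real (length xs)"
      unfolding ys_def
    proof (induction xs)
      case (Cons x xs)
      have "norm (sum_list (spl x) - 2 *\<^sub>R x) \<le> 2 * \<delta>"
      proof (cases "x \<in> W")
        case True
        have "sum_list (spl x) - 2 *\<^sub>R x = 2 *\<^sub>R (midpoint (a x) (b x) - x)"
          using True by (simp add: spl_def midpoint_def algebra_simps)
        then show ?thesis using ab(3)[OF True] by (simp add: dist_norm)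
      next
        case False
        then show ?thesis using pos by (simp add: spl_def scaleR_2)
      qed
      moreover have eq: "sum_list (concat (map spl (x # xs))) - 2 *\<^sub>R sum_list (x # xs)
         = (sum_list (spl x) - 2 *\<^sub>R x) + (sum_list (concat (map spl xs)) - 2 *\<^sub>R sum_list xs)"
        by (simp add: algebra_simps)
      moreover have "2 * \<delta> + 2 * \<delta> * real (length xs) = 2 * \<delta> * real (length (x # xs))"
        by (simp add: algebra_simps)
      ultimately show ?case
        unfolding eq using Cons.IH norm_triangle_ineq[of "sum_list (spl x) - 2 *\<^sub>R x"
          "sum_list (concat (map spl xs)) - 2 *\<^sub>R sum_list xs"] by linarith
    qed simp
    moreover have "list_mean ys - list_mean xs
        = (1 / (2 * real (length xs))) *\<^sub>R (sum_list ys - 2 *\<^sub>R sum_list xs)"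
      using n by (simp add: list_mean_def len scaleR_diff_right inverse_eq_divide)
    ultimately have "dist (list_mean ys) (list_mean xs)
        \<le> 1 / (2 * real (length xs)) * (2 * \<delta> * real (length xs))"
      using n by (simp only: dist_norm norm_scaleR) (intro mult_mono, auto)
    then have "dist (list_mean ys) (list_mean xs) \<le> \<delta>" using n by simp
    then have "dist (list_mean ys) \<phi> < \<delta>0"
      using xs(3) dist_triangle[of "list_mean ys" \<phi> "list_mean xs"]
      by (auto simp: \<delta>_def \<kappa>_def)
    then have up: "list_mean (map f ys) < top_value + c * \<eta> / 4"
      using \<delta>0(2) ysK by blast
    have "sum_list (map f ys) \<ge> 2 * sum_list (map f xs)
        + c * real (length (filter (\<lambda>x. x \<in> W) xs))"
      using xs(2) unfolding ys_def
    proof (induction xs)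
      case (Cons x xs)
      have "sum_list (map f (spl x)) \<ge> 2 * f x + (if x \<in> W then c else 0)"
      proof (cases "x \<in> W")
        case True
        have "dist (f (midpoint (a x) (b x))) (f x) < c / 2"
          using Cons.prems ab[OF True] mid by (intro d(2)) (auto simp: \<delta>_def)
        then have "f (midpoint (a x) (b x)) > f x - c / 2"
          unfolding dist_real_def by linarith
        then have "(f (a x) + f (b x)) / 2 > f x + c / 2"
          using c(2)[OF ab(1)[OF True] ab(2)[OF True] ab(4)[OF True]] by linarith
        then show ?thesis using True by (simp add: spl_def)
      qed (simp add: spl_def)
      moreover have "sum_list (map f (concat (map spl xs))) \<ge> 2 * sum_list (map f xs)
        + c * real (length (filter (\<lambda>x. x \<in> W) xs))" using Cons by auto
      ultimately show ?case by (cases "x \<in> W") (simp_all add: algebra_simps)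
    qed simp
    then have *: "(2 * sum_list (map f xs) + c * real (length (filter (\<lambda>x. x \<in> W) xs)))
        / (2 * real (length xs)) \<le> sum_list (map f ys) / (2 * real (length xs))"
      using n by (intro divide_right_mono) auto
    have "list_mean (map f ys) \<ge> list_mean (map f xs) + c * list_freq xs W / 2"
    proof -
      have "(2 * A + c * m) / (2 * N) = inverse N * A + c * (m / N) / 2" if "N > 0" for A m N :: real
        using that by (simp add: field_simps)
      from this[OF n] have 1: "list_mean (map f xs) + c * list_freq xs W / 2
          = (2 * sum_list (map f xs) + c * real (length (filter (\<lambda>x. x \<in> W) xs)))
            / (2 * real (length xs))"
        unfolding list_mean_def list_freq_def length_map real_scaleR_def by (rule sym)
      have 2: "list_mean (map f ys) = sum_list (map f ys) / (2 * real (length xs))"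
        unfolding list_mean_def length_map len real_scaleR_def of_nat_mult of_nat_numeral divide_inverse
        by (rule mult.commute)
      show ?thesis unfolding 1 2 by (rule *)
    qed
    then have "c * list_freq xs W / 2 < \<kappa> + c * \<eta> / 4"
      using up xs(4) by linarith
    then have "c * list_freq xs W < c * \<eta>"
      using min.cobounded1[of "c * \<eta> / 4" "\<delta>0 / 2"] unfolding \<kappa>_def by linarith
    then show ?thesis using c(1) by simp
  qed
  then show ?thesis using pos unfolding W_def by blast
qed

text \<open>Choquet's theorem without measures. If \<open>\<phi>\<close> dominated no point of \<open>D\<close>, near-optimal samples would
  have small frequency near each point of \<open>D\<close> and near the midpoints of distant points, and frequency
  bounded away from 1 near \<open>e0\<close>. By compactness these neighbourhoods do not cover \<open>K\<close>, and a point
  outside of them is a further extreme point.\<close>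

theorem dominates_extreme_point:
  assumes D: "countable D" "D \<subseteq> K" and ext: "\<And>x. x extreme_point_of K \<Longrightarrow> x = e0 \<or> x \<in> D"
    and e0: "e0 \<in> K" and ne: "\<phi> \<noteq> e0"
  shows "\<exists>e\<in>D. \<exists>t y. 0 < t \<and> t \<le> 1 \<and> y \<in> K \<and> \<phi> = t *\<^sub>R e + (1 - t) *\<^sub>R y"
proof (rule ccontr)
  assume no: "\<not> ?thesis"
  have "\<exists>s. 0 < s \<and> s < 1 \<and> \<not> (\<exists>t y. s \<le> t \<and> t \<le> 1 \<and> y \<in> K \<and> \<phi> = t *\<^sub>R e0 + (1 - t) *\<^sub>R y)"
  proof -
    obtain C where C: "\<And>x. x \<in> K \<Longrightarrow> norm x \<le> C" "C > 0"
      using compact_imp_bounded[OF compact] bounded_pos by metis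
    \<comment> \<open>A share of at least \<open>1 - q\<close> for \<open>e0\<close> would put
      \<phi> within \<open>q * (2 * C)\<close> of \<open>e0\<close>, which is half of their actual
      distance.\<close>
    define q where "q = norm (\<phi> - e0) / (4 * C)"
    have q0: "q > 0" using ne C(2) by (simp add: q_def)
    have "norm (\<phi> - e0) \<le> 2 * C" using C(1)[OF point] C(1)[OF e0] norm_triangle_ineq4[of \<phi> e0] by linarith
    then have q1: "q < 1" using C(2) by (simp add: q_def field_simps)
    have False if "1 - q \<le> t" "t \<le> 1" "y \<in> K" "\<phi> = t *\<^sub>R e0 + (1 - t) *\<^sub>R y" for t y
    proof -
      have "\<phi> - e0 = (1 - t) *\<^sub>R (y - e0)" using that(4) by (simp add: algebra_simps)
      then have "norm (\<phi> - e0) = (1 - t) * norm (y - e0)" using that(2) by simp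
      also have "\<dots> \<le> q * (2 * C)"
        using that C(1)[OF that(3)] C(1)[OF e0] norm_triangle_ineq4[of y e0]
        by (intro mult_mono) auto
      also have "\<dots> = norm (\<phi> - e0) / 2" using C(2) by (simp add: q_def)
      finally show False using ne by simp
    qed
    then show ?thesis using q0 q1 by (intro exI[of _ "1 - q"]) auto
  qed
  then obtain s where s: "0 < s" "s < 1"
      "\<not> (\<exists>t y. s \<le> t \<and> t \<le> 1 \<and> y \<in> K \<and> \<phi> = t *\<^sub>R e0 + (1 - t) *\<^sub>R y)" by blast
  obtain \<delta>0 \<kappa>0 where "\<delta>0 > 0" "\<kappa>0 > 0"
      and \<kappa>0: "\<And>xs. near_optimal \<kappa>0 xs \<Longrightarrow> list_freq xs (ball e0 \<delta>0) < s"
    using freq_near_undominated[OF e0 s(1,3)] by blast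
  then obtain O0 where O0: "open O0" "e0 \<in> O0" "\<kappa>0 > 0"
      "\<And>xs. near_optimal \<kappa>0 xs \<Longrightarrow> list_freq xs O0 < s"
    using centre_in_ball open_ball by meson
  \<comment> \<open>Twice these weights sum to at most \<open>1 - s\<close>, which is what the
    frequency near \<open>e0\<close> leaves over. The factor 2 provides for the two pieces of each
    \<open>U i\<close>: one near midpoints, one near a point of \<open>D\<close>.\<close>
  define w where "w i = (1 - s) * (1 / 2) ^ (i + 2)" for i :: nat
  have w: "w i > 0" for i using s by (simp add: w_def)
  have wsum: "(\<Sum>i<n. 2 * w i) \<le> 1 - s" for n
  proof -
    have "(\<Sum>i<n. 2 * w i) = (1 - s) * (1 - (1/2) ^ n)"
    proof (induction n)
      case (Suc n)
      have "2 * w n = (1 - s) * ((1/2) ^ n / 2)" by (simp add: w_def)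
      then show ?case
        unfolding sum.lessThan_Suc Suc.IH by (simp only: power_Suc) (simp add: algebra_simps)
    qed simp
    also have "\<dots> \<le> 1 - s" using s by (intro mult_left_le) auto
    finally show ?thesis .
  qed
  \<comment> \<open>One index runs through both families: midpoints of pairs at distance at least
    \<open>1 / real (Suc i)\<close>, and the point of \<open>D\<close> with number \<open>i\<close>
    if there is one.\<close>
  define Q where "Q i U \<longleftrightarrow> open U
     \<and> (\<exists>\<kappa>>0. \<forall>xs. near_optimal \<kappa> xs \<longrightarrow> list_freq xs U < 2 * w i)
     \<and> far_midpoints (1 / real (Suc i)) \<subseteq> U \<and> {e \<in> D. to_nat_on D e = i} \<subseteq> U" for i U
  have "\<exists>U. Q i U" for i
  proof -
    have "1 / real (Suc i) > 0" by simp
    from freq_near_far_midpoints[OF this w[of i]]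
    obtain \<delta> \<kappa> where 1: "\<delta> > 0" "\<kappa> > 0" "\<And>xs. near_optimal \<kappa> xs \<Longrightarrow>
        list_freq xs (\<Union>x\<in>far_midpoints (1 / real (Suc i)). ball x \<delta>) < w i" by blast
    let ?W = "\<Union>x\<in>far_midpoints (1 / real (Suc i)). ball x \<delta>"
    have W: "open ?W" "far_midpoints (1 / real (Suc i)) \<subseteq> ?W" using 1 by auto
    show ?thesis
    proof (cases "{e \<in> D. to_nat_on D e = i} = {}")
      case True
      have "list_freq xs ?W < 2 * w i" if "near_optimal \<kappa> xs" for xs
        using 1(3)[OF that] w[of i] by linarith
      then show ?thesis unfolding Q_def using 1(2) W True by blast
    next
      case False
      then obtain e where e: "e \<in> D" "to_nat_on D e = i" by blast
      then have e_only: "{e \<in> D. to_nat_on D e = i} = {e}"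
        using inj_on_to_nat_on[OF D(1)] by (auto simp: inj_on_def)
      obtain \<delta>' \<kappa>' where 2: "\<delta>' > 0" "\<kappa>' > 0"
          "\<And>xs. near_optimal \<kappa>' xs \<Longrightarrow> list_freq xs (ball e \<delta>') < w i"
      proof -
        have "e \<in> K" using D(2) e(1) by blast
        moreover have "\<not> (\<exists>t y. w i \<le> t \<and> t \<le> 1 \<and> y \<in> K \<and> \<phi> = t *\<^sub>R e + (1 - t) *\<^sub>R y)"
          using no e(1) w[of i] order_less_le_trans by blast
        ultimately show ?thesis using freq_near_undominated[OF _ w[of i]] that by blast
      qed
      have "list_freq xs (?W \<union> ball e \<delta>') < 2 * w i" if "near_optimal (min \<kappa> \<kappa>') xs" for xs
        using list_freq_Un[of xs ?W "ball e \<delta>'"] 1(3)[of xs] 2(3)[of xs]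
          near_optimal_mono[OF that, of \<kappa>] near_optimal_mono[OF that, of \<kappa>'] by auto
      moreover have "open (?W \<union> ball e \<delta>')" "min \<kappa> \<kappa>' > 0"
          "far_midpoints (1 / real (Suc i)) \<subseteq> ?W \<union> ball e \<delta>'"
          "{e \<in> D. to_nat_on D e = i} \<subseteq> ?W \<union> ball e \<delta>'"
        using W 1(2) 2(1,2) e_only by auto
      ultimately show ?thesis unfolding Q_def by blast
    qed
  qed
  then obtain U where Q: "\<And>i. Q i (U i)" by metis
  then have "\<exists>\<kappa>>0. \<forall>xs. near_optimal \<kappa> xs \<longrightarrow> list_freq xs (U i) < 2 * w i" for i
    unfolding Q_def by blast
  then obtain \<kappa> where \<kappa>: "\<And>i. \<kappa> i > 0"
     "\<And>i xs. near_optimal (\<kappa> i) xs \<Longrightarrow> list_freq xs (U i) < 2 * w i" by metis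
  have U: "open (U i)" "far_midpoints (1 / real (Suc i)) \<subseteq> U i"
      "{e \<in> D. to_nat_on D e = i} \<subseteq> U i" for i
    using Q[of i] unfolding Q_def by blast+
  have "K \<subseteq> O0 \<union> (\<Union>i. U i)"
  proof
    fix x assume x: "x \<in> K"
    show "x \<in> O0 \<union> (\<Union>i. U i)"
    proof (cases "x extreme_point_of K")
      case True
      then show ?thesis using ext[OF True] O0(2) U(3)[of "to_nat_on D x"] by blast
    next
      case False
      then obtain a b where ab: "a \<in> K" "b \<in> K" "a \<noteq> b" "x = midpoint a b"
        using not_extreme_point_midpoint[OF convex x] by blast
      then obtain i where "1 / real (Suc i) < dist a b"
        using nat_approx_posE[of "dist a b"] by auto
      then have "x \<in> far_midpoints (1 / real (Suc i))"
        using ab unfolding far_midpoints_def by (blast intro: less_imp_le)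
      then show ?thesis using U(2) by blast
    qed
  qed
  then have "K \<subseteq> \<Union> (insert O0 (range U))" by auto
  moreover have "open B" if "B \<in> insert O0 (range U)" for B
    using that O0(1) U(1) by blast
  ultimately obtain F where F: "F \<subseteq> insert O0 (range U)" "finite F" "K \<subseteq> \<Union>F"
    by (rule compactE[OF compact])
  have "F - {O0} \<subseteq> range U" "finite (F - {O0})" using F(1,2) by blast+
  then obtain I where I: "finite I" "F - {O0} = U ` I"
    using finite_subset_image by metis
  obtain n where "I \<subseteq> {..<n}" using I(1)[unfolded finite_nat_iff_bounded] ..
  then have "F \<subseteq> insert O0 (U ` {..<n})" using I(2) by blast
  then have cover: "K \<subseteq> O0 \<union> (\<Union>i\<in>{..<n}. U i)" using F(3) by blast
  \<comment> \<open>The thresholds of all the \<open>U i\<close> might have infimum 0; the finite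
    subcover leaves finitely many, so one sample can meet them all.\<close>
  define \<kappa>m where "\<kappa>m = Min (insert \<kappa>0 (\<kappa> ` {..<n}))"
  have \<kappa>m: "\<kappa>m > 0" "\<kappa>m \<le> \<kappa>0" "\<And>i. i < n \<Longrightarrow> \<kappa>m \<le> \<kappa> i"
    using O0(3) \<kappa>(1) by (auto simp: \<kappa>m_def)
  obtain xs where xs: "near_optimal \<kappa>m xs" using near_optimal_exists[OF \<kappa>m(1)] by blast
  then have "xs \<noteq> []" "set xs \<subseteq> K" by (auto simp: near_optimal_def)
  then have "1 = list_freq xs (O0 \<union> (\<Union>i\<in>{..<n}. U i))"
    using cover list_freq_superset[OF _ subset_trans] by metis
  also have "\<dots> \<le> list_freq xs O0 + (\<Sum>i<n. list_freq xs (U i))"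
    using list_freq_Un[of xs O0 "\<Union>i\<in>{..<n}. U i"] list_freq_UN[of "{..<n}" xs U] by simp
  also have "\<dots> < s + (\<Sum>i<n. 2 * w i)"
  proof (rule add_less_le_mono)
    show "list_freq xs O0 < s" using O0(4) near_optimal_mono[OF xs \<kappa>m(2)] by blast
    show "(\<Sum>i<n. list_freq xs (U i)) \<le> (\<Sum>i<n. 2 * w i)"
      using \<kappa>(2) near_optimal_mono[OF xs \<kappa>m(3)] by (intro sum_mono less_imp_le) blast
  qed
  also have "\<dots> \<le> 1" using wsum[of n] by simp
  finally show False by simp
qed

end

section \<open>Orthonormal bases in \<open>\<ell>\<^sup>2\<close>\<close>

lemma ell2_mult_summable:
  assumes "f \<in> ell2" "g \<in> ell2"
  shows "(\<lambda>i. cmod (f i) * cmod (g i)) summable_on UNIV"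
proof (rule summable_on_comparison_test)
  show "(\<lambda>i. (cmod (f i))\<^sup>2 + (cmod (g i))\<^sup>2) summable_on UNIV"
    using assms by (intro summable_on_add) (auto simp: ell2_def)
  have "a * b \<le> a\<^sup>2 + b\<^sup>2" for a b :: real
    using sum_squares_bound[of a b] zero_le_power2[of a] zero_le_power2[of b] by linarith
  then show "cmod (f i) * cmod (g i) \<le> (cmod (f i))\<^sup>2 + (cmod (g i))\<^sup>2" for i .
qed auto

lemma ell2_inner_summable:
  assumes "f \<in> ell2" "g \<in> ell2"
  shows "(\<lambda>i. f i * cnj (g i)) summable_on UNIV"
  by (rule abs_summable_summable) (simp add: norm_mult ell2_mult_summable[OF assms])

lemma ell2_zero: "(\<lambda>i. 0) \<in> ell2"
  by (simp add: ell2_def)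

lemma ell2_scale: "f \<in> ell2 \<Longrightarrow> (\<lambda>i. c * f i) \<in> ell2"
  unfolding ell2_def by (simp add: norm_mult power_mult_distrib summable_on_cmult_right)

lemma ell2_add:
  assumes "f \<in> ell2" "g \<in> ell2" shows "(\<lambda>i. f i + g i) \<in> ell2"
proof -
  have "(\<lambda>i. (cmod (f i + g i))\<^sup>2) summable_on UNIV"
  proof (rule summable_on_comparison_test)
    show "(\<lambda>i. 2 * ((cmod (f i))\<^sup>2 + (cmod (g i))\<^sup>2)) summable_on UNIV"
      using assms by (intro summable_on_cmult_right summable_on_add) (auto simp: ell2_def)
    fix i
    have "(cmod (f i + g i))\<^sup>2 \<le> (cmod (f i) + cmod (g i))\<^sup>2"
      by (intro power_mono norm_triangle_ineq) auto
    also have "\<dots> \<le> 2 * ((cmod (f i))\<^sup>2 + (cmod (g i))\<^sup>2)"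
      using sum_squares_bound[of "cmod (f i)" "cmod (g i)"] by (simp add: power2_sum)
    finally show "(cmod (f i + g i))\<^sup>2 \<le> 2 * ((cmod (f i))\<^sup>2 + (cmod (g i))\<^sup>2)" .
  qed auto
  then show ?thesis by (simp add: ell2_def)
qed

lemma ell2_diff:
  assumes "f \<in> ell2" "g \<in> ell2" shows "(\<lambda>i. f i - g i) \<in> ell2"
  using ell2_add[OF assms(1) ell2_scale[OF assms(2), of "-1"]] by simp

lemma ell2_lincomb:
  assumes "\<And>u. u \<in> U \<Longrightarrow> e u \<in> ell2"
  shows "(\<lambda>i. \<Sum>u\<in>U. c u * e u i) \<in> ell2"
  using assms
proof (induction U rule: infinite_finite_induct)
  case (insert x F)
  have "(\<lambda>i. c x * e x i) \<in> ell2" using insert.prems by (intro ell2_scale) blast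
  moreover have "(\<lambda>i. \<Sum>u\<in>F. c u * e u i) \<in> ell2" using insert.prems by (intro insert.IH) blast
  ultimately show ?case using ell2_add insert.hyps by simp
qed (auto intro: ell2_zero)

lemma ell2_inner_add:
  assumes "f \<in> ell2" "g \<in> ell2" "h \<in> ell2"
  shows "ell2_inner (\<lambda>i. f i + g i) h = ell2_inner f h + ell2_inner g h"
  unfolding ell2_inner_def distrib_right
  using assms by (intro infsum_add ell2_inner_summable)

lemma ell2_inner_scale: "ell2_inner (\<lambda>i. c * f i) h = c * ell2_inner f h"
  unfolding ell2_inner_def mult.assoc by (rule infsum_cmult_right')

lemma ell2_inner_diff:
  assumes "f \<in> ell2" "g \<in> ell2" "h \<in> ell2"
  shows "ell2_inner (\<lambda>i. f i - g i) h = ell2_inner f h - ell2_inner g h"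
  using ell2_inner_add[OF assms(1) ell2_scale[OF assms(2), of "-1"] assms(3)]
    ell2_inner_scale[of "-1" g h] by simp

lemma ell2_inner_commute: "ell2_inner f g = cnj (ell2_inner g f)"
  unfolding ell2_inner_def infsum_cnj[symmetric] by (simp add: mult.commute)

lemma ell2_inner_lincomb:
  assumes "\<And>u. u \<in> U \<Longrightarrow> e u \<in> ell2" "h \<in> ell2"
  shows "ell2_inner (\<lambda>i. \<Sum>u\<in>U. c u * e u i) h = (\<Sum>u\<in>U. c u * ell2_inner (e u) h)"
  using assms(1)
proof (induction U rule: infinite_finite_induct)
  case (insert x F)
  then show ?case
    using assms(2) by (simp add: ell2_inner_add ell2_scale ell2_lincomb ell2_inner_scale)
qed (auto simp: ell2_inner_def)

lemma ell2_norm_nonneg: "0 \<le> ell2_norm f"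
  by (simp add: ell2_norm_def infsum_nonneg)

lemma ell2_inner_self:
  assumes "f \<in> ell2" shows "ell2_inner f f = of_real ((ell2_norm f)\<^sup>2)"
proof -
  have "ell2_inner f f = (\<Sum>\<^sub>\<infinity>i. of_real ((cmod (f i))\<^sup>2))"
    unfolding ell2_inner_def complex_norm_square ..
  also have "\<dots> = of_real (\<Sum>\<^sub>\<infinity>i. (cmod (f i))\<^sup>2)"
    using assms unfolding ell2_def by (intro infsumI has_sum_of_real has_sum_infsum) simp
  finally show ?thesis by (simp add: ell2_norm_def infsum_nonneg)
qed

lemma ell2_partial_norm:
  assumes "f \<in> ell2" "finite F"
  shows "L2_set (\<lambda>i. cmod (f i)) F \<le> ell2_norm f"
  using assms unfolding L2_set_def ell2_norm_def
  by (intro real_sqrt_le_mono finite_sum_le_infsum) (auto simp: ell2_def)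

lemma ell2_coord_le_norm: "f \<in> ell2 \<Longrightarrow> cmod (f i) \<le> ell2_norm f"
  using ell2_partial_norm[of f "{i}"] by simp

lemma ell2_inner_zero_iff:
  assumes "f \<in> ell2" shows "ell2_inner f f = 0 \<longleftrightarrow> f = (\<lambda>i. 0)"
proof
  assume "ell2_inner f f = 0"
  then have "ell2_norm f = 0" using assms by (simp add: ell2_inner_self)
  then show "f = (\<lambda>i. 0)" using ell2_coord_le_norm[OF assms] by (intro ext) (metis norm_le_zero_iff)
qed (simp add: ell2_inner_def)

lemma ell2_Cauchy_Schwarz:
  assumes "f \<in> ell2" "g \<in> ell2"
  shows "cmod (ell2_inner f g) \<le> ell2_norm f * ell2_norm g"
proof -
  have s: "(\<lambda>i. cmod (f i * cnj (g i))) summable_on UNIV"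
    using ell2_mult_summable[OF assms] by (simp add: norm_mult)
  have "cmod (ell2_inner f g) \<le> (\<Sum>\<^sub>\<infinity>i. cmod (f i * cnj (g i)))"
    unfolding ell2_inner_def by (rule norm_infsum_bound[OF s])
  also have "\<dots> \<le> ell2_norm f * ell2_norm g"
  proof (rule infsum_le_finite_sums[OF s])
    fix F :: "'a set" assume F: "finite F"
    have "(\<Sum>i\<in>F. cmod (f i * cnj (g i))) = (\<Sum>i\<in>F. \<bar>cmod (f i)\<bar> * \<bar>cmod (g i)\<bar>)"
      by (simp add: norm_mult)
    also have "\<dots> \<le> L2_set (\<lambda>i. cmod (f i)) F * L2_set (\<lambda>i. cmod (g i)) F"
      by (rule L2_set_mult_ineq)
    also have "\<dots> \<le> ell2_norm f * ell2_norm g"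
      using assms F by (intro mult_mono ell2_partial_norm) (auto simp: ell2_norm_nonneg)
    finally show "(\<Sum>i\<in>F. cmod (f i * cnj (g i))) \<le> ell2_norm f * ell2_norm g" .
  qed
  finally show ?thesis .
qed

section \<open>Subspaces of the space of square-summable families\<close>

lemma closed_subspaceD:
  assumes "closed_subspace V"
  shows "V \<subseteq> ell2" "(\<lambda>i. 0) \<in> V" "\<And>f g. f \<in> V \<Longrightarrow> g \<in> V \<Longrightarrow> (\<lambda>i. f i + g i) \<in> V"
    "\<And>c f. f \<in> V \<Longrightarrow> (\<lambda>i. c * f i) \<in> V"
    "\<And>f. f \<in> ell2 \<Longrightarrow> (\<And>\<epsilon>. \<epsilon> > 0 \<Longrightarrow> \<exists>g\<in>V. ell2_norm (\<lambda>i. f i - g i) < \<epsilon>) \<Longrightarrow> f \<in> V"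
  using assms unfolding closed_subspace_def by auto

definition linear_subspace :: "('i \<Rightarrow> complex) set \<Rightarrow> bool" where
  "linear_subspace L \<longleftrightarrow> L \<subseteq> ell2 \<and> (\<lambda>i. 0) \<in> L \<and> (\<forall>f\<in>L. \<forall>g\<in>L. (\<lambda>i. f i + g i) \<in> L)
     \<and> (\<forall>c. \<forall>f\<in>L. (\<lambda>i. c * f i) \<in> L)"

lemma linear_subspaceD:
  assumes "linear_subspace L"
  shows "L \<subseteq> ell2" "(\<lambda>i. 0) \<in> L" "\<And>f g. f \<in> L \<Longrightarrow> g \<in> L \<Longrightarrow> (\<lambda>i. f i + g i) \<in> L"
    "\<And>c f. f \<in> L \<Longrightarrow> (\<lambda>i. c * f i) \<in> L"
  using assms unfolding linear_subspace_def by auto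

lemma closed_subspace_linear: "closed_subspace V \<Longrightarrow> linear_subspace V"
  by (auto simp: closed_subspace_def linear_subspace_def)

lemma linear_subspace_lincomb:
  assumes "linear_subspace L" "\<And>u. u \<in> U \<Longrightarrow> e u \<in> L"
  shows "(\<lambda>i. \<Sum>u\<in>U. c u * e u i) \<in> L"
  using assms(2)
proof (induction U rule: infinite_finite_induct)
  case (insert x F)
  have "(\<lambda>i. c x * e x i) \<in> L"
    using insert.prems by (intro linear_subspaceD(4)[OF assms(1)]) blast
  moreover have "(\<lambda>i. \<Sum>u\<in>F. c u * e u i) \<in> L"
    using insert.prems by (intro insert.IH) blast
  ultimately show ?case
    using linear_subspaceD(3)[OF assms(1)] insert.hyps by simp
qed (use linear_subspaceD(2)[OF assms(1)] in auto)

lemma linear_subspace_diff: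
  assumes "linear_subspace L" "f \<in> L" "g \<in> L"
  shows "(\<lambda>i. f i - g i) \<in> L"
  using linear_subspaceD(3)[OF assms(1,2) linear_subspaceD(4)[OF assms(1,3), of "-1"]] by simp

lemma closed_subspace_orthogonal:
  assumes V: "closed_subspace V" and w: "w \<in> ell2"
  shows "closed_subspace {v \<in> V. ell2_inner v w = 0}"
  unfolding closed_subspace_def
proof (intro conjI ballI allI impI)
  note D = closed_subspaceD[OF V]
  show "{v \<in> V. ell2_inner v w = 0} \<subseteq> ell2" using D(1) by auto
  show "(\<lambda>i. 0) \<in> {v \<in> V. ell2_inner v w = 0}" using D(2) by (auto simp: ell2_inner_def)
  show "(\<lambda>i. f i + g i) \<in> {v \<in> V. ell2_inner v w = 0}"
    if "f \<in> {v \<in> V. ell2_inner v w = 0}" "g \<in> {v \<in> V. ell2_inner v w = 0}" for f g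
    using that D(1,3) w by (auto simp: ell2_inner_add subset_iff)
  show "(\<lambda>i. c * f i) \<in> {v \<in> V. ell2_inner v w = 0}"
    if "f \<in> {v \<in> V. ell2_inner v w = 0}" for c f
    using that D(4) by (auto simp: ell2_inner_scale)
  fix f :: "'a \<Rightarrow> complex"
  assume f: "f \<in> ell2"
    and lim: "\<forall>\<epsilon>>0. \<exists>g\<in>{v \<in> V. ell2_inner v w = 0}. ell2_norm (\<lambda>i. f i - g i) < \<epsilon>"
  have "f \<in> V" using lim by (intro D(5)[OF f]) blast
  moreover have "cmod (ell2_inner f w) \<le> \<epsilon>" if "\<epsilon> > 0" for \<epsilon>
  proof -
    have "\<epsilon> / (ell2_norm w + 1) > 0"
      using that ell2_norm_nonneg[of w] by (intro divide_pos_pos) auto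
    then obtain g where g: "g \<in> V" "ell2_inner g w = 0"
        "ell2_norm (\<lambda>i. f i - g i) < \<epsilon> / (ell2_norm w + 1)" using lim by blast
    then have "g \<in> ell2" using D(1) by auto
    then have "ell2_inner f w = ell2_inner (\<lambda>i. f i - g i) w"
      using f g w by (simp add: ell2_inner_diff)
    also have "cmod \<dots> \<le> ell2_norm (\<lambda>i. f i - g i) * ell2_norm w"
      using f w \<open>g \<in> ell2\<close> by (intro ell2_Cauchy_Schwarz ell2_diff)
    also have "\<dots> \<le> \<epsilon> / (ell2_norm w + 1) * (ell2_norm w + 1)"
      using g(3) ell2_norm_nonneg[of w] ell2_norm_nonneg[of "\<lambda>i. f i - g i"]
      by (intro mult_mono) auto
    also have "\<dots> = \<epsilon>" using ell2_norm_nonneg[of w] by simp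
    finally show ?thesis .
  qed
  then have "ell2_inner f w = 0"
    by (metis dense_ge norm_le_zero_iff)
  ultimately show "f \<in> {v \<in> V. ell2_inner v w = 0}" by blast
qed

section \<open>Orthonormal systems, projections and bases\<close>

definition orthonormal :: "('i \<Rightarrow> complex) set \<Rightarrow> bool" where
  "orthonormal U \<longleftrightarrow> finite U \<and> U \<subseteq> ell2 \<and>
     (\<forall>u\<in>U. \<forall>v\<in>U. ell2_inner u v = (if u = v then 1 else 0))"

lemma orthonormalD:
  assumes "orthonormal U"
  shows "finite U" "\<And>u. u \<in> U \<Longrightarrow> u \<in> ell2" "\<And>u. u \<in> U \<Longrightarrow> ell2_inner u u = 1"
    "\<And>u v. u \<in> U \<Longrightarrow> v \<in> U \<Longrightarrow> u \<noteq> v \<Longrightarrow> ell2_inner u v = 0"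
  using assms unfolding orthonormal_def by auto

text \<open>For orthonormal \<open>U\<close>, the orthogonal projection onto the span of
  \<open>U\<close>; the equation \<open>proj U v = v\<close> serves throughout as the statement that
  \<open>v\<close> lies in this span.\<close>

definition proj :: "('i \<Rightarrow> complex) set \<Rightarrow> ('i \<Rightarrow> complex) \<Rightarrow> 'i \<Rightarrow> complex" where
  "proj U v = (\<lambda>i. \<Sum>u\<in>U. ell2_inner v u * u i)"

lemma proj_ell2: "orthonormal U \<Longrightarrow> proj U v \<in> ell2"
  unfolding proj_def orthonormal_def by (intro ell2_lincomb) auto

lemma proj_inner:
  assumes "orthonormal U" "w \<in> ell2"
  shows "ell2_inner (proj U v) w = (\<Sum>u\<in>U. ell2_inner v u * ell2_inner u w)"
  unfolding proj_def using assms by (intro ell2_inner_lincomb) (auto simp: orthonormal_def)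

lemma residual_orthogonal:
  assumes U: "orthonormal U" and v: "v \<in> ell2" and u: "u \<in> U"
  shows "ell2_inner (\<lambda>i. v i - proj U v i) u = 0"
proof -
  have "u \<in> ell2" using U u by (auto simp: orthonormal_def)
  then have "ell2_inner (proj U v) u = (\<Sum>u'\<in>U. ell2_inner v u' * (if u' = u then 1 else 0))"
    unfolding proj_inner[OF U \<open>u \<in> ell2\<close>] using U u by (intro sum.cong) (auto simp: orthonormal_def)
  also have "\<dots> = ell2_inner v u"
    using U u by (simp add: orthonormal_def if_distrib[of "\<lambda>x. _ * x"] cong: if_cong)
  finally show ?thesis
    using ell2_inner_diff[OF v proj_ell2[OF U] \<open>u \<in> ell2\<close>] by simp
qed

text \<open>One Gram-Schmidt step. The formula for \<open>w\<close> is part of the conclusion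
  because it keeps \<open>w\<close> in every linear subspace that contains \<open>v\<close> and
  \<open>U\<close>.\<close>

lemma orthonormal_extend:
  assumes U: "orthonormal U" and v: "v \<in> ell2" and ne: "v \<noteq> proj U v"
  shows "\<exists>w c. w \<notin> U \<and> orthonormal (insert w U) \<and> w = (\<lambda>i. c * (v i - proj U v i))
    \<and> proj (insert w U) v = v"
proof -
  define r where "r = (\<lambda>i. v i - proj U v i)"
  have r: "r \<in> ell2" unfolding r_def by (intro ell2_diff v proj_ell2 U)
  have "r \<noteq> (\<lambda>i. 0)"
  proof
    assume "r = (\<lambda>i. 0)"
    then have "r i = 0" for i by simp
    then have "v i = proj U v i" for i by (simp add: r_def)
    then show False using ne by blast
  qed
  then have "ell2_inner r r \<noteq> 0" using ell2_inner_zero_iff[OF r] by blast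
  then have n0: "ell2_norm r \<noteq> 0" unfolding ell2_inner_self[OF r] by simp
  define c :: complex where "c = of_real (1 / ell2_norm r)"
  define w where "w = (\<lambda>i. c * r i)"
  have w: "w \<in> ell2" unfolding w_def by (intro ell2_scale r)
  have wh: "ell2_inner w h = c * ell2_inner r h" for h
    unfolding w_def by (rule ell2_inner_scale)
  have wu: "ell2_inner w u = 0" if "u \<in> U" for u
    using residual_orthogonal[OF U v that] unfolding wh r_def by simp
  have uw: "ell2_inner u w = 0" if "u \<in> U" for u
    unfolding ell2_inner_commute[of u w] wu[OF that] by simp
  have wr: "ell2_inner r w = of_real (ell2_norm r)"
    unfolding ell2_inner_commute[of r w] wh ell2_inner_self[OF r]
    using n0 by (simp add: c_def power2_eq_square)
  have ww: "ell2_inner w w = 1"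
    unfolding wh wr using n0 by (simp add: c_def)
  have "w \<notin> U" using wu[of w] ww by auto
  moreover have on: "orthonormal (insert w U)"
    using U w wu uw ww unfolding orthonormal_def by auto
  moreover have "proj (insert w U) v = v"
  proof
    fix i
    have "ell2_inner (proj U v) w = 0"
      unfolding proj_inner[OF U w] by (intro sum.neutral) (simp add: uw)
    moreover have "ell2_inner r w = ell2_inner v w - ell2_inner (proj U v) w"
      unfolding r_def by (rule ell2_inner_diff[OF v proj_ell2[OF U] w])
    ultimately have "ell2_inner v w = of_real (ell2_norm r)" using wr by simp
    then have "ell2_inner v w * w i = r i" using n0 unfolding w_def c_def by simp
    then have "ell2_inner v w * w i + proj U v i = v i" by (simp add: r_def)
    then show "proj (insert w U) v i = v i"
      using U \<open>w \<notin> U\<close> unfolding proj_def orthonormal_def by simp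
  qed
  moreover have "w = (\<lambda>i. c * (v i - proj U v i))" unfolding w_def r_def ..
  ultimately show ?thesis by (intro exI conjI)
qed

text \<open>A vector in the span of \<open>U\<close> is orthogonal to the vectors added to
  \<open>U\<close>, so these contribute nothing to its projection.\<close>

lemma orthonormal_superset_proj:
  assumes "orthonormal U'" "U \<subseteq> U'" "proj U v = v" "orthonormal U"
  shows "proj U' v = v"
proof -
  have "ell2_inner v u = 0" if "u \<in> U' - U" for u
  proof -
    have u: "u \<in> ell2" using orthonormalD(2)[OF assms(1)] that by blast
    have "ell2_inner v u = ell2_inner (proj U v) u" unfolding assms(3) ..
    also have "\<dots> = (\<Sum>u'\<in>U. ell2_inner v u' * ell2_inner u' u)"
      by (rule proj_inner[OF assms(4) u])
    also have "\<dots> = 0"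
    proof (intro sum.neutral ballI)
      fix u' assume "u' \<in> U"
      then have "ell2_inner u' u = 0" using assms(2) that by (intro orthonormalD(4)[OF assms(1)]) auto
      then show "ell2_inner v u' * ell2_inner u' u = 0" by simp
    qed
    finally show ?thesis .
  qed
  then have "proj U' v = proj U v"
    unfolding proj_def using assms(1,2) orthonormalD(1)[OF assms(1)]
    by (intro ext sum.mono_neutral_right) auto
  then show ?thesis using assms(3) by simp
qed

lemma gram_schmidt:
  assumes L: "linear_subspace L" and "finite B" "B \<subseteq> L"
  shows "\<exists>U. orthonormal U \<and> U \<subseteq> L \<and> (\<forall>b\<in>B. proj U b = b)"
  using assms(2,3)
proof (induction B rule: finite_induct)
  case empty
  then show ?case by (intro exI[of _ "{}"]) (auto simp: orthonormal_def)
next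
  case (insert b B)
  then obtain U where U: "orthonormal U" "U \<subseteq> L" "\<forall>b\<in>B. proj U b = b" by blast
  have b: "b \<in> L" "b \<in> ell2" using insert L by (auto simp: linear_subspace_def)
  show ?case
  proof (cases "b = proj U b")
    case True
    then have "\<forall>a\<in>insert b B. proj U a = a" using U(3) by (metis insertE)
    then show ?thesis using U(1,2) by blast
  next
    case False
    obtain w c where w: "orthonormal (insert w U)" "w = (\<lambda>i. c * (b i - proj U b i))"
       "proj (insert w U) b = b" using orthonormal_extend[OF U(1) b(2) False] by blast
    have "proj U b \<in> L" unfolding proj_def using U(2) by (intro linear_subspace_lincomb[OF L]) auto
    then have "(\<lambda>i. b i - proj U b i) \<in> L" using b by (intro linear_subspace_diff[OF L])
    then have "w \<in> L" unfolding w(2) by (rule linear_subspaceD(4)[OF L])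
    moreover have "\<forall>a\<in>insert b B. proj (insert w U) a = a"
      using w(3) U(3) orthonormal_superset_proj[OF w(1) _ _ U(1)] by blast
    ultimately show ?thesis using w(1) U(2) by blast
  qed
qed

lemma ell2_inner_mult_swap:
  "ell2_inner v u * ell2_inner u v = of_real ((cmod (ell2_inner v u))\<^sup>2)"
  unfolding complex_norm_square ell2_inner_commute[of u v] ..

lemma bessel:
  assumes U: "orthonormal U" and v: "v \<in> ell2"
  shows "(\<Sum>u\<in>U. (cmod (ell2_inner v u))\<^sup>2) \<le> (ell2_norm v)\<^sup>2"
proof -
  define r where "r = (\<lambda>i. v i - proj U v i)"
  have r: "r \<in> ell2" unfolding r_def by (intro ell2_diff v proj_ell2 U)
  have ur: "ell2_inner u r = 0" if "u \<in> U" for u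
    using residual_orthogonal[OF U v that] ell2_inner_commute[of u r]
    unfolding r_def[symmetric] by simp
  have "ell2_inner (proj U v) r = 0"
    unfolding proj_inner[OF U r] by (intro sum.neutral) (simp add: ur)
  moreover have "ell2_inner r r = ell2_inner v r - ell2_inner (proj U v) r"
    using ell2_inner_diff[OF v proj_ell2[OF U] r] unfolding r_def .
  ultimately have "ell2_inner r r = ell2_inner v r" by simp
  also have "\<dots> = cnj (ell2_inner r v)" by (rule ell2_inner_commute)
  also have "ell2_inner r v = ell2_inner v v - ell2_inner (proj U v) v"
    unfolding r_def by (intro ell2_inner_diff v proj_ell2 U)
  also have "ell2_inner (proj U v) v = of_real (\<Sum>u\<in>U. (cmod (ell2_inner v u))\<^sup>2)"
    unfolding proj_inner[OF U v] of_real_sum ell2_inner_mult_swap ..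
  finally have "complex_of_real ((ell2_norm r)\<^sup>2)
      = of_real ((ell2_norm v)\<^sup>2 - (\<Sum>u\<in>U. (cmod (ell2_inner v u))\<^sup>2))"
    unfolding ell2_inner_self[OF r] ell2_inner_self[OF v] by simp
  then have "(ell2_norm r)\<^sup>2 = (ell2_norm v)\<^sup>2 - (\<Sum>u\<in>U. (cmod (ell2_inner v u))\<^sup>2)"
    unfolding of_real_eq_iff .
  then show ?thesis using zero_le_power2[of "ell2_norm r"] by linarith
qed

text \<open>Double counting of the squares of the inner products between \<open>U\<close> and
  \<open>F\<close>: each vector of \<open>F\<close> accounts for exactly 1, and by Bessel's
  inequality each vector of \<open>U\<close> for at most 1.\<close>

lemma orthonormal_card_le:
  assumes U: "orthonormal U" and F: "orthonormal F" and span: "\<And>v. v \<in> F \<Longrightarrow> proj U v = v"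
  shows "card F \<le> card U"
proof -
  have nrm: "(ell2_norm u)\<^sup>2 = 1" if "u \<in> U" for u
  proof -
    have "complex_of_real ((ell2_norm u)\<^sup>2) = of_real 1"
      using ell2_inner_self[OF orthonormalD(2)[OF U that]] orthonormalD(3)[OF U that] by simp
    then show ?thesis by (simp only: of_real_eq_iff)
  qed
  have 1: "1 = (\<Sum>u\<in>U. (cmod (ell2_inner u v))\<^sup>2)" if "v \<in> F" for v
  proof -
    have v: "v \<in> ell2" by (rule orthonormalD(2)[OF F that])
    have "1 = ell2_inner v v" using orthonormalD(3)[OF F that] ..
    also have "\<dots> = (\<Sum>u\<in>U. ell2_inner v u * ell2_inner u v)"
      using proj_inner[OF U v, of v] span[OF that] by simp
    also have "\<dots> = of_real (\<Sum>u\<in>U. (cmod (ell2_inner u v))\<^sup>2)"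
      unfolding of_real_sum by (intro sum.cong refl) (metis ell2_inner_mult_swap mult.commute)
    finally have "complex_of_real 1 = of_real (\<Sum>u\<in>U. (cmod (ell2_inner u v))\<^sup>2)" by simp
    then show ?thesis unfolding of_real_eq_iff .
  qed
  have "real (card F) = (\<Sum>v\<in>F. \<Sum>u\<in>U. (cmod (ell2_inner u v))\<^sup>2)"
    using 1 by simp
  also have "\<dots> = (\<Sum>u\<in>U. \<Sum>v\<in>F. (cmod (ell2_inner u v))\<^sup>2)" by (rule sum.swap)
  also have "\<dots> \<le> (\<Sum>u\<in>U. (ell2_norm u)\<^sup>2)"
    using U by (intro sum_mono bessel F) (auto simp: orthonormal_def)
  also have "\<dots> = real (card U)" using nrm by simp
  finally show ?thesis by simp
qed

lemma orthonormal_basis_exists: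
  assumes V: "linear_subspace V" and fd: "finite_dimensional V"
  shows "\<exists>U. orthonormal U \<and> U \<subseteq> V \<and> (\<forall>v\<in>V. proj U v = v)"
proof -
  obtain B where B: "finite B" "B \<subseteq> V" "\<And>v. v \<in> V \<Longrightarrow> \<exists>c. v = (\<lambda>i. \<Sum>b\<in>B. c b * b i)"
    using fd unfolding finite_dimensional_def by blast
  obtain U where U: "orthonormal U" "U \<subseteq> V" "\<forall>b\<in>B. proj U b = b"
    using gram_schmidt[OF V B(1,2)] by blast
  have "proj U v = v" if v: "v \<in> V" for v
  proof
    fix i
    obtain c where c: "v = (\<lambda>i. \<Sum>b\<in>B. c b * b i)" using B(3)[OF v] by blast
    have in_ell2: "b \<in> ell2" if "b \<in> V" for b using V that by (auto simp: linear_subspace_def)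
    have "proj U v i = (\<Sum>u\<in>U. \<Sum>b\<in>B. c b * (ell2_inner b u * u i))"
      unfolding proj_def using U(2) B(2) in_ell2
      by (intro sum.cong refl)
        (subst c, subst ell2_inner_lincomb, auto simp: sum_distrib_right mult.assoc)
    also have "\<dots> = (\<Sum>b\<in>B. c b * proj U b i)"
      by (subst sum.swap) (simp add: proj_def sum_distrib_left)
    also have "\<dots> = v i" using U(3) c by simp
    finally show "proj U v i = v i" .
  qed
  then show ?thesis using U by blast
qed

text \<open>The cardinalities of orthonormal systems in \<open>L\<close> are bounded by
  \<open>card U\<close>. A system of maximal cardinality spans \<open>L\<close>, since the residual
  of a vector outside of its span would enlarge it.\<close>

lemma subspace_basis_exists:
  assumes V: "orthonormal U" "\<And>v. v \<in> V \<Longrightarrow> proj U v = v" and L: "linear_subspace L" "L \<subseteq> V"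
  shows "\<exists>F. orthonormal F \<and> F \<subseteq> L \<and> (\<forall>v\<in>L. proj F v = v)"
proof -
  let ?C = "{card F | F. orthonormal F \<and> F \<subseteq> L}"
  have "?C \<subseteq> {..card U}" using orthonormal_card_le[OF V(1)] V(2) L(2) by blast
  then have fin: "finite ?C" by (rule finite_subset) auto
  have "orthonormal {}" by (simp add: orthonormal_def)
  then have "?C \<noteq> {}" by blast
  from Max_in[OF fin this] obtain F where F: "Max ?C = card F" "orthonormal F" "F \<subseteq> L" by blast
  have "proj F v = v" if v: "v \<in> L" for v
  proof (rule ccontr)
    assume ne: "proj F v \<noteq> v"
    have "v \<in> ell2" using v L(1) by (auto simp: linear_subspace_def)
    then obtain w c where w: "w \<notin> F" "orthonormal (insert w F)" "w = (\<lambda>i. c * (v i - proj F v i))"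
      using orthonormal_extend[OF F(2) _ ne[symmetric]] by blast
    have "proj F v \<in> L" unfolding proj_def using F(3) by (intro linear_subspace_lincomb[OF L(1)]) auto
    then have "(\<lambda>i. v i - proj F v i) \<in> L" using v by (intro linear_subspace_diff[OF L(1)])
    then have "w \<in> L" unfolding w(3) by (rule linear_subspaceD(4)[OF L(1)])
    then have "card (insert w F) \<in> ?C" using w(2) F(3) by blast
    then have "card (insert w F) \<le> Max ?C" by (rule Max_ge[OF fin])
    then show False using w(1) orthonormalD(1)[OF F(2)] F(1) by simp
  qed
  then show ?thesis using F by blast
qed

text \<open>In finite dimension a cyclic vector is cyclic algebraically, without closure. The
  residual \<open>r\<close> of a vector of \<open>V\<close> against \<open>L\<close> has as its
  orthogonal complement in \<open>V\<close> a closed subspace containing \<open>A\<close>; this is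
  all of \<open>V\<close>, so \<open>r\<close> is orthogonal to itself.\<close>

lemma closed_span_finite_dimensional:
  assumes V: "closed_subspace V" "finite_dimensional V"
    and L: "linear_subspace L" "A \<subseteq> L" "L \<subseteq> V" and span: "closed_span A = V"
  shows "L = V"
proof
  show "V \<subseteq> L"
  proof
    fix v assume v: "v \<in> V"
    obtain U where U: "orthonormal U" "\<And>v. v \<in> V \<Longrightarrow> proj U v = v"
      using orthonormal_basis_exists[OF closed_subspace_linear[OF V(1)] V(2)] by blast
    obtain F where F: "orthonormal F" "F \<subseteq> L" "\<And>v. v \<in> L \<Longrightarrow> proj F v = v"
      using subspace_basis_exists[OF U L(1,3)] by blast
    define r where "r = (\<lambda>i. v i - proj F v i)"
    have "v \<in> ell2" using v closed_subspaceD(1)[OF V(1)] by auto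
    then have r: "r \<in> ell2" unfolding r_def by (intro ell2_diff proj_ell2 F(1))
    have p: "proj F v \<in> L" unfolding proj_def using F(2) by (intro linear_subspace_lincomb[OF L(1)]) auto
    have "r \<in> V" unfolding r_def using p L(3) v
      by (intro linear_subspace_diff[OF closed_subspace_linear[OF V(1)]]) auto
    have "ell2_inner a r = 0" if "a \<in> L" for a
    proof -
      have ur: "ell2_inner u r = 0" if "u \<in> F" for u
        using residual_orthogonal[OF F(1) \<open>v \<in> ell2\<close> that] ell2_inner_commute[of u r]
        unfolding r_def[symmetric] by simp
      have "ell2_inner (proj F a) r = 0"
        unfolding proj_inner[OF F(1) r] by (intro sum.neutral) (simp add: ur)
      then show ?thesis unfolding F(3)[OF that] .
    qed
    then have "A \<subseteq> {x \<in> V. ell2_inner x r = 0}" using L by blast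
    then have "V \<subseteq> {x \<in> V. ell2_inner x r = 0}"
      using closed_subspace_orthogonal[OF V(1) r] span unfolding closed_span_def by blast
    then have "ell2_inner r r = 0" using \<open>r \<in> V\<close> by blast
    then have "r = (\<lambda>i. 0)" using ell2_inner_zero_iff[OF r] by simp
    then have "r i = 0" for i by simp
    then have "v i = proj F v i" for i by (simp add: r_def)
    then have "v = proj F v" by blast
    then show "v \<in> L" using p by simp
  qed
qed (rule L(3))

section \<open>Coordinates for finite characters\<close>

lemma euclidean_inner:
  assumes "f \<in> euclidean_Cn n"
  shows "ell2_inner f g = (\<Sum>i<n. f i * cnj (g i))"
proof -
  have "ell2_inner f g = (\<Sum>\<^sub>\<infinity>i\<in>{..<n}. f i * cnj (g i))"
    unfolding ell2_inner_def using assms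
    by (intro infsum_cong_neutral) (auto simp: euclidean_Cn_def)
  then show ?thesis by simp
qed

lemma euclidean_subset_ell2: "euclidean_Cn n \<subseteq> ell2"
proof
  fix f assume "f \<in> euclidean_Cn n"
  then have "(\<lambda>i. (cmod (f i))\<^sup>2) summable_on UNIV \<longleftrightarrow> (\<lambda>i. (cmod (f i))\<^sup>2) summable_on {..<n}"
    by (intro summable_on_cong_neutral) (auto simp: euclidean_Cn_def)
  then show "f \<in> ell2" by (simp add: ell2_def)
qed

lemma closed_subspace_euclidean: "closed_subspace (euclidean_Cn n)"
  unfolding closed_subspace_def
proof (intro conjI ballI allI impI)
  fix f :: "nat \<Rightarrow> complex"
  assume f: "f \<in> ell2" and lim: "\<forall>\<epsilon>>0. \<exists>g\<in>euclidean_Cn n. ell2_norm (\<lambda>i. f i - g i) < \<epsilon>"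
  have "f i = 0" if i: "i \<ge> n" for i
  proof -
    have "cmod (f i) \<le> 0 + \<epsilon>" if pos: "\<epsilon> > 0" for \<epsilon>
    proof -
      obtain g where g: "g \<in> euclidean_Cn n" "ell2_norm (\<lambda>i. f i - g i) < \<epsilon>"
        using lim pos by blast
      have "g \<in> ell2" using g(1) euclidean_subset_ell2 by blast
      then have "cmod (f i - g i) \<le> ell2_norm (\<lambda>i. f i - g i)"
        using ell2_coord_le_norm[OF ell2_diff[OF f]] by blast
      moreover have "g i = 0" using g(1) i by (simp add: euclidean_Cn_def)
      ultimately show ?thesis using g(2) by simp
    qed
    then have "cmod (f i) \<le> 0" by (rule field_le_epsilon)
    then show ?thesis by simp
  qed
  then show "f \<in> euclidean_Cn n" by (simp add: euclidean_Cn_def)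
qed (use euclidean_subset_ell2 in \<open>auto simp: euclidean_Cn_def\<close>)

text \<open>Cyclicity is stated with the algebraic span of the orbit, because the domination of
  vector states works with finite combinations of orbit vectors. The fixed space
  \<open>euclidean_Cn n\<close> makes representations comparable by \<open>rep_iso\<close>.\<close>

definition coordinate_gns :: "('a, 'b) monoid_scheme \<Rightarrow> ('a \<Rightarrow> complex) \<Rightarrow> nat
    \<Rightarrow> ('a \<Rightarrow> (nat \<Rightarrow> complex) \<Rightarrow> nat \<Rightarrow> complex) \<Rightarrow> (nat \<Rightarrow> complex) \<Rightarrow> bool" where
  "coordinate_gns G \<phi> n \<pi> \<xi> \<longleftrightarrow> \<pi> \<in> reps_of_dim G n \<and> \<xi> \<in> euclidean_Cn n
     \<and> (\<forall>g\<in>carrier G. \<phi> g = ell2_inner (\<pi> g \<xi>) \<xi>)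
     \<and> (\<forall>v\<in>euclidean_Cn n. \<exists>F d. finite F \<and> F \<subseteq> carrier G \<and> v = (\<lambda>i. \<Sum>g\<in>F. d g * \<pi> g \<xi> i))"

lemma linear_subspace_span:
  assumes "\<And>g. g \<in> X \<Longrightarrow> e g \<in> ell2"
  shows "linear_subspace {(\<lambda>i. \<Sum>g\<in>F. d g * e g i) | F d. finite F \<and> F \<subseteq> X}"
    (is "linear_subspace ?L")
  unfolding linear_subspace_def
proof (intro conjI ballI allI)
  show "?L \<subseteq> ell2"
  proof
    fix f assume "f \<in> ?L"
    then obtain F d where "F \<subseteq> X" "f = (\<lambda>i. \<Sum>g\<in>F. d g * e g i)" by blast
    then show "f \<in> ell2" using assms by (auto intro: ell2_lincomb)
  qed
  have "(\<lambda>i. \<Sum>g\<in>{}. 0 * e g i) \<in> ?L" by (intro CollectI exI[of _ "{}"] exI[of _ "\<lambda>_. 0"]) simp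
  then show "(\<lambda>i. 0) \<in> ?L" by simp
  fix f g assume "f \<in> ?L" "g \<in> ?L"
  then obtain A a B b where AB: "finite A" "A \<subseteq> X" "f = (\<lambda>i. \<Sum>g\<in>A. a g * e g i)"
      "finite B" "B \<subseteq> X" "g = (\<lambda>i. \<Sum>g\<in>B. b g * e g i)" by blast
  define c where "c x = (if x \<in> A then a x else 0) + (if x \<in> B then b x else 0)" for x
  have "f i = (\<Sum>x\<in>A \<union> B. (if x \<in> A then a x else 0) * e x i)" for i
    unfolding AB(3) using AB(1,4) by (intro sum.mono_neutral_cong_left) auto
  moreover have "g i = (\<Sum>x\<in>A \<union> B. (if x \<in> B then b x else 0) * e x i)" for i
    unfolding AB(6) using AB(1,4) by (intro sum.mono_neutral_cong_left) auto
  ultimately have "(\<lambda>i. f i + g i) = (\<lambda>i. \<Sum>x\<in>A \<union> B. c x * e x i)"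
    by (simp add: c_def distrib_right sum.distrib)
  then show "(\<lambda>i. f i + g i) \<in> ?L"
    using AB by (intro CollectI exI[of _ "A \<union> B"] exI[of _ c]) simp
next
  fix c f assume "f \<in> ?L"
  then obtain A a where A: "finite A" "A \<subseteq> X" "f = (\<lambda>i. \<Sum>g\<in>A. a g * e g i)" by blast
  have "(\<lambda>i. c * f i) = (\<lambda>i. \<Sum>g\<in>A. (c * a g) * e g i)"
    unfolding A(3) by (simp add: sum_distrib_left mult.assoc)
  then show "(\<lambda>i. c * f i) \<in> ?L"
    using A by (intro CollectI exI[of _ A] exI[of _ "\<lambda>g. c * a g"]) simp
qed

text \<open>The GNS space is some finite-dimensional subspace; coordinates in an orthonormal basis
  carry its representation into \<open>reps_of_dim G n\<close>, the set to which condition (d) of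
  \<open>charfinite\<close> refers.\<close>

lemma finite_character_coordinates:
  assumes fin: "finite_character G \<phi>"
  shows "\<exists>n \<pi> \<xi>. coordinate_gns G \<phi> n \<pi> \<xi>"
proof -
  obtain V \<sigma> \<eta> where gns: "gns_triple G \<phi> V \<sigma> \<eta>" and fd: "finite_dimensional V"
    using fin unfolding finite_character_def by blast
  have rep: "unitary_rep G V \<sigma>" and \<eta>: "\<eta> \<in> V" and V: "closed_subspace V"
    and span: "closed_span ((\<lambda>g. \<sigma> g \<eta>) ` carrier G) = V"
    and \<phi>: "\<And>g. g \<in> carrier G \<Longrightarrow> \<phi> g = ell2_inner (\<sigma> g \<eta>) \<eta>"
    using gns unfolding gns_triple_def unitary_rep_def by blast+
  have \<sigma>: "linear_map_on V (\<sigma> g)" "\<sigma> g ` V = V"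
     "\<And>v w. v \<in> V \<Longrightarrow> w \<in> V \<Longrightarrow> ell2_inner (\<sigma> g v) (\<sigma> g w) = ell2_inner v w"
     if "g \<in> carrier G" for g
    using rep that unfolding unitary_rep_def unitary_map_def by blast+
  have \<sigma>V: "\<sigma> g v \<in> V" if "g \<in> carrier G" "v \<in> V" for g v using \<sigma>(2)[OF that(1)] that(2) by blast
  have hom: "\<sigma> (g \<otimes>\<^bsub>G\<^esub> h) v = \<sigma> g (\<sigma> h v)" if "g \<in> carrier G" "h \<in> carrier G" "v \<in> V" for g h v
    using rep that unfolding unitary_rep_def by blast
  have Ve: "v \<in> ell2" if "v \<in> V" for v using closed_subspaceD(1)[OF V] that by blast
  define L where "L = {(\<lambda>i. \<Sum>g\<in>F. d g * \<sigma> g \<eta> i) | F d. finite F \<and> F \<subseteq> carrier G}"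
  have L: "linear_subspace L"
    unfolding L_def using \<sigma>V[OF _ \<eta>] Ve by (intro linear_subspace_span) blast
  have LV: "L \<subseteq> V"
  proof
    fix v assume "v \<in> L"
    then obtain F d where "F \<subseteq> carrier G" "v = (\<lambda>i. \<Sum>g\<in>F. d g * \<sigma> g \<eta> i)"
      unfolding L_def by blast
    then show "v \<in> V"
      using \<sigma>V[OF _ \<eta>] linear_subspace_lincomb[OF closed_subspace_linear[OF V], of F "\<lambda>g. \<sigma> g \<eta>" d]
      by blast
  qed
  have orb: "(\<lambda>g. \<sigma> g \<eta>) ` carrier G \<subseteq> L"
  proof (rule image_subsetI)
    fix g assume "g \<in> carrier G"
    then have "(\<lambda>i. \<Sum>x\<in>{g}. 1 * \<sigma> x \<eta> i) \<in> L"
      unfolding L_def by (intro CollectI exI[of _ "{g}"] exI[of _ "\<lambda>_. 1"]) simp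
    then show "\<sigma> g \<eta> \<in> L" by simp
  qed
  have L_eq: "L = V" by (rule closed_span_finite_dimensional[OF V fd L orb LV span])
  obtain U where U: "orthonormal U" "U \<subseteq> V" "\<And>v. v \<in> V \<Longrightarrow> proj U v = v"
    using orthonormal_basis_exists[OF closed_subspace_linear[OF V] fd] by blast
  define n where "n = card U"
  obtain e where e: "bij_betw e {..<n} U"
    using ex_bij_betw_nat_finite[OF orthonormalD(1)[OF U(1)]] unfolding n_def lessThan_atLeast0 by blast
  have eU: "e i \<in> U" if "i < n" for i using e that by (auto simp: bij_betw_def)
  have ee: "e i \<in> ell2" if "i < n" for i using orthonormalD(2)[OF U(1) eU[OF that]] .
  have eij: "ell2_inner (e i) (e j) = (if i = j then 1 else 0)" if "i < n" "j < n" for i j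
  proof (cases "i = j")
    case True
    then show ?thesis using orthonormalD(3)[OF U(1) eU[OF that(1)]] by simp
  next
    case False
    then have "e i \<noteq> e j" using e that by (auto simp: bij_betw_def inj_on_def)
    then show ?thesis using False orthonormalD(4)[OF U(1) eU[OF that(1)] eU[OF that(2)]] by simp
  qed
  \<comment> \<open>\<open>T\<close> takes coordinates in the basis \<open>e\<close> and
    \<open>S\<close> is its inverse; the value 0 from \<open>n\<close> on places \<open>T v\<close>
    in \<open>euclidean_Cn n\<close>.\<close>
  define T where "T v = (\<lambda>i. if i < n then ell2_inner v (e i) else 0)" for v
  define S where "S w = (\<lambda>j. \<Sum>i<n. w i * e i j)" for w :: "nat \<Rightarrow> complex"
  have T_in: "T v \<in> euclidean_Cn n" for v by (simp add: T_def euclidean_Cn_def)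
  have S_in: "S w \<in> V" for w
    unfolding S_def using eU U(2) by (intro linear_subspace_lincomb[OF closed_subspace_linear[OF V]]) auto
  have ST: "S (T v) = v" if "v \<in> V" for v
  proof -
    have "S (T v) = (\<lambda>j. \<Sum>i<n. ell2_inner v (e i) * e i j)" by (simp add: S_def T_def)
    also have "\<dots> = proj U v"
      unfolding proj_def by (intro ext sum.reindex_bij_betw[OF e])
    finally show ?thesis using U(3)[OF that] by simp
  qed
  have TS: "T (S w) = w" if "w \<in> euclidean_Cn n" for w
  proof
    fix k
    show "T (S w) k = w k"
    proof (cases "k < n")
      case True
      have "T (S w) k = ell2_inner (S w) (e k)" using True by (simp add: T_def)
      also have "\<dots> = (\<Sum>i<n. w i * ell2_inner (e i) (e k))"
        unfolding S_def using ee True by (intro ell2_inner_lincomb) auto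
      also have "\<dots> = (\<Sum>i<n. if i = k then w i else 0)"
        using eij[OF _ True] by (intro sum.cong) auto
      finally show ?thesis using True by simp
    next
      case False
      then show ?thesis using that by (simp add: T_def euclidean_Cn_def)
    qed
  qed
  have T_lincomb: "T (\<lambda>i. \<Sum>x\<in>F. d x * f x i) = (\<lambda>i. \<Sum>x\<in>F. d x * T (f x) i)"
    if "\<And>x. x \<in> F \<Longrightarrow> f x \<in> V" for F :: "'a set" and d f
    using that Ve ee by (auto simp: T_def fun_eq_iff ell2_inner_lincomb)
  have T_add: "T (\<lambda>i. v i + w i) = (\<lambda>i. T v i + T w i)" if "v \<in> V" "w \<in> V" for v w
    using that Ve ee by (auto simp: T_def fun_eq_iff ell2_inner_add)
  have T_scale: "T (\<lambda>i. c * v i) = (\<lambda>i. c * T v i)" for c v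
    by (auto simp: T_def fun_eq_iff ell2_inner_scale)
  have T_inner: "ell2_inner (T v) (T w) = ell2_inner v w" if "v \<in> V" "w \<in> V" for v w
  proof -
    have "ell2_inner (T v) (T w) = (\<Sum>i<n. ell2_inner v (e i) * ell2_inner (e i) w)"
      unfolding euclidean_inner[OF T_in] by (simp add: T_def ell2_inner_commute[of "e _" w])
    also have "\<dots> = (\<Sum>u\<in>U. ell2_inner v u * ell2_inner u w)"
      by (rule sum.reindex_bij_betw[OF e])
    also have "\<dots> = ell2_inner (proj U v) w" using proj_inner[OF U(1) Ve[OF that(2)]] by simp
    finally show ?thesis using U(3)[OF that(1)] by simp
  qed
  define \<pi> where "\<pi> g w = T (\<sigma> g (S w))" for g w
  define \<xi> where "\<xi> = T \<eta>"
  have \<pi>\<xi>: "\<pi> g \<xi> = T (\<sigma> g \<eta>)" for g by (simp add: \<pi>_def \<xi>_def ST[OF \<eta>])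
  have "\<pi> \<in> reps_of_dim G n"
    unfolding reps_of_dim_def unitary_rep_def unitary_map_def linear_map_on_def
  proof (intro CollectI conjI ballI allI closed_subspace_euclidean)
    fix g assume g: "g \<in> carrier G"
    show "\<pi> g (\<lambda>i. v i + w i) = (\<lambda>i. \<pi> g v i + \<pi> g w i)" for v w
    proof -
      have "S (\<lambda>i. v i + w i) = (\<lambda>j. S v j + S w j)"
        by (simp add: S_def distrib_right sum.distrib)
      moreover have "\<sigma> g (\<lambda>j. S v j + S w j) = (\<lambda>j. \<sigma> g (S v) j + \<sigma> g (S w) j)"
        using \<sigma>(1)[OF g] S_in unfolding linear_map_on_def by blast
      ultimately show ?thesis unfolding \<pi>_def using T_add \<sigma>V[OF g S_in] by simp
    qed
    show "\<pi> g (\<lambda>i. c * v i) = (\<lambda>i. c * \<pi> g v i)" for c v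
    proof -
      have "S (\<lambda>i. c * v i) = (\<lambda>j. c * S v j)"
        by (simp add: S_def sum_distrib_left mult.assoc)
      moreover have "\<sigma> g (\<lambda>j. c * S v j) = (\<lambda>j. c * \<sigma> g (S v) j)"
        using \<sigma>(1)[OF g] S_in unfolding linear_map_on_def by blast
      ultimately show ?thesis unfolding \<pi>_def using T_scale by simp
    qed
    show "\<pi> g ` euclidean_Cn n = euclidean_Cn n"
    proof
      show "\<pi> g ` euclidean_Cn n \<subseteq> euclidean_Cn n" unfolding \<pi>_def using T_in by blast
      show "euclidean_Cn n \<subseteq> \<pi> g ` euclidean_Cn n"
      proof
        fix w assume w: "w \<in> euclidean_Cn n"
        have "S w \<in> \<sigma> g ` V" unfolding \<sigma>(2)[OF g] by (rule S_in)
        then obtain v where v: "S w = \<sigma> g v" "v \<in> V" by (rule imageE)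
        have "\<pi> g (T v) = w" unfolding \<pi>_def ST[OF v(2)] v(1)[symmetric] by (rule TS[OF w])
        then show "w \<in> \<pi> g ` euclidean_Cn n" using T_in[of v] by (metis imageI)
      qed
    qed
    show "ell2_inner (\<pi> g v) (\<pi> g w) = ell2_inner v w"
      if "v \<in> euclidean_Cn n" "w \<in> euclidean_Cn n" for v w
      using T_inner[OF \<sigma>V[OF g S_in] \<sigma>V[OF g S_in], of v w] \<sigma>(3)[OF g S_in S_in, of v w]
        T_inner[OF S_in S_in, of v w] TS[OF that(1)] TS[OF that(2)] unfolding \<pi>_def by simp
    show "\<pi> (g \<otimes>\<^bsub>G\<^esub> h) v = \<pi> g (\<pi> h v)" if h: "h \<in> carrier G" for h v
      unfolding \<pi>_def hom[OF g h S_in] ST[OF \<sigma>V[OF h S_in]] ..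
  qed
  moreover have "\<xi> \<in> euclidean_Cn n" by (simp add: \<xi>_def T_in)
  moreover have "\<forall>g\<in>carrier G. \<phi> g = ell2_inner (\<pi> g \<xi>) \<xi>"
  proof
    fix g assume g: "g \<in> carrier G"
    show "\<phi> g = ell2_inner (\<pi> g \<xi>) \<xi>"
      unfolding \<pi>\<xi> \<phi>[OF g] by (simp add: \<xi>_def T_inner[OF \<sigma>V[OF g \<eta>] \<eta>])
  qed
  moreover have "\<forall>v\<in>euclidean_Cn n. \<exists>F d. finite F \<and> F \<subseteq> carrier G
      \<and> v = (\<lambda>i. \<Sum>g\<in>F. d g * \<pi> g \<xi> i)"
  proof
    fix v assume v: "v \<in> euclidean_Cn n"
    have "S v \<in> L" using S_in L_eq by simp
    then obtain F d where F: "finite F" "F \<subseteq> carrier G" "S v = (\<lambda>i. \<Sum>g\<in>F. d g * \<sigma> g \<eta> i)"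
      unfolding L_def by blast
    have "v = T (S v)" by (rule TS[OF v, symmetric])
    also have "\<dots> = (\<lambda>i. \<Sum>g\<in>F. d g * T (\<sigma> g \<eta>) i)"
      unfolding F(3) using F(2) \<sigma>V[OF _ \<eta>] by (intro T_lincomb) blast
    finally have "v = (\<lambda>i. \<Sum>g\<in>F. d g * \<pi> g \<xi> i)" unfolding \<pi>\<xi> .
    then show "\<exists>F d. finite F \<and> F \<subseteq> carrier G \<and> v = (\<lambda>i. \<Sum>g\<in>F. d g * \<pi> g \<xi> i)"
      using F(1,2) by blast
  qed
  ultimately show ?thesis unfolding coordinate_gns_def by blast
qed

section \<open>Extremal finite characters\<close>

definition pd_form :: "('a, 'b) monoid_scheme \<Rightarrow> 'a set \<Rightarrow> ('a \<Rightarrow> complex) \<Rightarrow> ('a \<Rightarrow> complex) \<Rightarrow> complex" where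
  "pd_form G F c \<phi> = (\<Sum>x\<in>F. \<Sum>y\<in>F. c x * cnj (c y) * \<phi> (inv\<^bsub>G\<^esub> y \<otimes>\<^bsub>G\<^esub> x))"

lemma positive_definite_iff:
  "positive_definite G \<phi> \<longleftrightarrow>
     (\<forall>F c. finite F \<and> F \<subseteq> carrier G \<longrightarrow> pd_form G F c \<phi> \<in> \<real>\<^sub>\<ge>\<^sub>0)"
  by (simp add: positive_definite_def pd_form_def)

lemma pd_form_lincomb:
  "pd_form G F c (\<lambda>x. a * \<phi> x + b * \<psi> x) = a * pd_form G F c \<phi> + b * pd_form G F c \<psi>"
  by (simp add: pd_form_def sum_distrib_left distrib_left sum.distrib mult.assoc mult.left_commute[of a] mult.left_commute[of b])

lemma charactersD:
  assumes "\<phi> \<in> characters G"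
  shows "\<And>x. x \<notin> carrier G \<Longrightarrow> \<phi> x = 0" "positive_definite G \<phi>" "\<phi> \<one>\<^bsub>G\<^esub> = 1"
    "\<And>g x. g \<in> carrier G \<Longrightarrow> x \<in> carrier G \<Longrightarrow> \<phi> (g \<otimes>\<^bsub>G\<^esub> x \<otimes>\<^bsub>G\<^esub> inv\<^bsub>G\<^esub> g) = \<phi> x"
    "\<And>F c. finite F \<Longrightarrow> F \<subseteq> carrier G \<Longrightarrow> pd_form G F c \<phi> \<in> \<real>\<^sub>\<ge>\<^sub>0"
  using assms by (auto simp: characters_def normalized_pd_def group_functions_def positive_definite_iff)

lemma charactersI:
  assumes "\<And>x. x \<notin> carrier G \<Longrightarrow> \<phi> x = 0" "\<phi> \<one>\<^bsub>G\<^esub> = 1"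
    "\<And>g x. g \<in> carrier G \<Longrightarrow> x \<in> carrier G \<Longrightarrow> \<phi> (g \<otimes>\<^bsub>G\<^esub> x \<otimes>\<^bsub>G\<^esub> inv\<^bsub>G\<^esub> g) = \<phi> x"
    "\<And>F c. finite F \<Longrightarrow> F \<subseteq> carrier G \<Longrightarrow> pd_form G F c \<phi> \<in> \<real>\<^sub>\<ge>\<^sub>0"
  shows "\<phi> \<in> characters G"
  using assms by (auto simp: characters_def normalized_pd_def group_functions_def positive_definite_iff)

lemma convex_comb_character:
  assumes "\<phi> \<in> characters G" "\<psi> \<in> characters G" "0 \<le> t" "t \<le> 1"
  shows "convex_comb t \<phi> \<psi> \<in> characters G"
proof (rule charactersI)
  fix F :: "'a set" and c assume "finite F" "F \<subseteq> carrier G"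
  then show "pd_form G F c (convex_comb t \<phi> \<psi>) \<in> \<real>\<^sub>\<ge>\<^sub>0"
    unfolding convex_comb_def pd_form_lincomb
    using charactersD(5)[OF assms(1)] charactersD(5)[OF assms(2)] assms(3,4)
    by (intro nonneg_Reals_add_I nonneg_Reals_mult_I) (auto simp: complex_nonneg_Reals_iff)
qed (use charactersD[OF assms(1)] charactersD[OF assms(2)] in
      \<open>auto simp: convex_comb_def simp flip: of_real_add\<close>)

text \<open>The normalized remainder \<open>\<rho> = (C \<psi> - \<phi>) / (C - 1)\<close> is again
  a character, and \<psi> is the convex combination of \<phi> and \<rho> with weights
  \<open>1 / C\<close> and \<open>1 - 1 / C\<close>; extremality then forces both to be
  \<psi>.\<close>

lemma extremal_character_dominates:
  assumes ext: "extremal_character G \<psi>" and \<phi>: "\<phi> \<in> characters G" and C: "C > 1"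
    and dom: "\<And>F c. finite F \<Longrightarrow> F \<subseteq> carrier G \<Longrightarrow>
       of_real C * pd_form G F c \<psi> - pd_form G F c \<phi> \<in> \<real>\<^sub>\<ge>\<^sub>0"
  shows "\<phi> = \<psi>"
proof -
  have \<psi>: "\<psi> \<in> characters G" using ext by (simp add: extremal_character_def)
  define \<rho> where "\<rho> = (\<lambda>x. of_real (C / (C - 1)) * \<psi> x + of_real (- 1 / (C - 1)) * \<phi> x)"
  have "\<rho> \<in> characters G"
  proof (rule charactersI)
    fix F :: "'a set" and c assume F: "finite F" "F \<subseteq> carrier G"
    have eq: "pd_form G F c \<rho>
        = of_real (1 / (C - 1)) * (of_real C * pd_form G F c \<psi> - pd_form G F c \<phi>)"
      unfolding \<rho>_def pd_form_lincomb by (simp add: algebra_simps divide_inverse)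
    have "complex_of_real (1 / (C - 1)) \<in> \<real>\<^sub>\<ge>\<^sub>0"
      using C by (subst nonneg_Reals_of_real_iff) simp
    then show "pd_form G F c \<rho> \<in> \<real>\<^sub>\<ge>\<^sub>0"
      unfolding eq by (rule nonneg_Reals_mult_I[OF _ dom[OF F]])
  next
    have "C / (C - 1) + - 1 / (C - 1) = 1"
      using C unfolding add_divide_distrib[symmetric] by simp
    then show "\<rho> \<one>\<^bsub>G\<^esub> = 1"
      using charactersD(3)[OF \<phi>] charactersD(3)[OF \<psi>] unfolding \<rho>_def
      by (metis mult.right_neutral of_real_1 of_real_add)
  qed (use charactersD[OF \<phi>] charactersD[OF \<psi>] in \<open>auto simp: \<rho>_def\<close>)
  moreover have "\<psi> = convex_comb (1 / C) \<phi> \<rho>"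
  proof
    fix x
    have q: "1 - 1 / C = (C - 1) / C" using C by (simp add: diff_divide_distrib)
    have coeff: "(1 - 1 / C) * (C / (C - 1)) = 1" "1 / C + (1 - 1 / C) * (- 1 / (C - 1)) = 0"
      unfolding q using C by simp_all
    have expand: "of_real p * u + of_real r * (of_real a * v + of_real b * u)
        = of_real (r * a) * v + of_real (p + r * b) * u" for p r a b :: real and u v :: complex
      by (simp add: algebra_simps)
    show "\<psi> x = convex_comb (1 / C) \<phi> \<rho> x"
      unfolding convex_comb_def \<rho>_def expand coeff by simp
  qed
  moreover have "0 < 1 / C" "1 / C < 1" using C by auto
  ultimately show ?thesis using ext \<phi> unfolding extremal_character_def by blast
qed

section \<open>Vector states of finite-dimensional representations\<close>

lemma reps_of_dimD:
  assumes "\<pi> \<in> reps_of_dim G n" "g \<in> carrier G"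
  shows "\<And>v w. v \<in> euclidean_Cn n \<Longrightarrow> w \<in> euclidean_Cn n \<Longrightarrow> \<pi> g (\<lambda>i. v i + w i) = (\<lambda>i. \<pi> g v i + \<pi> g w i)"
    "\<And>c v. v \<in> euclidean_Cn n \<Longrightarrow> \<pi> g (\<lambda>i. c * v i) = (\<lambda>i. c * \<pi> g v i)"
    "\<And>v. v \<in> euclidean_Cn n \<Longrightarrow> \<pi> g v \<in> euclidean_Cn n"
    "\<And>v w. v \<in> euclidean_Cn n \<Longrightarrow> w \<in> euclidean_Cn n \<Longrightarrow> ell2_inner (\<pi> g v) (\<pi> g w) = ell2_inner v w"
    "\<And>h v. h \<in> carrier G \<Longrightarrow> v \<in> euclidean_Cn n \<Longrightarrow> \<pi> (g \<otimes>\<^bsub>G\<^esub> h) v = \<pi> g (\<pi> h v)"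
  using assms unfolding reps_of_dim_def unitary_rep_def unitary_map_def linear_map_on_def by blast+

lemma reps_of_dim_lincomb:
  assumes "\<pi> \<in> reps_of_dim G n" "g \<in> carrier G" "\<And>h. h \<in> F \<Longrightarrow> e h \<in> euclidean_Cn n"
  shows "\<pi> g (\<lambda>i. \<Sum>h\<in>F. d h * e h i) = (\<lambda>i. \<Sum>h\<in>F. d h * \<pi> g (e h) i)"
proof -
  note lin = reps_of_dimD[OF assms(1,2)]
  have zero: "(\<lambda>i. 0) \<in> euclidean_Cn n" by (simp add: euclidean_Cn_def)
  have "\<pi> g (\<lambda>i. 0) = (\<lambda>i. 0)" using lin(2)[OF zero, of 0] by simp
  then show ?thesis
    using assms(3)
  proof (induction F rule: infinite_finite_induct)
    case (insert x F)
    have "(\<lambda>i. \<Sum>h\<in>F. d h * e h i) \<in> euclidean_Cn n" "(\<lambda>i. d x * e x i) \<in> euclidean_Cn n"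
      using insert.prems by (auto simp: euclidean_Cn_def)
    then have "\<pi> g (\<lambda>i. d x * e x i + (\<Sum>h\<in>F. d h * e h i))
        = (\<lambda>i. d x * \<pi> g (e x) i + (\<Sum>h\<in>F. d h * \<pi> g (e h) i))"
      using lin(1) lin(2)[of "e x" "d x"] insert by simp
    then show ?case using insert.hyps by simp
  qed auto
qed

text \<open>The values of \<phi> are the entries of a Gram matrix, which turns the form into a sum
  of squares.\<close>

lemma pd_form_gram:
  assumes "\<And>x y. x \<in> F \<Longrightarrow> y \<in> F \<Longrightarrow> \<phi> (inv\<^bsub>G\<^esub> y \<otimes>\<^bsub>G\<^esub> x) = (\<Sum>i<n. v x i * cnj (v y i))"
  shows "pd_form G F c \<phi> = of_real (\<Sum>i<n. (cmod (\<Sum>x\<in>F. c x * v x i))\<^sup>2)"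
proof -
  have "pd_form G F c \<phi> = (\<Sum>x\<in>F. \<Sum>y\<in>F. \<Sum>i<n. (c x * v x i) * cnj (c y * v y i))"
    unfolding pd_form_def using assms by (intro sum.cong refl) (simp add: sum_distrib_left mult_ac)
  also have "\<dots> = (\<Sum>x\<in>F. \<Sum>i<n. \<Sum>y\<in>F. (c x * v x i) * cnj (c y * v y i))"
    by (intro sum.cong refl sum.swap)
  also have "\<dots> = (\<Sum>i<n. \<Sum>x\<in>F. \<Sum>y\<in>F. (c x * v x i) * cnj (c y * v y i))"
    by (rule sum.swap)
  also have "\<dots> = (\<Sum>i<n. (\<Sum>x\<in>F. c x * v x i) * cnj (\<Sum>x\<in>F. c x * v x i))"
    by (simp only: sum_product cnj_sum)
  also have "\<dots> = of_real (\<Sum>i<n. (cmod (\<Sum>x\<in>F. c x * v x i))\<^sup>2)"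
    by (simp only: of_real_sum complex_norm_square)
  finally show ?thesis .
qed

lemma (in group) rep_matrix_coefficient:
  assumes \<pi>: "\<pi> \<in> reps_of_dim G n" and \<xi>: "\<xi> \<in> euclidean_Cn n" and xy: "x \<in> carrier G" "y \<in> carrier G"
  shows "ell2_inner (\<pi> (inv y \<otimes> x) \<xi>) \<xi> = (\<Sum>i<n. \<pi> x \<xi> i * cnj (\<pi> y \<xi> i))"
proof -
  have c: "inv y \<otimes> x \<in> carrier G" using xy by simp
  have "\<pi> x \<xi> = \<pi> (y \<otimes> (inv y \<otimes> x)) \<xi>" using xy by (simp add: m_assoc[symmetric])
  also have "\<dots> = \<pi> y (\<pi> (inv y \<otimes> x) \<xi>)" by (rule reps_of_dimD(5)[OF \<pi> xy(2) c \<xi>])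
  finally have "ell2_inner (\<pi> x \<xi>) (\<pi> y \<xi>) = ell2_inner (\<pi> (inv y \<otimes> x) \<xi>) \<xi>"
    using reps_of_dimD(4)[OF \<pi> xy(2) reps_of_dimD(3)[OF \<pi> c \<xi>] \<xi>] by simp
  then show ?thesis using euclidean_inner[OF reps_of_dimD(3)[OF \<pi> xy(1) \<xi>]] by simp
qed

text \<open>The translated argument is the conjugate of \<open>inv y \<otimes> x\<close> by
  \<open>inv h\<close>. Through this identity all vectors \<open>\<pi> h \<xi>\<close> define the
  same state as \<xi>.\<close>

lemma (in group) pd_form_conj_translate:
  assumes \<phi>: "\<phi> \<in> characters G" and h: "h \<in> carrier G" and xy: "x \<in> carrier G" "y \<in> carrier G"
  shows "\<phi> (inv (y \<otimes> h) \<otimes> (x \<otimes> h)) = \<phi> (inv y \<otimes> x)"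
proof -
  have "inv (y \<otimes> h) \<otimes> (x \<otimes> h) = inv h \<otimes> (inv y \<otimes> x) \<otimes> inv (inv h)"
    using h xy by (simp add: inv_mult_group m_assoc)
  then show ?thesis using charactersD(4)[OF \<phi>, of "inv h" "inv y \<otimes> x"] h xy by simp
qed

lemma cmod_sum_squared_le:
  assumes "finite F"
  shows "(cmod (\<Sum>h\<in>F. d h * z h))\<^sup>2 \<le> (\<Sum>h\<in>F. (cmod (d h))\<^sup>2) * (\<Sum>h\<in>F. (cmod (z h))\<^sup>2)"
proof -
  have "cmod (\<Sum>h\<in>F. d h * z h) \<le> (\<Sum>h\<in>F. cmod (d h) * cmod (z h))"
    by (rule order_trans[OF norm_sum]) (simp add: norm_mult)
  then have "(cmod (\<Sum>h\<in>F. d h * z h))\<^sup>2 \<le> (\<Sum>h\<in>F. cmod (d h) * cmod (z h))\<^sup>2"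
    by (intro power_mono) auto
  also have "\<dots> \<le> (\<Sum>h\<in>F. (cmod (d h))\<^sup>2) * (\<Sum>h\<in>F. (cmod (z h))\<^sup>2)"
    by (rule Cauchy_Schwarz_ineq_sum)
  finally show ?thesis .
qed

text \<open>If \<open>\<zeta> = \<Sum> d h * \<pi> h \<xi>\<close>, then by Cauchy--Schwarz the vector state of \<open>\<zeta>\<close> is dominated by a multiple
  of the sum of the vector states of the \<open>\<pi> h \<xi>\<close>, and by conjugation invariance all of these are
  equal to \<open>\<psi>\<close>.\<close>

lemma (in group) vector_state_dominated:
  assumes \<psi>: "coordinate_gns G \<psi> n \<pi> \<xi>" "\<psi> \<in> characters G" and \<zeta>: "\<zeta> \<in> euclidean_Cn n"
    and \<phi>: "\<And>g. g \<in> carrier G \<Longrightarrow> \<phi> g = ell2_inner (\<pi> g \<zeta>) \<zeta>"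
  shows "\<exists>C>1. \<forall>F c. finite F \<longrightarrow> F \<subseteq> carrier G \<longrightarrow>
    of_real C * pd_form G F c \<psi> - pd_form G F c \<phi> \<in> \<real>\<^sub>\<ge>\<^sub>0"
proof -
  have \<pi>: "\<pi> \<in> reps_of_dim G n" and \<xi>: "\<xi> \<in> euclidean_Cn n"
    and \<psi>_eq: "\<And>g. g \<in> carrier G \<Longrightarrow> \<psi> g = ell2_inner (\<pi> g \<xi>) \<xi>"
    using \<psi>(1) unfolding coordinate_gns_def by blast+
  obtain H d where H: "finite H" "H \<subseteq> carrier G" "\<zeta> = (\<lambda>i. \<Sum>h\<in>H. d h * \<pi> h \<xi> i)"
    using \<psi>(1) \<zeta> unfolding coordinate_gns_def by blast
  define D where "D = (\<Sum>h\<in>H. (cmod (d h))\<^sup>2)"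
  \<comment> \<open>\<open>D\<close> is the Cauchy-Schwarz factor and \<open>card H\<close> the
    number of equal states that are added up; the summand 2 ensures \<open>C > 1\<close>.\<close>
  define C where "C = D * real (card H) + 2"
  have D0: "D \<ge> 0" unfolding D_def by (intro sum_nonneg) auto
  have "of_real C * pd_form G F c \<psi> - pd_form G F c \<phi> \<in> \<real>\<^sub>\<ge>\<^sub>0"
    if F: "finite F" "F \<subseteq> carrier G" for F c
  proof -
    have mem: "x \<in> carrier G" if "x \<in> F" for x using F(2) that by blast
    have memH: "h \<in> carrier G" if "h \<in> H" for h using H(2) that by blast
    define p where "p = (\<Sum>i<n. (cmod (\<Sum>x\<in>F. c x * \<pi> x \<zeta> i))\<^sup>2)"
    \<comment> \<open>For every \<open>h\<close> in \<open>H\<close> this is the same number, the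
      form of \<psi>, but written with the orbit vector \<open>\<pi> h \<xi>\<close> so that it can
      be compared with \<open>p\<close>.\<close>
    define q where "q h = (\<Sum>i<n. (cmod (\<Sum>x\<in>F. c x * \<pi> (x \<otimes> h) \<xi> i))\<^sup>2)" for h
    have p: "pd_form G F c \<phi> = of_real p"
      unfolding p_def using mem rep_matrix_coefficient[OF \<pi> \<zeta>] \<phi> by (intro pd_form_gram) simp
    have q: "pd_form G F c \<psi> = of_real (q h)" if h: "h \<in> H" for h
      unfolding q_def
    proof (rule pd_form_gram)
      fix x y assume "x \<in> F" "y \<in> F"
      then have xy: "x \<in> carrier G" "y \<in> carrier G" using mem by auto
      have "\<psi> (inv y \<otimes> x) = \<psi> (inv (y \<otimes> h) \<otimes> (x \<otimes> h))"
        using pd_form_conj_translate[OF \<psi>(2) memH[OF h] xy] by simp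
      also have "\<dots> = (\<Sum>i<n. \<pi> (x \<otimes> h) \<xi> i * cnj (\<pi> (y \<otimes> h) \<xi> i))"
        using \<psi>_eq rep_matrix_coefficient[OF \<pi> \<xi>] xy memH[OF h] by simp
      finally show "\<psi> (inv y \<otimes> x) = (\<Sum>i<n. \<pi> (x \<otimes> h) \<xi> i * cnj (\<pi> (y \<otimes> h) \<xi> i))" .
    qed
    have "\<pi> x \<zeta> i = (\<Sum>h\<in>H. d h * \<pi> (x \<otimes> h) \<xi> i)" if "x \<in> F" for x i
    proof -
      have "\<pi> x \<zeta> = (\<lambda>i. \<Sum>h\<in>H. d h * \<pi> x (\<pi> h \<xi>) i)"
        unfolding H(3) using memH reps_of_dimD(3)[OF \<pi> _ \<xi>]
        by (intro reps_of_dim_lincomb[OF \<pi> mem[OF that]]) blast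
      then show ?thesis using reps_of_dimD(5)[OF \<pi> mem[OF that] memH \<xi>] by simp
    qed
    then have "(\<Sum>x\<in>F. c x * \<pi> x \<zeta> i) = (\<Sum>x\<in>F. \<Sum>h\<in>H. d h * (c x * \<pi> (x \<otimes> h) \<xi> i))" for i
      by (simp add: sum_distrib_left mult.left_commute)
    also have "\<dots> i = (\<Sum>h\<in>H. d h * (\<Sum>x\<in>F. c x * \<pi> (x \<otimes> h) \<xi> i))" for i
      by (subst sum.swap) (simp add: sum_distrib_left)
    finally have "p = (\<Sum>i<n. (cmod (\<Sum>h\<in>H. d h * (\<Sum>x\<in>F. c x * \<pi> (x \<otimes> h) \<xi> i)))\<^sup>2)"
      unfolding p_def by simp
    also have "\<dots> \<le> (\<Sum>i<n. D * (\<Sum>h\<in>H. (cmod (\<Sum>x\<in>F. c x * \<pi> (x \<otimes> h) \<xi> i))\<^sup>2))"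
      unfolding D_def by (intro sum_mono cmod_sum_squared_le H(1))
    also have "\<dots> = D * (\<Sum>h\<in>H. q h)"
      unfolding q_def sum_distrib_left[symmetric] by (subst sum.swap) simp
    finally have pq: "p \<le> D * (\<Sum>h\<in>H. q h)" .
    have "pd_form G F c \<psi> \<in> \<real>\<^sub>\<ge>\<^sub>0" using charactersD(5)[OF \<psi>(2) F] .
    then obtain r where r: "r \<ge> 0" "pd_form G F c \<psi> = of_real r" by (rule nonneg_Reals_cases)
    have "q h = r" if "h \<in> H" for h using q[OF that] r(2) by simp
    then have "(\<Sum>h\<in>H. q h) = real (card H) * r" by simp
    then have "p \<le> C * r" using pq r(1) D0 unfolding C_def by (simp add: algebra_simps)
    then have "of_real (C * r - p) \<in> (\<real>\<^sub>\<ge>\<^sub>0 :: complex set)"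
      by (subst nonneg_Reals_of_real_iff) simp
    then show ?thesis unfolding p r(2) by simp
  qed
  moreover have "D * real (card H) \<ge> 0" using D0 by simp
  then have "C > 1" unfolding C_def by linarith
  ultimately show ?thesis by blast
qed

text \<open>The intertwiner carries \<eta> to a vector whose state in the representation of \<psi>
  is \<phi>. So a multiple of \<psi> dominates \<phi>, and an extremal character dominates no other
  character in this way.\<close>

lemma (in group) extremal_character_of_rep_iso:
  assumes \<phi>: "coordinate_gns G \<phi> n \<sigma> \<eta>" "\<phi> \<in> characters G"
    and \<psi>: "coordinate_gns G \<psi> n \<pi> \<xi>" "extremal_character G \<psi>" and iso: "(\<sigma>, \<pi>) \<in> rep_iso G n"
  shows "\<phi> = \<psi>"
proof -
  have \<sigma>: "\<sigma> \<in> reps_of_dim G n" "\<eta> \<in> euclidean_Cn n"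
      "\<And>g. g \<in> carrier G \<Longrightarrow> \<phi> g = ell2_inner (\<sigma> g \<eta>) \<eta>"
    using \<phi>(1) unfolding coordinate_gns_def by blast+
  obtain U where U: "unitary_map (euclidean_Cn n) (euclidean_Cn n) U"
      "\<And>g v. g \<in> carrier G \<Longrightarrow> v \<in> euclidean_Cn n \<Longrightarrow> U (\<sigma> g v) = \<pi> g (U v)"
    using iso unfolding rep_iso_def by blast
  have "U \<eta> \<in> euclidean_Cn n" using U(1) \<sigma>(2) unfolding unitary_map_def by blast
  moreover have "\<phi> g = ell2_inner (\<pi> g (U \<eta>)) (U \<eta>)" if g: "g \<in> carrier G" for g
  proof -
    have "ell2_inner (U (\<sigma> g \<eta>)) (U \<eta>) = ell2_inner (\<sigma> g \<eta>) \<eta>"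
      using U(1) reps_of_dimD(3)[OF \<sigma>(1) g \<sigma>(2)] \<sigma>(2) unfolding unitary_map_def by blast
    then show ?thesis using \<sigma>(3)[OF g] U(2)[OF g \<sigma>(2)] by simp
  qed
  moreover have "\<psi> \<in> characters G" using \<psi>(2) by (simp add: extremal_character_def)
  ultimately obtain C where "C > 1" "\<And>F c. finite F \<Longrightarrow> F \<subseteq> carrier G \<Longrightarrow>
      of_real C * pd_form G F c \<psi> - pd_form G F c \<phi> \<in> \<real>\<^sub>\<ge>\<^sub>0"
    using vector_state_dominated[OF \<psi>(1)] by blast
  then show ?thesis by (intro extremal_character_dominates[OF \<psi>(2) \<phi>(2)])
qed

lemma (in group) countable_extremal_finite_characters:
  assumes fin: "\<And>n. finite (reps_of_dim G n // rep_iso G n)"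
  shows "countable {\<phi>. extremal_character G \<phi> \<and> finite_character G \<phi>}" (is "countable ?E")
proof -
  have "\<exists>n \<pi>. \<exists>\<xi>. coordinate_gns G \<phi> n \<pi> \<xi>" if "\<phi> \<in> ?E" for \<phi>
    using finite_character_coordinates that by blast
  then obtain N P where NP: "\<And>\<phi>. \<phi> \<in> ?E \<Longrightarrow> \<exists>\<xi>. coordinate_gns G \<phi> (N \<phi>) (P \<phi>) \<xi>" by metis
  let ?c = "\<lambda>\<phi>. (N \<phi>, rep_iso G (N \<phi>) `` {P \<phi>})"
  have rep: "P \<phi> \<in> reps_of_dim G (N \<phi>)" if "\<phi> \<in> ?E" for \<phi>
    using NP[OF that] unfolding coordinate_gns_def by blast
  have "?c ` ?E \<subseteq> (SIGMA n:UNIV. reps_of_dim G n // rep_iso G n)"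
    using rep by (auto intro: quotientI)
  moreover have "countable (SIGMA n:UNIV. reps_of_dim G n // rep_iso G n)"
    using fin by (intro countable_SIGMA) (auto intro: countable_finite)
  ultimately have "countable (?c ` ?E)" by (rule countable_subset)
  moreover have "inj_on ?c ?E"
  proof (rule inj_onI)
    fix \<phi> \<psi> assume E: "\<phi> \<in> ?E" "\<psi> \<in> ?E" and eq: "?c \<phi> = ?c \<psi>"
    have N: "N \<phi> = N \<psi>" using eq by simp
    \<comment> \<open>Reflexivity at \<open>P \<psi>\<close> puts \<open>P \<psi>\<close> into its
      own class, hence into that of \<open>P \<phi>\<close>.\<close>
    have "unitary_map (euclidean_Cn (N \<psi>)) (euclidean_Cn (N \<psi>)) (\<lambda>v. v)"
      by (simp add: unitary_map_def linear_map_on_def)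
    then have "(P \<psi>, P \<psi>) \<in> rep_iso G (N \<psi>)" using rep[OF E(2)] unfolding rep_iso_def by blast
    then have "(P \<phi>, P \<psi>) \<in> rep_iso G (N \<psi>)" using eq N by auto
    moreover obtain \<xi> \<eta> where "coordinate_gns G \<phi> (N \<psi>) (P \<phi>) \<eta>" "coordinate_gns G \<psi> (N \<psi>) (P \<psi>) \<xi>"
      using NP[OF E(1)] NP[OF E(2)] N by auto
    moreover have "\<phi> \<in> characters G" "extremal_character G \<psi>"
      using E by (auto simp: extremal_character_def)
    ultimately show "\<phi> = \<psi>" using extremal_character_of_rep_iso by blast
  qed
  ultimately show ?thesis by (rule countable_image_inj_on)
qed

section \<open>The compact convex set of characters\<close>

text \<open>The strictly convex function for the Choquet argument; the supremum norm of the space is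
  not strictly convex. The weights make the series converge uniformly on the unit ball, whence
  continuity.\<close>

definition weighted_square_sum :: "(nat \<Rightarrow>\<^sub>C complex) \<Rightarrow> real" where
  "weighted_square_sum u = (\<Sum>i. (1/2) ^ i * (cmod (apply_bcontfun u i))\<^sup>2)"

lemma weighted_square_summable:
  fixes u :: "nat \<Rightarrow>\<^sub>C complex"
  shows "summable (\<lambda>i. (1/2) ^ i * (cmod (apply_bcontfun u i))\<^sup>2)"
proof (rule summable_comparison_test')
  show "summable (\<lambda>i. (1/2) ^ i * (norm u)\<^sup>2)"
    by (intro summable_mult2 summable_geometric) simp
  show "norm ((1/2) ^ i * (cmod (apply_bcontfun u i))\<^sup>2) \<le> (1/2) ^ i * (norm u)\<^sup>2" for i
    using norm_bounded[of u i] by (simp add: mult_left_mono power_mono)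
qed

lemma continuous_on_apply_bcontfun_left:
  "continuous_on A (\<lambda>u :: nat \<Rightarrow>\<^sub>C complex. apply_bcontfun u i)"
proof -
  have "1-lipschitz_on A (\<lambda>u :: nat \<Rightarrow>\<^sub>C complex. apply_bcontfun u i)"
    by (intro lipschitz_onI) (simp_all add: dist_bounded)
  then show ?thesis by (rule lipschitz_on_continuous_on)
qed

lemma continuous_on_weighted_square_sum:
  "continuous_on (cball 0 1) weighted_square_sum"
proof -
  have "uniform_limit (cball 0 1)
     (\<lambda>n (u :: nat \<Rightarrow>\<^sub>C complex). \<Sum>i<n. (1/2) ^ i * (cmod (apply_bcontfun u i))\<^sup>2)
     (\<lambda>u. \<Sum>i. (1/2) ^ i * (cmod (apply_bcontfun u i))\<^sup>2) sequentially"
  proof (rule Weierstrass_m_test)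
    show "summable (\<lambda>i. (1/2 :: real) ^ i)" by (intro summable_geometric) simp
    fix i and u :: "nat \<Rightarrow>\<^sub>C complex" assume "u \<in> cball 0 1"
    then have "cmod (apply_bcontfun u i) \<le> 1" using norm_bounded[of u i] by simp
    then have "(cmod (apply_bcontfun u i))\<^sup>2 \<le> 1" by (simp add: power_le_one)
    then show "norm ((1/2) ^ i * (cmod (apply_bcontfun u i))\<^sup>2) \<le> (1/2) ^ i"
      by (simp add: mult_left_le)
  qed
  then have "continuous_on (cball 0 1) (\<lambda>u :: nat \<Rightarrow>\<^sub>C complex. \<Sum>i. (1/2) ^ i * (cmod (apply_bcontfun u i))\<^sup>2)"
    by (rule uniform_limit_theorem[rotated])
       (auto intro!: always_eventually continuous_intros continuous_on_apply_bcontfun_left)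
  then show ?thesis by (simp add: weighted_square_sum_def[abs_def])
qed

text \<open>By the parallelogram identity the convexity gap at the midpoint is a quarter of the
  value at \<open>a - b\<close>, which is positive because some coordinate differs.\<close>

lemma weighted_square_sum_strictly_convex:
  assumes "a \<noteq> b"
  shows "weighted_square_sum (midpoint a b) < (weighted_square_sum a + weighted_square_sum b) / 2"
proof -
  have par: "(cmod ((x + y) / 2))\<^sup>2 = ((cmod x)\<^sup>2 + (cmod y)\<^sup>2) / 2 - (cmod (x - y))\<^sup>2 / 4" for x y
    by (simp add: norm_divide power_divide cmod_power2) (simp add: power2_eq_square field_simps)
  define s where "s u i = (1/2) ^ i * (cmod (apply_bcontfun u i))\<^sup>2" for u :: "nat \<Rightarrow>\<^sub>C complex" and i
  have sm: "summable (s u)" for u unfolding s_def by (rule weighted_square_summable)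
  have "s (midpoint a b) i = (s a i + s b i) / 2 - s (a - b) i / 4" for i
  proof -
    have "apply_bcontfun (midpoint a b) i = (apply_bcontfun a i + apply_bcontfun b i) / 2"
      by (simp add: midpoint_def scaleR_conv_of_real)
    then show ?thesis unfolding s_def by (simp only: par minus_bcontfun.rep_eq) (simp add: algebra_simps)
  qed
  then have "s (midpoint a b) = (\<lambda>i. (s a i + s b i) / 2 - s (a - b) i / 4)" by (rule ext)
  then have "suminf (s (midpoint a b)) = (\<Sum>i. (s a i + s b i) / 2 - s (a - b) i / 4)"
    by (rule arg_cong)
  also have "\<dots> = (suminf (s a) + suminf (s b)) / 2 - suminf (s (a - b)) / 4"
    by (intro sums_unique[symmetric] sums_diff sums_divide sums_add summable_sums sm)
  finally have eq: "suminf (s (midpoint a b)) = (suminf (s a) + suminf (s b)) / 2 - suminf (s (a - b)) / 4" .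
  have "suminf (s (a - b)) > 0"
  proof -
    obtain i where "apply_bcontfun a i \<noteq> apply_bcontfun b i" using assms bcontfun_eqI by blast
    then have "s (a - b) i > 0" unfolding s_def by simp
    moreover have "s (a - b) j \<ge> 0" for j unfolding s_def by simp
    ultimately show ?thesis using suminf_pos2[OF sm, of "a - b" i] by blast
  qed
  then have "suminf (s (midpoint a b)) < (suminf (s a) + suminf (s b)) / 2"
    unfolding eq by linarith
  then show ?thesis unfolding weighted_square_sum_def s_def .
qed

section \<open>Elementary properties of characters\<close>

context group
begin

text \<open>Positivity on the two points \<open>\<one>\<close> and \<open>x\<close>: the
  coefficients (1, 1) and (1, i) compare the imaginary and real parts of the values at
  \<open>x\<close> and \<open>inv x\<close>, and (\<open>\<phi> x\<close>, -1) bounds the modulus.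
  If \<open>x = \<one>\<close>, the two points coincide.\<close>

lemma character_hermitian:
  assumes \<phi>: "\<phi> \<in> characters G" and x: "x \<in> carrier G"
  shows "\<phi> (inv x) = cnj (\<phi> x)" and "cmod (\<phi> x) \<le> 1"
proof -
  have two: "(cmod a)\<^sup>2 + (cmod b)\<^sup>2 + (a * cnj b * \<phi> (inv x) + b * cnj a * \<phi> x) \<in> \<real>\<^sub>\<ge>\<^sub>0"
    if ne: "x \<noteq> \<one>" for a b
  proof -
    have "pd_form G {\<one>, x} (\<lambda>y. if y = x then b else a) \<phi> \<in> \<real>\<^sub>\<ge>\<^sub>0"
      using x by (intro charactersD(5)[OF \<phi>]) auto
    moreover have "pd_form G {\<one>, x} (\<lambda>y. if y = x then b else a) \<phi>
       = (cmod a)\<^sup>2 + (cmod b)\<^sup>2 + (a * cnj b * \<phi> (inv x) + b * cnj a * \<phi> x)"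
      using ne ne[symmetric] x charactersD(3)[OF \<phi>]
      by (simp add: pd_form_def complex_norm_square del: of_real_power)
    ultimately show ?thesis by simp
  qed
  have "\<phi> (inv x) = cnj (\<phi> x) \<and> cmod (\<phi> x) \<le> 1"
  proof (cases "x = \<one>")
    case True
    then show ?thesis using charactersD(3)[OF \<phi>] by simp
  next
    case False
    have "Im (\<phi> (inv x)) = - Im (\<phi> x)"
      using two[OF False, of 1 1] by (simp add: complex_nonneg_Reals_iff)
    moreover have "Re (\<phi> (inv x)) = Re (\<phi> x)"
      using two[OF False, of 1 \<i>] by (simp add: complex_nonneg_Reals_iff)
    ultimately have h: "\<phi> (inv x) = cnj (\<phi> x)" by (simp add: complex_eq_iff)
    have eq: "(cmod (\<phi> x))\<^sup>2 + (cmod (-1))\<^sup>2 + (\<phi> x * cnj (-1) * \<phi> (inv x) + (-1) * cnj (\<phi> x) * \<phi> x)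
        = of_real (1 - (cmod (\<phi> x))\<^sup>2)"
      unfolding h by (simp add: complex_norm_square del: of_real_power)
    have "complex_of_real (1 - (cmod (\<phi> x))\<^sup>2) \<in> \<real>\<^sub>\<ge>\<^sub>0"
      using two[OF False, of "\<phi> x" "-1"] unfolding eq .
    then have "(cmod (\<phi> x))\<^sup>2 \<le> 1" by (subst (asm) nonneg_Reals_of_real_iff) simp
    then show ?thesis using h by (simp add: power_le_one_iff abs_square_le_1)
  qed
  then show "\<phi> (inv x) = cnj (\<phi> x)" "cmod (\<phi> x) \<le> 1" by auto
qed

lemma dirac_character: "dirac G \<in> characters G"
proof (rule charactersI)
  fix F :: "'a set" and c assume F: "finite F" "F \<subseteq> carrier G"
  have "inv y \<otimes> x = \<one> \<longleftrightarrow> x = y" if "x \<in> F" "y \<in> F" for x y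
    using that F(2) by (metis inv_solve_left' one_closed r_one subsetD)
  then have "pd_form G F c (dirac G) = (\<Sum>x\<in>F. \<Sum>y\<in>F. if x = y then c x * cnj (c x) else 0)"
    unfolding pd_form_def dirac_def by (intro sum.cong refl) auto
  also have "\<dots> = of_real (\<Sum>x\<in>F. (cmod (c x))\<^sup>2)"
    using F(1) by (simp add: complex_norm_square del: of_real_power)
  finally show "pd_form G F c (dirac G) \<in> \<real>\<^sub>\<ge>\<^sub>0"
    by (simp only: nonneg_Reals_of_real_iff) (intro sum_nonneg, auto)
next
  fix g x assume "g \<in> carrier G" "x \<in> carrier G"
  then have "g \<otimes> x \<otimes> inv g = \<one> \<longleftrightarrow> x = \<one>"
    by (metis inv_closed inv_inv inv_solve_right' l_cancel_one' l_one m_closed r_cancel_one' r_one r_inv)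
  then show "dirac G (g \<otimes> x \<otimes> inv g) = dirac G x" by (simp add: dirac_def)
qed (auto simp: dirac_def)

text \<open>Each defining condition involves finitely many values of the function and is closed in
  them.\<close>

lemma character_limit:
  assumes \<phi>: "\<And>k. \<phi> k \<in> characters G" and lim: "\<And>x. x \<in> carrier G \<Longrightarrow> (\<lambda>k. \<phi> k x) \<longlonglongrightarrow> \<psi> x"
    and out: "\<And>x. x \<notin> carrier G \<Longrightarrow> \<psi> x = 0"
  shows "\<psi> \<in> characters G"
proof (rule charactersI)
  show "\<psi> \<one> = 1"
    using lim[OF one_closed] unfolding charactersD(3)[OF \<phi>] by (simp add: LIMSEQ_const_iff)
  fix g x assume gx: "g \<in> carrier G" "x \<in> carrier G"
  have "(\<lambda>k. \<phi> k (g \<otimes> x \<otimes> inv g)) \<longlonglongrightarrow> \<psi> (g \<otimes> x \<otimes> inv g)" using gx by (intro lim) simp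
  then have "(\<lambda>k. \<phi> k x) \<longlonglongrightarrow> \<psi> (g \<otimes> x \<otimes> inv g)" using charactersD(4)[OF \<phi> gx] by simp
  then show "\<psi> (g \<otimes> x \<otimes> inv g) = \<psi> x" using lim[OF gx(2)] LIMSEQ_unique by blast
next
  fix F :: "'a set" and c assume F: "finite F" "F \<subseteq> carrier G"
  have "(\<lambda>k. pd_form G F c (\<phi> k)) \<longlonglongrightarrow> pd_form G F c \<psi>"
    unfolding pd_form_def using F(2) by (intro tendsto_sum tendsto_mult tendsto_const lim) auto
  then show "pd_form G F c \<psi> \<in> \<real>\<^sub>\<ge>\<^sub>0"
    using charactersD(5)[OF \<phi> F] by (intro Lim_in_closed_set[OF closed_nonneg_Reals_complex]) auto
qed (rule out)

end

text \<open>The weights \<open>2\<^sup>-\<^sup>i\<close> turn pointwise convergence of characters into norm convergence.\<close>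

definition weighted_values :: "(nat \<Rightarrow> 'a) \<Rightarrow> ('a \<Rightarrow> complex) \<Rightarrow> (nat \<Rightarrow>\<^sub>C complex)" where
  "weighted_values e \<phi> = Bcontfun (\<lambda>i. (1/2) ^ i * \<phi> (e i))"

lemma apply_weighted_values:
  assumes "\<And>i. cmod (\<phi> (e i)) \<le> 1"
  shows "apply_bcontfun (weighted_values e \<phi>) i = (1/2) ^ i * \<phi> (e i)"
proof -
  have "cmod ((1/2) ^ i * \<phi> (e i)) \<le> 1" for i
    using assms[of i] by (simp add: norm_mult norm_power norm_divide mult_le_one power_le_one)
  then have "(\<lambda>i. (1/2) ^ i * \<phi> (e i)) \<in> bcontfun"
    by (auto simp: bcontfun_def bounded_iff)
  then show ?thesis unfolding weighted_values_def by (simp add: Bcontfun_inverse)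
qed

lemma weighted_values_tendsto:
  assumes b: "\<And>k i. cmod (\<phi> k (e i)) \<le> 1" "\<And>i. cmod (\<psi> (e i)) \<le> 1"
    and lim: "\<And>i. (\<lambda>k. \<phi> k (e i)) \<longlonglongrightarrow> \<psi> (e i)"
  shows "(\<lambda>k. weighted_values e (\<phi> k)) \<longlonglongrightarrow> weighted_values e \<psi>"
proof (rule tendstoI)
  fix \<epsilon> :: real assume \<epsilon>: "\<epsilon> > 0"
  \<comment> \<open>From \<open>N\<close> on the weights are below \<open>\<epsilon> / 4\<close>,
    while two values of modulus at most 1 differ by at most 2; so the tail stays below
    \<open>\<epsilon> / 2\<close>.\<close>
  obtain N where N: "(1/2 :: real) ^ N < \<epsilon> / 4" using real_arch_pow_inv[of "\<epsilon> / 4" "1/2"] \<epsilon> by auto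
  have "\<forall>\<^sub>F k in sequentially. \<forall>i\<in>{..<N}. dist (\<phi> k (e i)) (\<psi> (e i)) < \<epsilon> / 2"
    using tendstoD[OF lim, of "\<epsilon> / 2"] \<epsilon> by (intro eventually_ball_finite) auto
  then show "\<forall>\<^sub>F k in sequentially. dist (weighted_values e (\<phi> k)) (weighted_values e \<psi>) < \<epsilon>"
  proof eventually_elim
    case (elim k)
    have "dist (apply_bcontfun (weighted_values e (\<phi> k)) i) (apply_bcontfun (weighted_values e \<psi>) i) \<le> \<epsilon> / 2"
      for i
    proof -
      have eq: "dist (apply_bcontfun (weighted_values e (\<phi> k)) i) (apply_bcontfun (weighted_values e \<psi>) i)
          = (1/2) ^ i * dist (\<phi> k (e i)) (\<psi> (e i))"
        unfolding apply_weighted_values[of "\<phi> k" e, OF b(1)] apply_weighted_values[of \<psi> e, OF b(2)]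
        by (simp add: dist_norm norm_mult norm_power norm_divide flip: right_diff_distrib)
      show ?thesis
      proof (cases "i < N")
        case True
        have "(1/2) ^ i * dist (\<phi> k (e i)) (\<psi> (e i)) \<le> 1 * dist (\<phi> k (e i)) (\<psi> (e i))"
          by (intro mult_right_mono) (auto simp: power_le_one)
        then show ?thesis using elim True unfolding eq by force
      next
        case False
        have "dist (\<phi> k (e i)) (\<psi> (e i)) \<le> 2"
          using b(1)[of k i] b(2)[of i] norm_triangle_ineq4[of "\<phi> k (e i)" "\<psi> (e i)"]
          by (simp add: dist_norm)
        moreover have "(1/2 :: real) ^ i \<le> (1/2) ^ N" using False by (intro power_decreasing) auto
        ultimately have "(1/2) ^ i * dist (\<phi> k (e i)) (\<psi> (e i)) \<le> (1/2) ^ N * 2"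
          by (intro mult_mono) auto
        then show ?thesis using N unfolding eq by simp
      qed
    qed
    then have "dist (weighted_values e (\<phi> k)) (weighted_values e \<psi>) \<le> \<epsilon> / 2" by (rule dist_bound)
    then show ?case using \<epsilon> by simp
  qed
qed

text \<open>Along an enumeration of the group, characters become bounded sequences that form a
  norm-compact convex set. The encoding is injective and respects convex combinations, so extreme
  points of the image come from extremal characters and the decomposition found there pulls
  back.\<close>

lemma (in group) character_dominates_extremal:
  assumes cnt: "countable (carrier G)" and D: "countable D"
    and ext: "\<And>\<alpha>. extremal_character G \<alpha> \<Longrightarrow> \<alpha> = dirac G \<or> \<alpha> \<in> D" and DK: "D \<subseteq> characters G"
    and \<phi>: "\<phi> \<in> characters G" "\<phi> \<noteq> dirac G"
  shows "\<exists>\<alpha>\<in>D. \<exists>t \<psi>. 0 < t \<and> t \<le> 1 \<and> \<psi> \<in> characters G \<and> \<phi> = convex_comb t \<alpha> \<psi>"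
proof -
  \<comment> \<open>For a finite group this enumeration repeats elements; what matters is that its
    range is the whole carrier.\<close>
  define e where "e = from_nat_into (carrier G)"
  have ran: "range e = carrier G" unfolding e_def using cnt by (intro range_from_nat_into) auto
  have eG: "e i \<in> carrier G" for i using ran by blast
  define \<Phi> where "\<Phi> = weighted_values e"
  have ap: "apply_bcontfun (\<Phi> \<psi>) i = (1/2) ^ i * \<psi> (e i)" if "\<psi> \<in> characters G" for \<psi> i
    unfolding \<Phi>_def using character_hermitian(2)[OF that eG] by (rule apply_weighted_values)
  have inj: "\<psi> = \<rho>" if "\<psi> \<in> characters G" "\<rho> \<in> characters G" "\<Phi> \<psi> = \<Phi> \<rho>" for \<psi> \<rho>
  proof
    fix x
    show "\<psi> x = \<rho> x"
    proof (cases "x \<in> carrier G")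
      case True
      then obtain i where i: "x = e i" using ran by blast
      have "(1/2) ^ i * \<psi> (e i) = (1/2) ^ i * \<rho> (e i)"
        using ap[OF that(1), of i] ap[OF that(2), of i] that(3) by simp
      then show ?thesis unfolding i by simp
    next
      case False
      then show ?thesis using charactersD(1)[OF that(1)] charactersD(1)[OF that(2)] by simp
    qed
  qed
  have lin: "\<Phi> (convex_comb t \<psi> \<rho>) = t *\<^sub>R \<Phi> \<psi> + (1 - t) *\<^sub>R \<Phi> \<rho>"
    if "\<psi> \<in> characters G" "\<rho> \<in> characters G" "0 \<le> t" "t \<le> 1" for t \<psi> \<rho>
  proof (rule bcontfun_eqI)
    fix i
    show "apply_bcontfun (\<Phi> (convex_comb t \<psi> \<rho>)) i = apply_bcontfun (t *\<^sub>R \<Phi> \<psi> + (1 - t) *\<^sub>R \<Phi> \<rho>) i"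
      using ap[OF convex_comb_character[OF that]] ap[OF that(1)] ap[OF that(2)]
      by (simp add: convex_comb_def scaleR_conv_of_real algebra_simps)
  qed
  define K where "K = \<Phi> ` characters G"
  have "compact K"
    unfolding compact_eq_seq_compact_metric seq_compact_def
  proof (intro allI impI)
    fix u :: "nat \<Rightarrow> nat \<Rightarrow>\<^sub>C complex" assume "\<forall>n. u n \<in> K"
    then have "\<exists>\<psi>. \<psi> \<in> characters G \<and> u n = \<Phi> \<psi>" for n unfolding K_def by blast
    then obtain f where f: "\<And>n. f n \<in> characters G" "\<And>n. u n = \<Phi> (f n)" by metis
    obtain k where k: "strict_mono (k :: nat \<Rightarrow> nat)"
        "\<And>x. x \<in> carrier G \<Longrightarrow> \<exists>l. (\<lambda>n. f (k n) x) \<longlonglongrightarrow> l"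
      using function_convergent_subsequence[OF cnt, of f 1] character_hermitian(2)[OF f(1)] by blast
    \<comment> \<open>Characters vanish outside of the carrier, hence the default 0.\<close>
    define \<psi> where "\<psi> x = (if x \<in> carrier G then lim (\<lambda>n. f (k n) x) else 0)" for x
    have lim: "(\<lambda>n. f (k n) x) \<longlonglongrightarrow> \<psi> x" if "x \<in> carrier G" for x
      using k(2)[OF that] that by (simp add: \<psi>_def convergent_def[symmetric] convergent_LIMSEQ_iff)
    have \<psi>: "\<psi> \<in> characters G"
      by (rule character_limit[OF f(1) lim]) (simp_all add: \<psi>_def)
    have "(\<lambda>n. \<Phi> (f (k n))) \<longlonglongrightarrow> \<Phi> \<psi>"
      unfolding \<Phi>_def
      by (intro weighted_values_tendsto character_hermitian(2) f(1) \<psi> eG lim)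
    then have "(u \<circ> k) \<longlonglongrightarrow> \<Phi> \<psi>" by (simp add: o_def f(2))
    then show "\<exists>l\<in>K. \<exists>r. strict_mono r \<and> (u \<circ> r) \<longlonglongrightarrow> l" using k(1) \<psi> unfolding K_def by blast
  qed
  moreover have "convex K"
    unfolding convex_alt K_def
  proof (intro ballI allI impI, elim imageE, hypsubst)
    fix \<psi> \<rho> and u :: real assume *: "\<psi> \<in> characters G" "\<rho> \<in> characters G" "0 \<le> u \<and> u \<le> 1"
    have "(1 - u) *\<^sub>R \<Phi> \<psi> + u *\<^sub>R \<Phi> \<rho> = \<Phi> (convex_comb (1 - u) \<psi> \<rho>)"
      using lin[OF *(1,2), of "1 - u"] *(3) by simp
    moreover have "convex_comb (1 - u) \<psi> \<rho> \<in> characters G"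
      using * by (intro convex_comb_character) auto
    ultimately show "(1 - u) *\<^sub>R \<Phi> \<psi> + u *\<^sub>R \<Phi> \<rho> \<in> \<Phi> ` characters G" by (metis imageI)
  qed
  moreover have "K \<subseteq> cball 0 1"
  proof
    fix u assume "u \<in> K"
    then obtain \<psi> where \<psi>: "\<psi> \<in> characters G" "u = \<Phi> \<psi>" unfolding K_def by blast
    have "cmod (apply_bcontfun u i) \<le> 1" for i
      using character_hermitian(2)[OF \<psi>(1) eG[of i]] unfolding \<psi>(2) ap[OF \<psi>(1)]
      by (simp add: norm_mult norm_power norm_divide mult_le_one power_le_one)
    then show "u \<in> cball 0 1" by (simp add: norm_bound)
  qed
  then have "continuous_on K weighted_square_sum"
    using continuous_on_weighted_square_sum continuous_on_subset by blast
  moreover have "\<Phi> \<phi> \<in> K" using \<phi>(1) unfolding K_def by (rule imageI)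
  ultimately interpret K: strictly_convex_compact K weighted_square_sum "\<Phi> \<phi>"
    by (intro strictly_convex_compact.intro weighted_square_sum_strictly_convex)
  have "\<exists>d\<in>\<Phi> ` D. \<exists>t y. 0 < t \<and> t \<le> 1 \<and> y \<in> K \<and> \<Phi> \<phi> = t *\<^sub>R d + (1 - t) *\<^sub>R y"
  proof (rule K.dominates_extreme_point)
    show "countable (\<Phi> ` D)" using D by simp
    show "\<Phi> ` D \<subseteq> K" using DK unfolding K_def by blast
    show "\<Phi> (dirac G) \<in> K" using dirac_character unfolding K_def by blast
    show "\<Phi> \<phi> \<noteq> \<Phi> (dirac G)" using inj[OF \<phi>(1) dirac_character] \<phi>(2) by blast
    fix u assume u: "u extreme_point_of K"
    then obtain \<psi> where \<psi>: "\<psi> \<in> characters G" "u = \<Phi> \<psi>" unfolding K_def extreme_point_of_def by blast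
    have "extremal_character G \<psi>"
      unfolding extremal_character_def
    proof (intro conjI ballI allI impI; (elim conjE)?)
      show "\<psi> \<in> characters G" by (rule \<psi>(1))
      fix \<alpha> \<beta> and t :: real
      assume ab: "\<alpha> \<in> characters G" "\<beta> \<in> characters G" and t: "0 < t" "t < 1" "\<psi> = convex_comb t \<alpha> \<beta>"
      have "\<Phi> \<alpha> = \<Phi> \<beta>"
      proof (rule ccontr)
        assume "\<Phi> \<alpha> \<noteq> \<Phi> \<beta>"
        moreover have "u = (1 - (1 - t)) *\<^sub>R \<Phi> \<alpha> + (1 - t) *\<^sub>R \<Phi> \<beta>"
          using lin[OF ab, of t] t unfolding \<psi>(2) by simp
        ultimately have "u \<in> open_segment (\<Phi> \<alpha>) (\<Phi> \<beta>)"
          using t unfolding in_segment by (intro conjI exI[of _ "1 - t"]) auto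
        then show False using u ab unfolding extreme_point_of_def K_def by blast
      qed
      then have "\<alpha> = \<beta>" by (rule inj[OF ab])
      moreover have "convex_comb t \<beta> \<beta> = \<beta>"
        unfolding convex_comb_def by (simp add: algebra_simps)
      ultimately show "\<alpha> = \<psi>" "\<beta> = \<psi>" using t(3) by auto
    qed
    then show "u = \<Phi> (dirac G) \<or> u \<in> \<Phi> ` D" using ext \<psi>(2) by blast
  qed
  then obtain \<alpha> t \<psi> where *: "\<alpha> \<in> D" "0 < t" "t \<le> 1" "\<psi> \<in> characters G"
      "\<Phi> \<phi> = t *\<^sub>R \<Phi> \<alpha> + (1 - t) *\<^sub>R \<Phi> \<psi>" unfolding K_def by blast
  have \<alpha>: "\<alpha> \<in> characters G" using *(1) DK by blast
  have "\<phi> = convex_comb t \<alpha> \<psi>"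
    using *(2,3,5) lin[OF \<alpha> *(4), of t] convex_comb_character[OF \<alpha> *(4), of t]
    by (intro inj[OF \<phi>(1)]) auto
  then show ?thesis using * by blast
qed

section \<open>Recurrence in finite-dimensional representations\<close>

text \<open>Every generated element is the value of a finite word. Countability of the group is what
  permits the encoding of characters as sequences.\<close>

lemma (in group) countable_generate:
  assumes "countable S" "S \<subseteq> carrier G"
  shows "countable (generate G S)"
proof -
  let ?A = "S \<union> (\<lambda>s. inv s) ` S" and ?p = "\<lambda>ws. foldr (\<otimes>) ws \<one>"
  have A: "?A \<subseteq> carrier G" using assms(2) by auto
  have closed: "?p ws \<in> carrier G" if "set ws \<subseteq> carrier G" for ws
    using that by (induction ws) auto
  have append: "?p (ws @ vs) = ?p ws \<otimes> ?p vs" if "set ws \<subseteq> carrier G" "set vs \<subseteq> carrier G" for ws vs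
    using that(1) by (induction ws) (use that(2) closed in \<open>auto simp: m_assoc\<close>)
  have "\<exists>ws. set ws \<subseteq> ?A \<and> g = ?p ws" if "g \<in> generate G S" for g
    using that
  proof induction
    case one
    then show ?case by (intro exI[of _ "[]"]) simp
  next
    case (incl h)
    then show ?case using assms(2) by (intro exI[of _ "[h]"]) auto
  next
    case (inv h)
    then show ?case using assms(2) by (intro exI[of _ "[inv h]"]) auto
  next
    case (eng g h)
    then obtain ws vs where w: "set ws \<subseteq> ?A" "g = ?p ws" "set vs \<subseteq> ?A" "h = ?p vs" by blast
    then have "set ws \<subseteq> carrier G" "set vs \<subseteq> carrier G" using A by blast+
    then show ?case using w append by (intro exI[of _ "ws @ vs"]) simp
  qed
  then have "generate G S \<subseteq> ?p ` lists ?A" by (auto simp: lists_eq_set)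
  moreover have "countable (?p ` lists ?A)" using assms(1) by (intro countable_image countable_lists) auto
  ultimately show ?thesis by (rule countable_subset)
qed

lemma (in group) pow_inj:
  assumes g: "g \<in> carrier G" and inf: "\<And>n::nat. n > 0 \<Longrightarrow> g [^] n \<noteq> \<one>"
  shows "inj (\<lambda>n::nat. g [^] n)"
proof -
  have "g [^] m \<noteq> g [^] n" if "m < n" for m n :: nat
  proof
    assume eq: "g [^] m = g [^] n"
    have "g [^] n = g [^] m \<otimes> g [^] (n - m)" using nat_pow_mult[OF g, of m "n - m"] that by simp
    then have "g [^] (n - m) = \<one>"
      using eq g l_cancel_one'[of "g [^] m" "g [^] (n - m)"] by (metis l_cancel_one nat_pow_closed)
    then show False using inf that by simp
  qed
  then show ?thesis by (intro injI) (metis linorder_neqE_nat)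
qed

text \<open>The orbit of the cyclic vector lies in a compact set, so along a subsequence the vectors are
  close to each other.\<close>

lemma (in group) finite_character_recurrence:
  assumes \<alpha>: "coordinate_gns G \<alpha> n \<pi> \<xi>" "\<alpha> \<in> characters G" and x: "\<And>k. x k \<in> carrier G"
  shows "\<exists>r N. strict_mono (r :: nat \<Rightarrow> nat)
    \<and> (\<forall>k\<ge>N. \<forall>l\<ge>N. 1/2 \<le> Re (\<alpha> (inv (x (r l)) \<otimes> x (r k))))"
proof -
  have \<pi>: "\<pi> \<in> reps_of_dim G n" "\<xi> \<in> euclidean_Cn n"
      "\<And>g. g \<in> carrier G \<Longrightarrow> \<alpha> g = ell2_inner (\<pi> g \<xi>) \<xi>"
    using \<alpha>(1) unfolding coordinate_gns_def by blast+
  define v where "v k = \<pi> (x k) \<xi>" for k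
  have v: "\<alpha> (inv (x l) \<otimes> x k) = (\<Sum>i<n. v k i * cnj (v l i))" for k l
    using \<pi>(3)[of "inv (x l) \<otimes> x k"] rep_matrix_coefficient[OF \<pi>(1,2) x x] x unfolding v_def by simp
  have unit: "(\<Sum>i<n. v k i * cnj (v k i)) = 1" for k
    using v[of k k] x[of k] charactersD(3)[OF \<alpha>(2)] by simp
  have bound: "cmod (v k i) \<le> 1" if "i < n" for k i
  proof -
    have "complex_of_real (\<Sum>i<n. (cmod (v k i))\<^sup>2) = of_real 1"
      using unit[of k] by (simp only: of_real_sum complex_norm_square of_real_1)
    then have "(\<Sum>i<n. (cmod (v k i))\<^sup>2) = 1" by (simp only: of_real_eq_iff)
    moreover have "(cmod (v k i))\<^sup>2 \<le> (\<Sum>i<n. (cmod (v k i))\<^sup>2)"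
      using that by (intro member_le_sum) auto
    ultimately show ?thesis by (simp add: abs_square_le_1)
  qed
  obtain r where r: "strict_mono (r :: nat \<Rightarrow> nat)"
      "\<And>i. i \<in> {..<n} \<Longrightarrow> \<exists>l. (\<lambda>k. v (r k) i) \<longlonglongrightarrow> l"
    using function_convergent_subsequence[of "{..<n}" v 1] bound by auto
  then obtain l where l: "\<And>i. i \<in> {..<n} \<Longrightarrow> (\<lambda>k. v (r k) i) \<longlonglongrightarrow> l i" by metis
  \<comment> \<open>Two vectors within \<delta> of the limit in each of \<open>n\<close> coordinates
    change the inner product by at most \<open>2 * \<delta> * n\<close>, which is at most 1/2;
    \<open>n + 1\<close> avoids division by 0.\<close>
  define \<delta> where "\<delta> = 1 / (4 * (real n + 1))"
  have \<delta>: "\<delta> > 0" by (simp add: \<delta>_def)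
  have "\<forall>\<^sub>F k in sequentially. \<forall>i\<in>{..<n}. dist (v (r k) i) (l i) < \<delta>"
    using tendstoD[OF l \<delta>] by (intro eventually_ball_finite) auto
  then obtain N where N: "\<And>k i. k \<ge> N \<Longrightarrow> i < n \<Longrightarrow> dist (v (r k) i) (l i) < \<delta>"
    unfolding eventually_sequentially by blast
  have "1/2 \<le> Re (\<alpha> (inv (x (r m)) \<otimes> x (r k)))" if "k \<ge> N" "m \<ge> N" for k m
  proof -
    \<comment> \<open>Write 1 as the inner product of the unit vector \<open>v (r m)\<close> with
      itself.\<close>
    have "\<alpha> (inv (x (r m)) \<otimes> x (r k)) - 1 = (\<Sum>i<n. (v (r k) i - v (r m) i) * cnj (v (r m) i))"
      unfolding v by (subst unit[of "r m", symmetric]) (simp add: sum_subtractf left_diff_distrib)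
    also have "cmod \<dots> \<le> (\<Sum>i<n. 2 * \<delta>)"
    proof (rule order_trans[OF norm_sum sum_mono])
      fix i assume "i \<in> {..<n}"
      then have i: "i < n" by simp
      have "cmod (v (r k) i - v (r m) i) \<le> 2 * \<delta>"
        using N[OF that(1) i] N[OF that(2) i] dist_triangle2[of "v (r k) i" "v (r m) i" "l i"]
        by (simp add: dist_norm)
      then have "cmod (v (r k) i - v (r m) i) * cmod (v (r m) i) \<le> 2 * \<delta> * 1"
        using bound[OF i] \<delta> by (intro mult_mono) auto
      then show "cmod ((v (r k) i - v (r m) i) * cnj (v (r m) i)) \<le> 2 * \<delta>" by (simp add: norm_mult)
    qed
    also have "\<dots> \<le> 1/2" by (simp add: \<delta>_def field_simps)
    finally have "\<bar>Re (\<alpha> (inv (x (r m)) \<otimes> x (r k)) - 1)\<bar> \<le> 1/2"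
      using abs_Re_le_cmod order_trans by blast
    then show ?thesis unfolding minus_complex.sel one_complex.sel by linarith
  qed
  then show ?thesis using r(1) by blast
qed

text \<open>Linear against quadratic growth: with all coefficients 1 the form of \<phi> on
  \<open>m\<close> points reduces to its diagonal, whereas \<alpha> has real part at least 1/2 in
  all \<open>m * m\<close> places and the nonnegative form of \<psi> cannot cancel this.\<close>

lemma (in group) dominating_character_not_orthogonal:
  assumes \<phi>: "\<phi> \<in> characters G" "\<phi> = convex_comb t \<alpha> \<psi>" and t: "0 < t" "t \<le> 1" and \<psi>: "\<psi> \<in> characters G"
    and x: "\<And>k. x k \<in> carrier G" "inj_on x Y" and Y: "infinite Y"
    and re: "\<And>k l. k \<in> Y \<Longrightarrow> l \<in> Y \<Longrightarrow> 1/2 \<le> Re (\<alpha> (inv (x l) \<otimes> x k))"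
    and zero: "\<And>k l. k \<in> Y \<Longrightarrow> l \<in> Y \<Longrightarrow> k \<noteq> l \<Longrightarrow> \<phi> (inv (x l) \<otimes> x k) = 0"
  shows False
proof -
  \<comment> \<open>Chosen to contradict the inequality \<open>t * (m * (m / 2)) \<le> m\<close>
    reached below.\<close>
  obtain m :: nat where m: "2 / t < real m" using reals_Archimedean2 by blast
  obtain T where T: "finite T" "card T = m" "T \<subseteq> Y" using infinite_arbitrarily_large[OF Y] by blast
  have form: "pd_form G (x ` T) (\<lambda>_. 1) \<rho> = (\<Sum>k\<in>T. \<Sum>l\<in>T. \<rho> (inv (x l) \<otimes> x k))" for \<rho>
    unfolding pd_form_def using inj_on_subset[OF x(2) T(3)] by (simp add: sum.reindex)
  have "pd_form G (x ` T) (\<lambda>_. 1) \<phi> = (\<Sum>k\<in>T. \<Sum>l\<in>T. if l = k then 1 else 0)"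
    unfolding form
  proof (intro sum.cong refl)
    fix k l assume "k \<in> T" "l \<in> T"
    then show "\<phi> (inv (x l) \<otimes> x k) = (if l = k then 1 else 0)"
      using T(3) zero[of k l] x(1)[of k] charactersD(3)[OF \<phi>(1)] by auto
  qed
  also have "\<dots> = of_nat m" using T(1,2) by simp
  finally have "Re (pd_form G (x ` T) (\<lambda>_. 1) \<phi>) = real m" by simp
  moreover have "pd_form G (x ` T) (\<lambda>_. 1) \<phi>
      = of_real t * pd_form G (x ` T) (\<lambda>_. 1) \<alpha> + of_real (1 - t) * pd_form G (x ` T) (\<lambda>_. 1) \<psi>"
    unfolding \<phi>(2) convex_comb_def by (rule pd_form_lincomb)
  ultimately have eq: "real m = t * Re (pd_form G (x ` T) (\<lambda>_. 1) \<alpha>)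
      + (1 - t) * Re (pd_form G (x ` T) (\<lambda>_. 1) \<psi>)" by simp
  have "pd_form G (x ` T) (\<lambda>_. 1) \<psi> \<in> \<real>\<^sub>\<ge>\<^sub>0" using T(1) x(1) by (intro charactersD(5)[OF \<psi>]) auto
  then have "0 \<le> (1 - t) * Re (pd_form G (x ` T) (\<lambda>_. 1) \<psi>)"
    using t(2) by (intro mult_nonneg_nonneg) (auto simp: complex_nonneg_Reals_iff)
  moreover have "Re (pd_form G (x ` T) (\<lambda>_. 1) \<alpha>) \<ge> (\<Sum>k\<in>T. \<Sum>l\<in>T. 1/2)"
    unfolding form Re_sum using re T(3) by (intro sum_mono) blast
  then have "Re (pd_form G (x ` T) (\<lambda>_. 1) \<alpha>) \<ge> real m * (real m / 2)" using T(2) by simp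
  then have "t * Re (pd_form G (x ` T) (\<lambda>_. 1) \<alpha>) \<ge> t * (real m * (real m / 2))"
    using t(1) by simp
  ultimately have "t * (real m * (real m / 2)) \<le> real m" using eq by linarith
  moreover have "real m > 0" using m t(1) by (meson divide_pos_pos order_less_trans zero_less_numeral)
  ultimately have "t * real m \<le> 2" by (simp add: field_simps)
  then show False using m t(1) by (simp add: field_simps)
qed

lemma (in group) common_nonzero_value:
  assumes fin: "finite_character G \<alpha>" "finite_character G \<beta>"
    and \<phi>: "\<phi> \<in> characters G" "\<phi> = convex_comb s \<alpha> \<phi>'" "0 < s" "s \<le> 1" "\<phi>' \<in> characters G"
    and \<psi>: "\<psi> \<in> characters G" "\<psi> = convex_comb t \<beta> \<psi>'" "0 < t" "t \<le> 1" "\<psi>' \<in> characters G"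
    and g: "g \<in> carrier G" "\<And>n::nat. n > 0 \<Longrightarrow> g [^] n \<noteq> \<one>"
  shows "\<exists>x\<in>carrier G. x \<noteq> \<one> \<and> \<phi> x * \<psi> x \<noteq> 0"
proof (rule ccontr)
  assume "\<not> ?thesis"
  then have prod: "\<phi> x = 0 \<or> \<psi> x = 0" if "x \<in> carrier G" "x \<noteq> \<one>" for x using that by force
  have ch: "\<alpha> \<in> characters G" "\<beta> \<in> characters G" using fin by (simp_all add: finite_character_def)
  obtain n \<pi> \<xi> where \<alpha>: "coordinate_gns G \<alpha> n \<pi> \<xi>"
    using finite_character_coordinates[OF fin(1)] by blast
  obtain n' \<pi>' \<xi>' where \<beta>: "coordinate_gns G \<beta> n' \<pi>' \<xi>'"
    using finite_character_coordinates[OF fin(2)] by blast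
  obtain r N where r: "strict_mono (r :: nat \<Rightarrow> nat)"
      "\<And>k l. k \<ge> N \<Longrightarrow> l \<ge> N \<Longrightarrow> 1/2 \<le> Re (\<alpha> (inv (g [^] r l) \<otimes> g [^] r k))"
    using finite_character_recurrence[OF \<alpha> ch(1), of "\<lambda>k. g [^] k"] g(1) by auto
  \<comment> \<open>The second extraction starts from the sequence found for \<alpha>, so the final
    powers return for both characters. Which of the two bounds is used is decided only by the
    colouring.\<close>
  obtain r' N' where r': "strict_mono (r' :: nat \<Rightarrow> nat)"
      "\<And>k l. k \<ge> N' \<Longrightarrow> l \<ge> N' \<Longrightarrow> 1/2 \<le> Re (\<beta> (inv (g [^] r (r' l)) \<otimes> g [^] r (r' k)))"
    using finite_character_recurrence[OF \<beta> ch(2), of "\<lambda>k. g [^] r k"] g(1) by auto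
  define x where "x k = g [^] r (r' k)" for k
  have x: "x k \<in> carrier G" for k using g(1) by (simp add: x_def)
  have inj: "inj x"
    using pow_inj[OF g] strict_mono_imp_inj_on[OF r(1)] strict_mono_imp_inj_on[OF r'(1)]
    unfolding x_def inj_def by blast
  define Z where "Z = {max N N'..}"
  have "infinite Z" by (simp add: Z_def infinite_Ici)
  \<comment> \<open>Ramsey's theorem colours unordered pairs, while \<phi> is evaluated at
    \<open>inv (x l) \<otimes> x k\<close> and at its inverse. Colour 0 asks both values to vanish;
    as they are conjugate, colour 1 means that both are nonzero, so that \<psi> must vanish
    there.\<close>
  define col where "col P = (if \<forall>k\<in>P. \<forall>l\<in>P. k \<noteq> l \<longrightarrow> \<phi> (inv (x l) \<otimes> x k) = 0 then 0 else 1 :: nat)" for P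
  have "\<forall>k\<in>Z. \<forall>l\<in>Z. k \<noteq> l \<longrightarrow> col {k, l} < 2" by (simp add: col_def)
  from Ramsey2[OF \<open>infinite Z\<close> this] obtain Y c where Y: "Y \<subseteq> Z" "infinite Y" "c < 2"
      "\<forall>k\<in>Y. \<forall>l\<in>Y. k \<noteq> l \<longrightarrow> col {k, l} = c" by blast
  have re: "1/2 \<le> Re (\<alpha> (inv (x l) \<otimes> x k))" "1/2 \<le> Re (\<beta> (inv (x l) \<otimes> x k))"
    if "k \<in> Y" "l \<in> Y" for k l
  proof -
    have "k \<ge> N" "k \<ge> N'" "l \<ge> N" "l \<ge> N'" using that Y(1) by (auto simp: Z_def)
    \<comment> \<open>The bound \<open>N\<close> belongs to the indices of the first extraction,
      which are now \<open>r' k\<close> and \<open>r' l\<close>.\<close>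
    moreover have "r' k \<ge> k" "r' l \<ge> l" using strict_mono_imp_increasing[OF r'(1)] by auto
    ultimately show "1/2 \<le> Re (\<alpha> (inv (x l) \<otimes> x k))" "1/2 \<le> Re (\<beta> (inv (x l) \<otimes> x k))"
      using r(2)[of "r' k" "r' l"] r'(2)[of k l] by (auto simp: x_def)
  qed
  have injY: "inj_on x Y" using inj by (rule inj_on_subset) simp
  consider "c = 0" | "c = 1" using Y(3) by linarith
  then show False
  proof cases
    case 1
    have "\<phi> (inv (x l) \<otimes> x k) = 0" if "k \<in> Y" "l \<in> Y" "k \<noteq> l" for k l
    proof (rule ccontr)
      assume "\<phi> (inv (x l) \<otimes> x k) \<noteq> 0"
      then have "col {k, l} = 1" using that(3) unfolding col_def by auto
      then show False using Y(4) that 1 by simp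
    qed
    then show False
      using dominating_character_not_orthogonal[OF \<phi>(1,2,3,4,5) x injY Y(2) re(1)] by blast
  next
    case 2
    have "\<psi> (inv (x l) \<otimes> x k) = 0" if "k \<in> Y" "l \<in> Y" "k \<noteq> l" for k l
    proof -
      have "\<not> (\<forall>a\<in>{k, l}. \<forall>b\<in>{k, l}. a \<noteq> b \<longrightarrow> \<phi> (inv (x b) \<otimes> x a) = 0)"
        using Y(4) that 2 unfolding col_def by (metis zero_neq_one)
      then have "\<phi> (inv (x l) \<otimes> x k) \<noteq> 0 \<or> \<phi> (inv (x k) \<otimes> x l) \<noteq> 0" by auto
      moreover have "inv (x k) \<otimes> x l = inv (inv (x l) \<otimes> x k)" using x by (simp add: inv_mult_group)
      then have "\<phi> (inv (x k) \<otimes> x l) = cnj (\<phi> (inv (x l) \<otimes> x k))"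
        using character_hermitian(1)[OF \<phi>(1)] x by simp
      ultimately have "\<phi> (inv (x l) \<otimes> x k) \<noteq> 0" by auto
      moreover have "inv (x l) \<otimes> x k \<noteq> \<one>"
      proof
        assume "inv (x l) \<otimes> x k = \<one>"
        then have "x k = x l" using x by (metis inv_closed inv_equality inv_inv)
        then show False using inj that(3) by (simp add: inj_eq)
      qed
      ultimately show ?thesis using prod[of "inv (x l) \<otimes> x k"] x by auto
    qed
    then show False
      using dominating_character_not_orthogonal[OF \<psi>(1,2,3,4,5) x injY Y(2) re(2)] by blast
  qed
qed

theorem proposition3p19:
  fixes G :: "('a, 'b) monoid_scheme" and S :: "'a set" and \<gamma> :: 'a
  assumes "group G"
    and "finite S" and "S \<subseteq> carrier G" and "generate G S = carrier G"
    and "charfinite G"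
    and "amenable_radical G = {\<one>\<^bsub>G\<^esub>}"
    and "\<gamma> \<in> carrier G"
    and "\<forall>n::nat. n > 0 \<longrightarrow> \<gamma> [^]\<^bsub>G\<^esub> n \<noteq> \<one>\<^bsub>G\<^esub>"
    and "distorted G S \<gamma>"
  shows "nonfactorizable_regular_character G"
proof -
  interpret group G by (rule assms(1))
  let ?D = "{\<phi>. extremal_character G \<phi> \<and> finite_character G \<phi>}"
  have cnt: "countable (carrier G)"
    using countable_generate[OF countable_finite[OF assms(2)] assms(3)] assms(4) by simp
  have D: "countable ?D"
    using assms(5) by (intro countable_extremal_finite_characters) (simp add: charfinite_def)
  \<comment> \<open>Condition (b) leaves two cases. Von Neumann amenability includes amenability of
    the character, so (e) makes it finite; otherwise the character is supported on the trivial
    radical, and normalization makes it \<open>dirac G\<close>.\<close>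
  have ext: "\<alpha> = dirac G \<or> \<alpha> \<in> ?D" if \<alpha>: "extremal_character G \<alpha>" for \<alpha>
  proof (cases "von_neumann_amenable_character G \<alpha>")
    case True
    then have "amenable_character G \<alpha>"
      unfolding von_neumann_amenable_character_def amenable_character_def by blast
    then have "finite_character G \<alpha>" using \<alpha> assms(5) unfolding charfinite_def by blast
    then show ?thesis using \<alpha> by simp
  next
    case False
    then have "\<forall>x. x \<notin> amenable_radical G \<longrightarrow> \<alpha> x = 0"
      using \<alpha> assms(5) unfolding charfinite_def by blast
    moreover have "\<alpha> \<one>\<^bsub>G\<^esub> = 1" using \<alpha> charactersD(3) unfolding extremal_character_def by blast
    ultimately show ?thesis unfolding assms(6) by (auto simp: dirac_def fun_eq_iff)
  qed
  have DK: "?D \<subseteq> characters G" by (auto simp: extremal_character_def)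
  show ?thesis
    unfolding nonfactorizable_regular_character_def
  proof (intro ballI impI, rule ccontr)
    fix \<phi> \<psi> assume ch: "\<phi> \<in> characters G" "\<psi> \<in> characters G"
      and prod: "\<forall>s\<in>carrier G. s \<noteq> \<one>\<^bsub>G\<^esub> \<longrightarrow> \<phi> s * \<psi> s = 0"
      and ne: "\<not> (\<phi> = dirac G \<or> \<psi> = dirac G)"
    obtain \<alpha> s \<phi>' where \<alpha>: "\<alpha> \<in> ?D" "0 < s" "s \<le> 1" "\<phi>' \<in> characters G" "\<phi> = convex_comb s \<alpha> \<phi>'"
      using character_dominates_extremal[OF cnt D ext DK ch(1)] ne by blast
    obtain \<beta> t \<psi>' where \<beta>: "\<beta> \<in> ?D" "0 < t" "t \<le> 1" "\<psi>' \<in> characters G" "\<psi> = convex_comb t \<beta> \<psi>'"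
      using character_dominates_extremal[OF cnt D ext DK ch(2)] ne by blast
    have fin: "finite_character G \<alpha>" "finite_character G \<beta>" using \<alpha>(1) \<beta>(1) by auto
    have "\<gamma> [^]\<^bsub>G\<^esub> n \<noteq> \<one>\<^bsub>G\<^esub>" if "n > 0" for n :: nat using assms(8) that by blast
    then show False
      using common_nonzero_value[OF fin ch(1) \<alpha>(5,2,3,4) ch(2) \<beta>(5,2,3,4) assms(7)] prod by blast
  qed
qed

end
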